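(* Let $G$ be a simple plane graph on $n\geq 6$ vertices with minimum degree $\delta(G)\geq 3$ that contains neither $K_4$ nor $C_6$ as a subgraph. Then $e(G)\leq \frac{7}{3}(n-2)$.
   Context: $K_4$ is the complete graph on $4$ vertices, $C_6$ the cycle on $6$ vertices; $e(G)$ is the number of edges of $G$. *)

theory Defs
  imports "HOL-Analysis.Analysis"
begin

definition simple_graph :: "'a set \<Rightarrow> 'a set set \<Rightarrow> bool" where
  "simple_graph V E \<longleftrightarrow> finite V \<and> (\<forall>e\<in>E. e \<subseteq> V \<and> card e = 2)"

definition degree :: "'a set set \<Rightarrow> 'a \<Rightarrow> nat" where
  "degree E v = card {e\<in>E. v \<in> e}"

definition planar :: "'a set \<Rightarrow> 'a set set \<Rightarrow> bool" where
  "planar V E \<longleftrightarrow>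
    (\<exists>(pos :: 'a \<Rightarrow> complex) (curve :: 'a set \<Rightarrow> real \<Rightarrow> complex).
       inj_on pos V \<and>
       (\<forall>e\<in>E. arc (curve e) \<and>
                {pathstart (curve e), pathfinish (curve e)} = pos ` e \<and>
                path_image (curve e) \<inter> pos ` V = pos ` e) \<and>
       (\<forall>e\<in>E. \<forall>e'\<in>E. e \<noteq> e' \<longrightarrow>
                path_image (curve e) \<inter> path_image (curve e') \<subseteq> pos ` (e \<inter> e')))"

definition contains_K4 :: "'a set \<Rightarrow> 'a set set \<Rightarrow> bool" where
  "contains_K4 V E \<longleftrightarrow> (\<exists>f :: nat \<Rightarrow> 'a. inj_on f {0..<4} \<and> f ` {0..<4} \<subseteq> V \<and>
      (\<forall>i<4. \<forall>j<4. i \<noteq> j \<longrightarrow> {f i, f j} \<in> E))"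

definition contains_C6 :: "'a set \<Rightarrow> 'a set set \<Rightarrow> bool" where
  "contains_C6 V E \<longleftrightarrow> (\<exists>f :: nat \<Rightarrow> 'a. inj_on f {0..<6} \<and> f ` {0..<6} \<subseteq> V \<and>
      (\<forall>i<6. {f i, f ((i + 1) mod 6)} \<in> E))"

end

theory Submission
  imports Defs
begin

text \<open>
  By Euler's formula the bound amounts to \<open>7 f \<le> 4 e\<close> for the number \<open>f\<close> of faces, that is, to an
  average face length of at least \<open>7/2\<close>. A face of length \<open>k\<close> has charge \<open>2 k - 7\<close> and sends it in
  equal parts through its edges to the adjacent triangles, each of which lacks 1. Without \<open>K\<^sub>4\<close> and
  \<open>C\<^sub>6\<close> the triangles cluster in fans of at most three triangles around a vertex or in wheels
  with four spokes, and a case analysis shows that each cluster receives enough.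

  A vertex of degree at most 2 and a separation along at most one vertex are removed by induction,
  so the drawing may be taken 2-connected. Its faces are the components of the complement, and
  everything about them comes from two theorems: the Jordan curve theorem gives faces on both sides
  of an edge of a cycle, and Janiszewski's theorem shows that there is only one on each side.
\<close>


section \<open>Cycles and even edge sets\<close>

text \<open>Facial walks are avoided. A face only gets the set of edges whose removal would merge it
  with another face, and three facts about these sets do their work: every edge lies in exactly two
  of them, each has even degree at every vertex, and the faces around a vertex hang together. The
  last two come from counting modulo 2 the faces inside a cycle. An even set contains a cycle and
  leaves an even rest, which pins down the boundaries of short faces; long faces have charge to
  spare. The tight spot is the quadrilateral: it has charge 1 but may border three triangles, which
  then get only 1/3 each. These triangles form a fan whose middle one runs short, and its two
  neighbours have to pay for it. The bound fails for some graphs on fewer than six vertices, for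
  instance a wheel with four spokes, so the induction carries separate bounds for small
  graphs.\<close>

fun ledges :: "'a list \<Rightarrow> 'a set set" where
  "ledges (x # y # p) = insert {x, y} (ledges (y # p))"
| "ledges _ = {}"

definition upath :: "'a set set \<Rightarrow> 'a \<Rightarrow> 'a list \<Rightarrow> 'a \<Rightarrow> bool" where
  "upath E u p v \<longleftrightarrow> p \<noteq> [] \<and> distinct p \<and> hd p = u \<and> last p = v \<and> ledges p \<subseteq> E"

text \<open>Cycles are edge sets rather than closed walks so that they can be compared with stars
  and boundaries. At least three vertices keep the closing edge out of
  \<open>ledges p\<close>.\<close>

definition is_cycle :: "'a set set \<Rightarrow> bool" where
  "is_cycle C \<longleftrightarrow>
    (\<exists>p. distinct p \<and> 3 \<le> length p \<and> C = insert {last p, hd p} (ledges p))"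

definition adj_rel :: "'a set set \<Rightarrow> ('a \<times> 'a) set" where
  "adj_rel E = {(x, y). {x, y} \<in> E}"

definition star :: "'a set set \<Rightarrow> 'a \<Rightarrow> 'a set set" where
  "star E v = {e \<in> E. v \<in> e}"

lemma finite_ledges [simp]: "finite (ledges p)"
  by (induction p rule: ledges.induct) auto

lemma ledges_subset_set: "e \<in> ledges p \<Longrightarrow> e \<subseteq> set p"
  by (induction p rule: ledges.induct) auto

lemma ledges_append:
  "p \<noteq> [] \<Longrightarrow> q \<noteq> [] \<Longrightarrow>
    ledges (p @ q) = ledges p \<union> {{last p, hd q}} \<union> ledges q"
proof (induction p rule: ledges.induct)
  case (1 x y p)
  then show ?case by auto
next
  case ("2_2" v)
  then show ?case by (cases q) auto
qed simp

lemma ledges_split: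
  "e \<in> ledges p \<Longrightarrow> \<exists>xs a b ys. p = xs @ a # b # ys \<and> e = {a, b}"
proof (induction p rule: ledges.induct)
  case (1 x y p)
  then consider "e = {x, y}" | "e \<in> ledges (y # p)" by auto
  then show ?case
  proof cases
    case 1
    then show ?thesis by (intro exI[of _ "[]"]) auto
  next
    case 2
    then obtain xs a b ys where "y # p = xs @ a # b # ys" "e = {a, b}"
      using "1.IH" by blast
    then show ?thesis by (intro exI[of _ "x # xs"]) auto
  qed
qed auto

lemma hd_last_notin_ledges:
  assumes "distinct p" "3 \<le> length p"
  shows "{last p, hd p} \<notin> ledges p"
proof -
  obtain x y z q where p: "p = x # y # z # q"
    using assms(2) by (auto simp: numeral_3_eq_3 Suc_le_length_iff)
  have "{last p, x} \<notin> ledges (y # z # q)"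
    using ledges_subset_set[of "{last p, x}" "y # z # q"] assms(1) p by auto
  moreover have "last p \<noteq> y"
    using assms(1) p last_in_set[of "z # q"] by auto
  moreover have "last p \<noteq> x"
    using assms(1) p last_in_set[of "z # q"] by auto
  ultimately show ?thesis
    using p by (auto simp: doubleton_eq_iff)
qed

lemma card_ledges: "distinct p \<Longrightarrow> card (ledges p) = length p - 1"
proof (induction p rule: ledges.induct)
  case (1 x y p)
  have "{x, y} \<notin> ledges (y # p)"
    using ledges_subset_set[of "{x, y}" "y # p"] 1(2) by auto
  then show ?case using 1 by auto
qed auto

lemma star_insert:
  "star (insert e E) w = (if w \<in> e then insert e (star E w) else star E w)"
  by (auto simp: star_def)

lemma odd_degree_ledges:
  "distinct p \<Longrightarrow> p \<noteq> [] \<Longrightarrow>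
    odd (card (star (ledges p) w)) \<longleftrightarrow> ((w = hd p) \<noteq> (w = last p))"
proof (induction p rule: ledges.induct)
  case (1 x y p)
  have "{x, y} \<notin> star (ledges (y # p)) w"
    using ledges_subset_set[of "{x, y}" "y # p"] 1(2) by (auto simp: star_def)
  moreover have "finite (star (ledges (y # p)) w)"
    by (simp add: star_def)
  ultimately have "card (star (ledges (x # y # p)) w) =
      card (star (ledges (y # p)) w) + (if w \<in> {x, y} then 1 else 0)"
    by (simp add: star_insert)
  moreover have "x \<noteq> last (y # p)" "x \<noteq> y"
    using 1(2) last_in_set[of "y # p"] by auto
  ultimately show ?case
    using 1 by (auto split: if_splits)
qed (auto simp: star_def)

text \<open>Any edge becomes the closing edge by rotating the vertex list: cut the list between the
  two ends of the edge and swap the pieces.\<close>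

lemma is_cycle_through:
  assumes "is_cycle C" "e \<in> C"
  obtains p u v where "upath (C - {e}) u p v" "e = {u, v}" "u \<noteq> v"
    "C = insert e (ledges p)" "e \<notin> ledges p" "3 \<le> length p"
proof -
  obtain p where p: "distinct p" "3 \<le> length p" "C = insert {last p, hd p} (ledges p)"
    using assms(1) by (auto simp: is_cycle_def)
  show ?thesis
  proof (cases "e = {last p, hd p}")
    case True
    have "hd p \<noteq> last p"
      using p(1,2) by (cases p) (auto simp: last_in_set)
    with True p hd_last_notin_ledges[OF p(1,2)] show ?thesis
      by (intro that[of "hd p" p "last p"]) (auto simp: upath_def)
  next
    case False
    then obtain xs a b ys where s: "p = xs @ a # b # ys" "e = {a, b}"
      using assms(2) p(3) ledges_split by blast
    define q where "q = (b # ys) @ (xs @ [a])"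
    have lq: "ledges q = ledges (b # ys) \<union> {{last p, hd p}} \<union> ledges (xs @ [a])"
      unfolding q_def by (subst ledges_append) (use s in \<open>auto simp: hd_append\<close>)
    have "ledges p = ledges (xs @ [a]) \<union> {{a, b}} \<union> ledges (b # ys)"
      using ledges_append[of "xs @ [a]" "b # ys"] s by auto
    then have C: "C = insert e (ledges q)"
      using p(3) lq s by auto
    have dq: "distinct q" "3 \<le> length q" "hd q = b" "last q = a" "q \<noteq> []"
      using p(1,2) s by (auto simp: q_def)
    then have "e \<notin> ledges q"
      using hd_last_notin_ledges[OF dq(1,2)] s(2) by simp
    with C dq s p(1) show ?thesis
      by (intro that[of b q a]) (auto simp: upath_def)
  qed
qed

text \<open>With \<open>{u, v}\<close> outside \<open>E\<close> the path cannot be that single edge,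
  so it has at least three vertices.\<close>

lemma is_cycle_closing:
  assumes "upath E u p v" "{u, v} \<notin> E" "u \<noteq> v"
  shows "is_cycle (insert {u, v} (ledges p))"
proof -
  have "3 \<le> length p"
  proof (rule ccontr)
    assume *: "\<not> 3 \<le> length p"
    show False
    proof (cases p rule: ledges.cases)
      case (1 x y q)
      with * have "q = []" by (cases q) auto
      with 1 assms show False by (auto simp: upath_def)
    qed (use assms in \<open>auto simp: upath_def\<close>)
  qed
  with assms(1) show ?thesis
    unfolding is_cycle_def by (intro exI[of _ p]) (auto simp: upath_def insert_commute)
qed

text \<open>A path has odd degree exactly at its two ends, and the closing edge adds one at
  both.\<close>

lemma even_degree_is_cycle:
  assumes "is_cycle C"
  shows "even (card (star C w))"
proof -
  obtain p where p: "distinct p" "3 \<le> length p" "C = insert {last p, hd p} (ledges p)"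
    using assms by (auto simp: is_cycle_def)
  have "p \<noteq> []" using p(2) by auto
  have ne: "hd p \<noteq> last p"
    using p(1,2) by (cases p) (auto simp: last_in_set)
  have "{last p, hd p} \<notin> star (ledges p) w"
    using hd_last_notin_ledges[OF p(1,2)] by (auto simp: star_def)
  moreover have "finite (star (ledges p) w)"
    by (simp add: star_def)
  ultimately have "card (star C w) =
      card (star (ledges p) w) + (if w \<in> {last p, hd p} then 1 else 0)"
    by (simp add: star_insert p(3))
  then show ?thesis
    using odd_degree_ledges[OF p(1) \<open>p \<noteq> []\<close>, of w] ne by (auto split: if_splits)
qed

lemma rtrancl_adj_upath:
  assumes "(u, v) \<in> (adj_rel E)\<^sup>*"
  shows "\<exists>p. upath E u p v"
  using assms
proof (induction rule: rtrancl_induct)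
  case base
  show ?case by (intro exI[of _ "[u]"]) (simp add: upath_def)
next
  case (step y z)
  then obtain p where p: "upath E u p y" by blast
  show ?case
  proof (cases "z \<in> set p")
    \<comment> \<open>\<open>p\<close> already visits \<open>z\<close>: keep only the initial piece
      up to \<open>z\<close>.\<close>
    case True
    then obtain xs ys where s: "p = xs @ z # ys" by (auto simp: in_set_conv_decomp)
    have "ledges (xs @ [z]) \<subseteq> ledges p"
      using s ledges_append[of "xs @ [z]" ys] by (cases "ys = []") auto
    with p s have "upath E u (xs @ [z]) z"
      by (auto simp: upath_def hd_append)
    then show ?thesis by blast
  next
    case False
    have "ledges (p @ [z]) = ledges p \<union> {{y, z}}"
      using p ledges_append[of p "[z]"] by (auto simp: upath_def)
    with p False step(2) have "upath E u (p @ [z]) z"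
      by (auto simp: upath_def adj_rel_def)
    then show ?thesis by blast
  qed
qed

lemma adj_rel_rtrancl_sym:
  "(u, v) \<in> (adj_rel E)\<^sup>* \<Longrightarrow> (v, u) \<in> (adj_rel E)\<^sup>*"
  by (rule symD[OF sym_rtrancl]) (auto simp: sym_def adj_rel_def insert_commute)

lemma cycle_through_edge:
  assumes "(u, v) \<in> (adj_rel (E - {{u, v}}))\<^sup>*" "{u, v} \<in> E" "u \<noteq> v"
  obtains C where "is_cycle C" "C \<subseteq> E" "{u, v} \<in> C"
proof -
  obtain p where p: "upath (E - {{u, v}}) u p v"
    using rtrancl_adj_upath[OF assms(1)] by blast
  with is_cycle_closing[OF p _ assms(3)] assms(2) show ?thesis
    by (intro that[of "insert {u, v} (ledges p)"]) (auto simp: upath_def)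
qed

lemma handshake:
  assumes "finite X" "finite A"
  shows "(\<Sum>w\<in>A. card (star X w)) = (\<Sum>e\<in>X. card (e \<inter> A))"
proof -
  have "(\<Sum>w\<in>A. card (star X w)) = (\<Sum>w\<in>A. \<Sum>e\<in>X. if w \<in> e then 1 else 0)"
    using assms by (intro sum.cong refl) (simp add: star_def Collect_conj_eq sum.If_cases Int_commute)
  also have "\<dots> = (\<Sum>e\<in>X. \<Sum>w\<in>A. if w \<in> e then 1 else 0)"
    by (rule sum.swap)
  also have "\<dots> = (\<Sum>e\<in>X. card (e \<inter> A))"
    using assms by (intro sum.cong refl) (simp add: sum.If_cases Int_commute)
  finally show ?thesis .
qed

text \<open>If the component \<open>A\<close> of \<open>b\<close> after deleting
  \<open>{a, b}\<close> missed \<open>a\<close>, then \<open>{a, b}\<close> would be the only edge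
  meeting \<open>A\<close> in exactly one vertex, and the degrees over \<open>A\<close>, all even,
  would have an odd sum.\<close>

lemma even_edge_set_cycle:
  assumes X: "finite X" "\<And>e. e \<in> X \<Longrightarrow> card e = 2"
    and ev: "\<And>w. even (card (star X w))"
    and ab: "{a, b} \<in> X"
  obtains C where "is_cycle C" "C \<subseteq> X" "{a, b} \<in> C"
proof -
  have "a \<noteq> b" using X(2)[OF ab] by auto
  let ?Y = "X - {{a, b}}"
  define A where "A = {w. (b, w) \<in> (adj_rel ?Y)\<^sup>*}"
  have edge_A: "e \<inter> A = {} \<or> e \<subseteq> A" if eY: "e \<in> ?Y" for e
  proof -
    obtain x y where e: "e = {x, y}" using X(2)[of e] eY by (auto simp: card_2_iff)
    with eY have "(x, y) \<in> adj_rel ?Y" "(y, x) \<in> adj_rel ?Y"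
      by (auto simp: adj_rel_def insert_commute)
    then show ?thesis
      unfolding e A_def by (auto intro: rtrancl_into_rtrancl)
  qed
  have "A \<subseteq> insert b (\<Union>X)"
  proof
    fix w assume "w \<in> A"
    then have "(b, w) \<in> (adj_rel ?Y)\<^sup>*" by (simp add: A_def)
    then show "w \<in> insert b (\<Union>X)"
      by (cases rule: rtranclE) (auto simp: adj_rel_def)
  qed
  moreover have "finite (insert b (\<Union>X))"
    using X by (metis card_ge_0_finite finite.insertI finite_Union zero_less_numeral)
  ultimately have finA: "finite A" using finite_subset by blast
  have "a \<in> A"
  proof (rule ccontr)
    assume "a \<notin> A"
    moreover have "b \<in> A" by (simp add: A_def)
    ultimately have ab1: "card ({a, b} \<inter> A) = 1" by simp
    have "even (card (e \<inter> A))" if "e \<in> ?Y" for e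
      using edge_A[OF that] X(2)[of e] that by (auto simp: Int_absorb2)
    then have "even (\<Sum>e\<in>?Y. card (e \<inter> A))" by (rule dvd_sum)
    moreover have "(\<Sum>e\<in>X. card (e \<inter> A)) = 1 + (\<Sum>e\<in>?Y. card (e \<inter> A))"
      using ab1 ab X(1) by (simp add: sum.remove)
    moreover have "even (\<Sum>w\<in>A. card (star X w))" by (intro dvd_sum ev)
    ultimately show False using handshake[OF X(1) finA] by simp
  qed
  then have "(a, b) \<in> (adj_rel ?Y)\<^sup>*"
    using adj_rel_rtrancl_sym by (auto simp: A_def)
  from cycle_through_edge[OF this ab \<open>a \<noteq> b\<close>] that show ?thesis by blast
qed

text \<open>Deleting an edge of a forest cuts \<open>V\<close> into the part still reachable from
  one end and the rest; induction applies to both.\<close>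

lemma acyclic_card_le:
  assumes "finite V" "V \<noteq> {}" "\<forall>e\<in>T. e \<subseteq> V \<and> card e = 2"
    and "\<And>C. is_cycle C \<Longrightarrow> \<not> C \<subseteq> T"
  shows "card T + 1 \<le> card V"
  using assms
proof (induction "card V" arbitrary: V T rule: less_induct)
  case less
  have finT: "finite T"
    using less.prems(1,3) finite_subset[of T "Pow V"] by blast
  show ?case
  proof (cases "T = {}")
    case True
    with less.prems show ?thesis by (simp add: Suc_le_eq card_gt_0_iff)
  next
    case False
    then obtain u v where uv: "{u, v} \<in> T" "u \<noteq> v"
      using less.prems(3) by (metis all_not_in_conv card_2_iff)
    let ?S = "T - {{u, v}}"
    define A where "A = {w \<in> V. (u, w) \<in> (adj_rel ?S)\<^sup>*}"
    have "v \<notin> A"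
      using cycle_through_edge[of u v T] uv less.prems(4) by (auto simp: A_def)
    have uA: "u \<in> A" "v \<in> V" using uv less.prems(3) by (auto simp: A_def)
    have edge_A: "e \<subseteq> V - A \<or> e \<subseteq> A" if eS: "e \<in> ?S" for e
    proof -
      obtain x y where e: "e = {x, y}" "x \<in> V" "y \<in> V"
        using less.prems(3) eS by (metis DiffD1 card_2_iff insert_subset)
      with eS have "(x, y) \<in> adj_rel ?S" "(y, x) \<in> adj_rel ?S"
        by (auto simp: adj_rel_def insert_commute)
      then show ?thesis
        unfolding A_def using e by (auto intro: rtrancl_into_rtrancl)
    qed
    let ?T1 = "{e \<in> ?S. e \<subseteq> A}" and ?T2 = "{e \<in> ?S. e \<subseteq> V - A}"
    have "card A < card V" "card (V - A) < card V"
      using less.prems(1) uA \<open>v \<notin> A\<close>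
      by (auto intro!: psubset_card_mono simp: A_def)
    moreover have "card ?T1 + 1 \<le> card A"
      by (rule less.hyps) (use less.prems calculation uA in \<open>auto simp: A_def\<close>)
    moreover have "card ?T2 + 1 \<le> card (V - A)"
      by (rule less.hyps) (use less.prems calculation uA \<open>v \<notin> A\<close> in \<open>auto simp: A_def\<close>)
    moreover have "T = insert {u, v} (?T1 \<union> ?T2)"
      using edge_A uv by blast
    then have "card T \<le> Suc (card (?T1 \<union> ?T2))"
      using card_insert_le_m1[of "Suc (card (?T1 \<union> ?T2))" "?T1 \<union> ?T2" "{u, v}"] by simp
    moreover have "card (?T1 \<union> ?T2) \<le> card ?T1 + card ?T2" by (rule card_Un_le)
    moreover have "card V = card A + card (V - A)"
      using less.prems(1) card_Diff_subset[of A V] card_mono[of V A] by (auto simp: A_def)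
    ultimately show ?thesis by linarith
  qed
qed

section \<open>Plane drawings\<close>

text \<open>An arc has dimension one, so this is invariance of dimension. It later supplies a point
  next to a bridge but off its curve.\<close>

lemma open_subset_arc_empty:
  fixes g :: "real \<Rightarrow> complex"
  assumes "arc g" "open S" "S \<subseteq> path_image g"
  shows "S = {}"
proof (rule ccontr)
  assume "S \<noteq> {}"
  have "path_image g homeomorphic {0..1::real}"
    using homeomorphic_arc_image_interval[OF assms(1), of 0 1] by simp
  then obtain f h where fh: "homeomorphism (path_image g) {0..1::real} f h"
    by (auto simp: homeomorphic_def)
  then have "continuous_on S f" "inj_on f S"
    using assms(3) continuous_on_subset homeomorphism_apply1[OF fh]
    by (auto simp: homeomorphism_def intro!: inj_on_inverseI[of S h])
  from invariance_of_dimension[OF this(1) assms(2) this(2) \<open>S \<noteq> {}\<close>] show False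
    by simp
qed

lemma arc_subset_closure_interior:
  fixes g :: "real \<Rightarrow> complex"
  assumes "arc g"
  shows "path_image g \<subseteq> closure (path_image g - {pathstart g, pathfinish g})"
proof -
  have "g ` closure {0<..<1} \<subseteq> closure (g ` {0<..<1})"
    by (rule continuous_image_closure_subset[of "{0..1}"])
      (use assms in \<open>auto simp: arc_def path_def\<close>)
  then show ?thesis
    using simple_path_endless[OF arc_imp_simple_path[OF assms]]
    by (simp add: path_image_def)
qed

locale plane_drawing =
  fixes V :: "'a set" and E :: "'a set set"
    and pos :: "'a \<Rightarrow> complex" and curve :: "'a set \<Rightarrow> real \<Rightarrow> complex"
  assumes simple: "simple_graph V E"
    and arc_curve: "\<And>e. e \<in> E \<Longrightarrow> arc (curve e)"
    and ends_curve: "\<And>e. e \<in> E \<Longrightarrow> {pathstart (curve e), pathfinish (curve e)} = pos ` e"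
    and curve_Int: "\<And>e e'. e \<in> E \<Longrightarrow> e' \<in> E \<Longrightarrow> e \<noteq> e' \<Longrightarrow>
      path_image (curve e) \<inter> path_image (curve e') \<subseteq> pos ` (e \<inter> e')"
begin

definition img :: "'a set set \<Rightarrow> complex set" where
  "img X = (\<Union>e\<in>X. path_image (curve e))"

definition faces :: "'a set set \<Rightarrow> complex set set" where
  "faces X = components (- img X)"

text \<open>The component that results from opening the edge \<open>e\<close>: a face \<open>F\<close> of \<open>X\<close> is
  bounded by \<open>e\<close> iff \<open>F \<subseteq> side X e\<close>.\<close>

definition side :: "'a set set \<Rightarrow> 'a set \<Rightarrow> complex set" where
  "side X e = connected_component_set (- img (X - {e})) (curve e (1/2))"

lemma finite_V: "finite V" and edge_V: "e \<in> E \<Longrightarrow> e \<subseteq> V" and card_edge: "e \<in> E \<Longrightarrow> card e = 2"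
  using simple by (auto simp: simple_graph_def)

lemma finite_E: "finite E"
  using finite_V edge_V finite_subset[of E "Pow V"] by blast

lemma img_Un: "img (X \<union> Y) = img X \<union> img Y"
  by (auto simp: img_def)

lemma img_insert: "img (insert e X) = path_image (curve e) \<union> img X"
  by (auto simp: img_def)

lemma img_mono: "X \<subseteq> Y \<Longrightarrow> img X \<subseteq> img Y"
  by (auto simp: img_def)

lemma compact_img: "X \<subseteq> E \<Longrightarrow> compact (img X)"
  unfolding img_def
  using finite_E finite_subset arc_curve by (blast intro: compact_UN compact_arc_image)

lemma open_Compl_img: "X \<subseteq> E \<Longrightarrow> open (- img X)"
  using compact_img compact_imp_closed by auto

lemma curve_img_Int:
  assumes "e \<in> E" "X \<subseteq> E" "e \<notin> X"
  shows "path_image (curve e) \<inter> img X \<subseteq> pos ` (e \<inter> \<Union>X)"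
  using curve_Int[OF assms(1)] assms(2,3) unfolding img_def by fastforce

lemma oriented_curve:
  assumes "{x, y} \<in> E"
  obtains g where "arc g" "pathstart g = pos x" "pathfinish g = pos y"
    "path_image g = path_image (curve {x, y})"
proof -
  have "{pathstart (curve {x, y}), pathfinish (curve {x, y})} = {pos x, pos y}"
    using ends_curve[OF assms] by simp
  then consider "pathstart (curve {x, y}) = pos x" "pathfinish (curve {x, y}) = pos y"
    | "pathstart (curve {x, y}) = pos y" "pathfinish (curve {x, y}) = pos x"
    by (auto simp: doubleton_eq_iff)
  then show ?thesis
  proof cases
    case 1
    then show ?thesis using that arc_curve[OF assms] by blast
  next
    case 2
    then show ?thesis
      using that[of "reversepath (curve {x, y})"] arc_curve[OF assms] by (simp add: arc_reversepath)
  qed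
qed

lemma pos_in_curve: "e \<in> E \<Longrightarrow> v \<in> e \<Longrightarrow> pos v \<in> path_image (curve e)"
  using ends_curve[of e] pathstart_in_path_image[of "curve e"] pathfinish_in_path_image[of "curve e"]
  by (metis imageI insertE singletonD)

lemma upath_arc:
  "upath E u p v \<Longrightarrow> u \<noteq> v \<Longrightarrow>
    \<exists>g. arc g \<and> pathstart g = pos u \<and> pathfinish g = pos v \<and> path_image g = img (ledges p)"
proof (induction p arbitrary: u rule: ledges.induct)
  case (1 x y q)
  have xy: "{x, y} \<in> E" "u = x" "x \<notin> set (y # q)" and p: "upath E y (y # q) v"
    using 1(2) by (auto simp: upath_def)
  obtain g where g: "arc g" "pathstart g = pos x" "pathfinish g = pos y"
    "path_image g = path_image (curve {x, y})"
    using oriented_curve[OF xy(1)] by blast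
  show ?case
  proof (cases "y = v")
    case True
    then have "q = []" using p by (cases q) (auto simp: upath_def split: if_splits)
    with g True xy show ?thesis by (auto simp: img_def)
  next
    case False
    with "1.IH"[OF p] obtain h where h: "arc h" "pathstart h = pos y" "pathfinish h = pos v"
      "path_image h = img (ledges (y # q))" by blast
    have "{x, y} \<notin> ledges (y # q)"
      using ledges_subset_set[of "{x, y}" "y # q"] xy(3) by auto
    moreover have "\<Union>(ledges (y # q)) \<subseteq> set (y # q)"
      using ledges_subset_set by blast
    moreover have "ledges (y # q) \<subseteq> E" using p by (simp add: upath_def)
    ultimately have "path_image g \<inter> path_image h \<subseteq> pos ` ({x, y} \<inter> set (y # q))"
      using curve_img_Int[OF xy(1), of "ledges (y # q)"] unfolding g(4) h(4) by blast
    then have "path_image g \<inter> path_image h \<subseteq> {pos y}"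
      using xy(3) by auto
    with g h have "arc (g +++ h)" by (intro arc_join) auto
    with g h xy show ?thesis
      by (intro exI[of _ "g +++ h"]) (simp add: path_image_join img_insert)
  qed
qed (auto simp: upath_def)

text \<open>What remains of the cycle is an arc between the ends of \<open>e\<close>. Its
  connectedness is the condition that Janiszewski's theorem asks for.\<close>

lemma img_cycle_minus_edge:
  assumes "is_cycle C" "C \<subseteq> E" "e \<in> C"
  shows "connected (img (C - {e}))" "pos ` e \<subseteq> img (C - {e})"
proof -
  obtain p u v where p: "upath (C - {e}) u p v" "e = {u, v}" "u \<noteq> v"
    "C = insert e (ledges p)" "e \<notin> ledges p"
    using is_cycle_through[OF assms(1,3)] by metis
  have "upath E u p v" using p(1) assms(2) by (auto simp: upath_def)
  then obtain g where g: "arc g" "pathstart g = pos u" "pathfinish g = pos v"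
    "path_image g = img (ledges p)"
    using upath_arc p(3) by blast
  moreover have "C - {e} = ledges p" using p by auto
  ultimately show "connected (img (C - {e}))" "pos ` e \<subseteq> img (C - {e})"
    using connected_arc_image[OF g(1)] p(2) pathstart_in_path_image[of g] pathfinish_in_path_image[of g]
    by auto
qed

lemma img_cycle_loop:
  assumes "is_cycle C" "C \<subseteq> E"
  obtains c where "simple_path c" "pathfinish c = pathstart c" "path_image c = img C"
proof -
  obtain e where "e \<in> C" using assms(1) by (auto simp: is_cycle_def)
  obtain p u v where p: "upath (C - {e}) u p v" "e = {u, v}" "u \<noteq> v"
    "C = insert e (ledges p)" "e \<notin> ledges p"
    using is_cycle_through[OF assms(1) \<open>e \<in> C\<close>] by metis
  have "upath E u p v" "{v, u} \<in> E"
    using p \<open>e \<in> C\<close> assms(2) by (auto simp: upath_def insert_commute)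
  then obtain g h where gh: "arc g" "pathstart g = pos u" "pathfinish g = pos v"
    "path_image g = img (ledges p)"
    "arc h" "pathstart h = pos v" "pathfinish h = pos u" "path_image h = path_image (curve {v, u})"
    using upath_arc p(3) oriented_curve by metis
  have e: "e = {v, u}" using p(2) by auto
  have "path_image h \<inter> path_image g \<subseteq> pos ` e"
    using curve_img_Int[of e "ledges p"] p assms(2) unfolding gh e[symmetric] by auto
  with gh p(2) have "simple_path (g +++ h)"
    by (intro simple_path_join_loop) auto
  with gh that[of "g +++ h"] p(4) e show ?thesis
    by (auto simp: path_image_join img_insert)
qed

lemma Jordan_img:
  assumes "is_cycle C" "C \<subseteq> E"
  shows "open (inside (img C))" "open (outside (img C))"
    "inside (img C) \<inter> outside (img C) = {}"
    "inside (img C) \<union> outside (img C) = - img C"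
    "connected (inside (img C))" "connected (outside (img C))"
    "frontier (inside (img C)) = img C" "frontier (outside (img C)) = img C"
  using img_cycle_loop[OF assms] Jordan_inside_outside by metis+

lemma connected_inside_or_outside:
  assumes "is_cycle C" "C \<subseteq> E" "connected S" "S \<inter> img C = {}"
  shows "S \<subseteq> inside (img C) \<or> S \<subseteq> outside (img C)"
proof (rule ccontr)
  assume "\<not> ?thesis"
  moreover have S: "S \<subseteq> inside (img C) \<union> outside (img C)"
    unfolding Jordan_img(4)[OF assms(1,2)] using assms(4) by auto
  ultimately have "inside (img C) \<inter> S \<noteq> {}" "outside (img C) \<inter> S \<noteq> {}" by blast+
  with connectedD[OF assms(3) Jordan_img(1)[OF assms(1,2)] Jordan_img(2)[OF assms(1,2)]]
    Jordan_img(3)[OF assms(1,2)] S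
  show False by blast
qed

lemma mid_curve:
  assumes "e \<in> E"
  shows "curve e (1/2) \<in> path_image (curve e) - pos ` e"
proof -
  have "curve e (1/2) \<in> curve e ` {0<..<1}" by auto
  then show ?thesis
    using simple_path_endless[OF arc_imp_simple_path[OF arc_curve[OF assms]]] ends_curve[OF assms]
    by auto
qed

text \<open>The arc without its ends is connected and avoids all other edges. An end of
  \<open>e\<close> where no other edge arrives lies in its closure and may be added without losing
  connectedness.\<close>

lemma curve_minus_subset_side:
  assumes "e \<in> E" "X \<subseteq> E"
  shows "path_image (curve e) - img (X - {e}) \<subseteq> side X e"
proof -
  let ?e = "path_image (curve e) - pos ` e"
  have c: "connected ?e"
    using connected_simple_path_endless[OF arc_imp_simple_path[OF arc_curve[OF assms(1)]]]
      ends_curve[OF assms(1)] by simp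
  have disj: "?e \<inter> img (X - {e}) = {}"
    using curve_img_Int[of e "X - {e}"] assms by auto
  have cl: "path_image (curve e) \<subseteq> closure ?e"
    using arc_subset_closure_interior[OF arc_curve[OF assms(1)]] ends_curve[OF assms(1)] by simp
  have "connected (path_image (curve e) - img (X - {e}))"
    by (rule connected_intermediate_closure[OF c]) (use disj cl in blast)+
  moreover have "curve e (1/2) \<in> path_image (curve e) - img (X - {e})"
    using mid_curve[OF assms(1)] disj by auto
  ultimately show ?thesis
    unfolding side_def by (intro connected_component_maximal) auto
qed

lemma mid_in_side:
  assumes "e \<in> E" "X \<subseteq> E"
  shows "curve e (1/2) \<in> side X e"
proof -
  have "path_image (curve e) \<inter> img (X - {e}) \<subseteq> pos ` e"
    using curve_img_Int[OF assms(1), of "X - {e}"] assms(2) by auto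
  then have "curve e (1/2) \<in> path_image (curve e) - img (X - {e})"
    using mid_curve[OF assms(1)] by auto
  with curve_minus_subset_side[OF assms] show ?thesis by (rule subsetD)
qed

lemma open_side: "X \<subseteq> E \<Longrightarrow> open (side X e)"
  unfolding side_def by (intro open_connected_component open_Compl_img) auto

lemma side_in_faces:
  assumes "e \<in> E" "X \<subseteq> E"
  shows "side X e \<in> faces (X - {e})"
  using mid_in_side[OF assms] unfolding side_def faces_def
  by (intro componentsI) (metis connected_component_in mem_Collect_eq)

lemma side_disjoint: "side X e \<inter> img (X - {e}) = {}"
  using connected_component_subset[of "- img (X - {e})"] by (auto simp: side_def)

lemma connected_side: "connected (side X e)"
  by (simp add: side_def)

lemma faces_disjoint: "F \<in> faces X \<Longrightarrow> G \<in> faces X \<Longrightarrow> F \<noteq> G \<Longrightarrow> F \<inter> G = {}"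
  unfolding faces_def using components_nonoverlap by blast

lemma face_facts: "F \<in> faces X \<Longrightarrow> F \<noteq> {} \<and> connected F \<and> F \<inter> img X = {}"
  unfolding faces_def
  using in_components_nonempty in_components_connected in_components_subset by fastforce

lemma face_superset:
  assumes "F \<in> faces X" "Y \<subseteq> X"
  shows "\<exists>!G. G \<in> faces Y \<and> F \<subseteq> G"
proof -
  have F: "F \<noteq> {}" "connected F" "F \<subseteq> - img Y"
    using face_facts[OF assms(1)] img_mono[OF assms(2)] by auto
  then obtain G where "G \<in> faces Y" "F \<subseteq> G"
    using exists_component_superset[of F "- img Y"] unfolding faces_def by blast
  with F(1) faces_disjoint[of _ Y] show ?thesis by blast
qed

text \<open>Only the component that contains the curve of \<open>e\<close> is cut; every other face
  of \<open>X - {e}\<close> avoids the curve and remains a maximal connected set.\<close>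

lemma faces_insert:
  assumes "e \<in> X" "X \<subseteq> E"
  shows "faces X = (faces (X - {e}) - {side X e}) \<union> {F \<in> faces X. F \<subseteq> side X e}"
proof -
  have e: "e \<in> E" and X: "img X = path_image (curve e) \<union> img (X - {e})"
    using assms img_insert[of e "X - {e}"] by (auto simp: insert_absorb)
  have new: "G \<inter> img X = {}" if "G \<in> faces (X - {e})" "G \<noteq> side X e" for G
  proof -
    have "G \<inter> img (X - {e}) = {}" using face_facts[OF that(1)] by blast
    moreover have "G \<inter> side X e = {}"
      using faces_disjoint[OF that(1) side_in_faces[OF e assms(2)] that(2)] .
    ultimately show ?thesis
      using curve_minus_subset_side[OF e assms(2)] X by auto
  qed
  have old_new: "G \<in> faces X" if "G \<in> faces (X - {e})" "G \<noteq> side X e" for G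
  proof -
    have "G \<noteq> {}" "connected G" "G \<subseteq> - img X"
      using face_facts[OF that(1)] new[OF that] by auto
    then obtain F where F: "F \<in> faces X" "G \<subseteq> F"
      using exists_component_superset[of G "- img X"] unfolding faces_def by blast
    then have "connected F" "F \<subseteq> - img (X - {e})" "G \<inter> F \<noteq> {}"
      using face_facts[OF F(1)] X \<open>G \<noteq> {}\<close> by auto
    then have "F \<subseteq> G"
      using components_maximal[of G "- img (X - {e})" F] that(1) unfolding faces_def by blast
    with F show ?thesis by simp
  qed
  have "F \<in> faces (X - {e}) \<and> F \<noteq> side X e" if F: "F \<in> faces X" "\<not> F \<subseteq> side X e" for F
  proof -
    obtain G where G: "G \<in> faces (X - {e})" "F \<subseteq> G"
      using face_superset[OF F(1), of "X - {e}"] by auto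
    then have ne: "G \<noteq> side X e" using F by auto
    have "G = F"
      using faces_disjoint[OF old_new[OF G(1) ne] F(1)] G(2) face_facts[OF F(1)] by blast
    with G ne show ?thesis by simp
  qed
  with old_new show ?thesis by blast
qed

text \<open>The midpoint of \<open>e\<close> is a frontier point of \<open>R\<close>, so the open
  set \<open>side X e\<close> meets \<open>R\<close>. Two points of this intersection are separated
  neither by \<open>img (X - {e})\<close> nor by \<open>img C\<close>. These sets meet in the arc
  \<open>img (C - {e})\<close>, so by Janiszewski their union \<open>img X\<close> does not separate
  the points either.\<close>

lemma side_meets_half:
  assumes C: "is_cycle C" "C \<subseteq> X" "X \<subseteq> E" "e \<in> C"
    and R: "R = inside (img C) \<or> R = outside (img C)"
  shows "\<exists>F. {G \<in> faces X. G \<subseteq> side X e \<and> G \<subseteq> R} = {F}"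
proof -
  have CE: "C \<subseteq> E" and e: "e \<in> E" "e \<in> X" using C by auto
  have X: "img X = img (X - {e}) \<union> img C"
    using C e by (auto simp: img_def)
  note J = Jordan_img[OF C(1) CE]
  have R': "open R" "connected R" "frontier R = img C" "R \<subseteq> - img C"
    using R J by blast+
  have "curve e (1/2) \<in> img C"
    using mid_curve[OF e(1)] C(4) by (auto simp: img_def)
  then have "curve e (1/2) \<in> closure R"
    using R'(3) by (auto simp: frontier_def)
  then obtain x where x: "x \<in> R" "x \<in> side X e"
    using mid_in_side[OF e(1) C(3)] open_Int_closure_eq_empty[OF open_side[OF C(3)], of e R] by blast
  have Int: "img (X - {e}) \<inter> img C = img (C - {e})"
  proof -
    have "img C = img (C - {e}) \<union> path_image (curve e)"
      using C(4) img_insert[of e "C - {e}"] by (auto simp: insert_absorb)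
    moreover have "path_image (curve e) \<inter> img (X - {e}) \<subseteq> img (C - {e})"
      using curve_img_Int[of e "X - {e}"] e C(3) img_cycle_minus_edge(2)[OF C(1) CE C(4)] by auto
    moreover have "img (C - {e}) \<subseteq> img (X - {e})"
      using C(2) by (intro img_mono) auto
    ultimately show ?thesis by auto
  qed
  have same: "connected_component (- img X) y z" if "y \<in> R" "y \<in> side X e" "z \<in> R" "z \<in> side X e" for y z
    unfolding X
  proof (rule Janiszewski)
    show "compact (img (X - {e}))" "closed (img C)"
      using compact_img[of "X - {e}"] compact_img[OF CE] C(3) compact_imp_closed by auto
    show "connected (img (X - {e}) \<inter> img C)"
      unfolding Int by (rule img_cycle_minus_edge[OF C(1) CE C(4)])
    show "connected_component (- img (X - {e})) y z"
      using that connected_side[of X e] side_disjoint[of X e]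
      unfolding connected_component_def by (intro exI[of _ "side X e"]) auto
    show "connected_component (- img C) y z"
      using that R' by (auto simp: connected_component_def)
  qed
  define F where "F = connected_component_set (- img X) x"
  have xX: "x \<in> - img X"
    using x R'(4) side_disjoint[of X e] X by auto
  then have F: "F \<in> faces X" "x \<in> F"
    unfolding F_def faces_def by (auto intro: componentsI)
  have FX: "connected F" "F \<inter> img X = {}"
    using face_facts[OF F(1)] by auto
  have FS: "F \<subseteq> side X e"
    using components_maximal[of "side X e" "- img (X - {e})" F] side_in_faces[OF e(1) C(3)]
      FX X F(2) x unfolding faces_def by auto
  have FR: "F \<subseteq> R"
    using connected_inside_or_outside[OF C(1) CE FX(1)] FX(2) X F(2) x(1) R J(3) by blast
  have uniq: "G = F" if G: "G \<in> faces X" "G \<subseteq> side X e" "G \<subseteq> R" for G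
  proof -
    obtain z where "z \<in> G" using face_facts[OF G(1)] by auto
    then have "z \<in> F" unfolding F_def using same[OF x] G by auto
    with \<open>z \<in> G\<close> show ?thesis using faces_disjoint[OF G(1) F(1)] by blast
  qed
  have "{G \<in> faces X. G \<subseteq> side X e \<and> G \<subseteq> R} = {F}"
    using F(1) FS FR uniq by blast
  then show ?thesis ..
qed

text \<open>Without a return path, the edges \<open>A\<close> reachable from \<open>u\<close> and
  the remaining edges \<open>B\<close> are disjoint, and the curve of \<open>{u, v}\<close> touches
  each in at most one point. Joining first the curve and then \<open>img B\<close> to
  \<open>img A\<close> thus satisfies Janiszewski's condition both times, so a bridge does not cut
  its face.\<close>

lemma side_bridge:
  assumes X: "X \<subseteq> E" "{u, v} \<in> X" and nc: "(u, v) \<notin> (adj_rel (X - {{u, v}}))\<^sup>*"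
  shows "\<exists>F. {G \<in> faces X. G \<subseteq> side X {u, v}} = {F}"
proof -
  let ?e = "{u, v}" and ?Y = "X - {{u, v}}"
  have e: "?e \<in> E" using X by auto
  have imgX: "img X = path_image (curve ?e) \<union> img ?Y"
    using X img_insert[of ?e ?Y] by (auto simp: insert_absorb)
  have "side X ?e \<noteq> {}" using mid_in_side[OF e X(1)] by auto
  then have "\<not> side X ?e \<subseteq> path_image (curve ?e)"
    using open_subset_arc_empty[OF arc_curve[OF e] open_side[OF X(1)]] by blast
  then obtain x where x: "x \<in> side X ?e" "x \<notin> path_image (curve ?e)" by blast
  define A where "A = {f \<in> ?Y. \<forall>w\<in>f. (u, w) \<in> (adj_rel ?Y)\<^sup>*}"
  define B where "B = ?Y - A"
  have AB: "?Y = A \<union> B" "A \<subseteq> E" "B \<subseteq> E" "?e \<notin> A" "?e \<notin> B"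
    using X by (auto simp: A_def B_def)
  have B: "(u, w) \<notin> (adj_rel ?Y)\<^sup>*" if fw: "f \<in> B" "w \<in> f" for f w
  proof
    assume uw: "(u, w) \<in> (adj_rel ?Y)\<^sup>*"
    have "card f = 2" using AB(3) fw(1) card_edge by blast
    then obtain a b where "f = {a, b}" by (meson card_2_iff)
    with fw(2) obtain z where f: "f = {w, z}" by blast
    with fw have "(w, z) \<in> adj_rel ?Y" by (auto simp: B_def adj_rel_def)
    with uw have "(u, z) \<in> (adj_rel ?Y)\<^sup>*" by (rule rtrancl_into_rtrancl)
    with uw f fw show False by (auto simp: A_def B_def)
  qed
  have Areach: "(u, w) \<in> (adj_rel ?Y)\<^sup>*" if "f \<in> A" "w \<in> f" for f w
    using that by (simp add: A_def)
  have disj: "\<Union>A \<inter> \<Union>B = {}" "u \<notin> \<Union>B" "v \<notin> \<Union>A"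
    using B Areach nc rtrancl.rtrancl_refl by fast+
  have "img A \<inter> img B \<subseteq> pos ` (\<Union>A \<inter> \<Union>B)"
  proof
    fix x assume "x \<in> img A \<inter> img B"
    then obtain f g where fg: "f \<in> A" "g \<in> B" "x \<in> path_image (curve f) \<inter> path_image (curve g)"
      by (auto simp: img_def)
    then have "f \<noteq> g" "f \<in> E" "g \<in> E" using AB(2,3) by (auto simp: B_def)
    with curve_Int[of f g] fg show "x \<in> pos ` (\<Union>A \<inter> \<Union>B)" by blast
  qed
  then have ABi: "img A \<inter> img B = {}" using disj by auto
  have eA: "img A \<inter> path_image (curve ?e) \<subseteq> {pos u}"
    using curve_img_Int[OF e AB(2,4)] disj by auto
  have eB: "path_image (curve ?e) \<inter> img B \<subseteq> {pos v}"
    using curve_img_Int[OF e AB(3,5)] disj by auto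
  have small: "connected S" if "S \<subseteq> {a}" for S :: "complex set" and a
    using subset_singletonD[OF that] by auto
  have cc: "connected_component (- img X) y z"
    if y: "y \<in> side X ?e" "y \<notin> path_image (curve ?e)"
      and z: "z \<in> side X ?e" "z \<notin> path_image (curve ?e)" for y z
  proof -
    have Y: "connected_component (- img ?Y) y z"
      using y z connected_side[of X ?e] side_disjoint[of X ?e]
      unfolding connected_component_def by (intro exI[of _ "side X ?e"]) auto
    have Ysub: "- img ?Y \<subseteq> - img A" "- img ?Y \<subseteq> - img B"
      unfolding AB(1) img_Un by auto
    have cA: "connected_component (- img A) y z" "connected_component (- img B) y z"
      using Y Ysub connected_component_of_subset by metis+
    have "connected (- path_image (curve ?e))"
      using connected_arc_complement[OF arc_curve[OF e]] by simp
    then have ce: "connected_component (- path_image (curve ?e)) y z"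
      using y z by (auto simp: connected_component_def)
    have cAe: "connected_component (- (img A \<union> path_image (curve ?e))) y z"
      by (rule Janiszewski)
        (use compact_img[OF AB(2)] compact_arc_image[OF arc_curve[OF e]] small[OF eA] cA(1) ce
          in \<open>auto simp: compact_imp_closed\<close>)
    have "connected_component (- ((img A \<union> path_image (curve ?e)) \<union> img B)) y z"
    proof (rule Janiszewski)
      have "(img A \<union> path_image (curve ?e)) \<inter> img B \<subseteq> {pos v}"
        using eB ABi by blast
      then show "connected ((img A \<union> path_image (curve ?e)) \<inter> img B)" by (rule small)
      show "compact (img A \<union> path_image (curve ?e))"
        by (rule compact_Un[OF compact_img[OF AB(2)] compact_arc_image[OF arc_curve[OF e]]])
      show "closed (img B)" by (rule compact_imp_closed[OF compact_img[OF AB(3)]])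
    qed (fact cAe cA(2))+
    moreover have "img X = (img A \<union> path_image (curve ?e)) \<union> img B"
      using imgX AB(1) img_Un by auto
    ultimately show ?thesis by simp
  qed
  define F where "F = connected_component_set (- img X) x"
  have "x \<in> - img X" using x side_disjoint[of X ?e] imgX by auto
  then have F: "F \<in> faces X" "x \<in> F"
    unfolding F_def faces_def by (auto intro: componentsI)
  have "F \<subseteq> side X ?e"
    using components_maximal[of "side X ?e" "- img ?Y" F] side_in_faces[OF e X(1)]
      face_facts[OF F(1)] imgX F(2) x unfolding faces_def by auto
  moreover have "G = F" if G: "G \<in> faces X" "G \<subseteq> side X ?e" for G
  proof -
    obtain z where "z \<in> G" using face_facts[OF G(1)] by auto
    then have "z \<in> F"
      unfolding F_def using cc[OF x] G face_facts[OF G(1)] imgX by auto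
    with \<open>z \<in> G\<close> show ?thesis using faces_disjoint[OF G(1) F(1)] by blast
  qed
  ultimately have "{G \<in> faces X. G \<subseteq> side X ?e} = {F}" using F(1) by blast
  then show ?thesis ..
qed
end

section \<open>Face boundaries\<close>

context plane_drawing
begin

lemma faces_empty: "faces {} = {UNIV}"
  by (simp add: faces_def img_def components_eq_sing_iff)

lemma face_superset_unique:
  assumes "F \<in> faces X" "F \<subseteq> G" "F \<subseteq> H" "G \<in> faces Y" "H \<in> faces Y"
  shows "G = H"
proof (rule ccontr)
  assume "G \<noteq> H"
  then have "G \<inter> H = {}" by (rule faces_disjoint[OF assms(4,5)])
  moreover have "F \<noteq> {}" using face_facts[OF assms(1)] by simp
  ultimately show False using assms(2,3) by blast
qed

text \<open>Every face lies on one side of \<open>C\<close>, and \<open>side_meets_half\<close>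
  leaves exactly one in each half.\<close>

lemma faces_in_side_cycle:
  assumes C: "is_cycle C" "C \<subseteq> X" "X \<subseteq> E" "e \<in> C"
  obtains F G where "{H \<in> faces X. H \<subseteq> side X e} = {F, G}" "F \<noteq> G"
    "F \<subseteq> inside (img C)" "G \<subseteq> outside (img C)"
proof -
  have CE: "C \<subseteq> E" using C by auto
  obtain F where F: "{H \<in> faces X. H \<subseteq> side X e \<and> H \<subseteq> inside (img C)} = {F}"
    using side_meets_half[OF C disjI1[OF refl]] by (elim exE)
  obtain G where G: "{H \<in> faces X. H \<subseteq> side X e \<and> H \<subseteq> outside (img C)} = {G}"
    using side_meets_half[OF C disjI2[OF refl]] by (elim exE)
  have F': "H \<in> faces X \<and> H \<subseteq> side X e \<and> H \<subseteq> inside (img C) \<longleftrightarrow> H = F" for H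
    using eqset_imp_iff[OF F, of H] by simp
  have G': "H \<in> faces X \<and> H \<subseteq> side X e \<and> H \<subseteq> outside (img C) \<longleftrightarrow> H = G" for H
    using eqset_imp_iff[OF G, of H] by simp
  have "H \<subseteq> inside (img C) \<or> H \<subseteq> outside (img C)" if "H \<in> faces X" for H
    using connected_inside_or_outside[OF C(1) CE] face_facts[OF that] img_mono[OF C(2)] by blast
  then have "H \<in> faces X \<and> H \<subseteq> side X e \<longleftrightarrow> H = F \<or> H = G" for H
    using F'[of H] G'[of H] by metis
  then have FG: "{H \<in> faces X. H \<subseteq> side X e} = {F, G}"
    by (simp add: Collect_disj_eq insert_is_Un[of F "{G}"])
  have "F \<noteq> G"
  proof
    assume "F = G"
    then have "F \<subseteq> inside (img C)" "F \<subseteq> outside (img C)" "F \<noteq> {}"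
      using F'[of F] G'[of F] face_facts[of F X] by simp_all
    then show False using Jordan_img(3)[OF C(1) CE] by blast
  qed
  with FG F'[of F] G'[of G] show ?thesis using that by simp
qed

lemma faces_in_side_no_cycle:
  assumes X: "X \<subseteq> E" "e \<in> X" and nc: "\<And>C. is_cycle C \<Longrightarrow> C \<subseteq> X \<Longrightarrow> e \<notin> C"
  obtains F where "{H \<in> faces X. H \<subseteq> side X e} = {F}"
proof -
  obtain u v where e: "e = {u, v}" "u \<noteq> v"
    using card_edge[of e] X by (meson card_2_iff subsetD)
  then have "(u, v) \<notin> (adj_rel (X - {{u, v}}))\<^sup>*"
    using cycle_through_edge[of u v X] X nc by blast
  from side_bridge[OF X(1) _ this] X e that show ?thesis by auto
qed

lemma old_face_not_in_side:
  assumes "e \<in> E" "X \<subseteq> E" "G \<in> faces (X - {e})" "G \<noteq> side X e"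
  shows "\<not> G \<subseteq> side X e"
  using faces_disjoint[OF assms(3) side_in_faces[OF assms(1,2)] assms(4)] face_facts[OF assms(3)]
  by blast

lemma finite_faces: "X \<subseteq> E \<Longrightarrow> finite (faces X)"
proof -
  assume X: "X \<subseteq> E"
  then have "finite X" using finite_E finite_subset by blast
  then show ?thesis using X
  proof (induction X rule: finite_induct)
    case empty
    show ?case by (simp add: faces_empty)
  next
    case (insert e X)
    have "finite {H \<in> faces (insert e X). H \<subseteq> side (insert e X) e}"
    proof (cases "\<exists>C. is_cycle C \<and> C \<subseteq> insert e X \<and> e \<in> C")
      case True
      then obtain C where C: "is_cycle C" "C \<subseteq> insert e X" "e \<in> C" by blast
      show ?thesis
        by (rule faces_in_side_cycle[OF C(1,2) insert.prems C(3)]) simp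
    next
      case False
      show ?thesis
        by (rule faces_in_side_no_cycle[OF insert.prems, of e]) (use False in auto)
    qed
    moreover have "finite (faces X)" using insert by simp
    moreover have "faces (insert e X) \<subseteq> faces X \<union> {H \<in> faces (insert e X). H \<subseteq> side (insert e X) e}"
      using faces_insert[of e "insert e X"] insert by auto
    ultimately show ?case using finite_subset by blast
  qed
qed

lemma card_faces_cycle:
  assumes C: "is_cycle C" "C \<subseteq> X" "X \<subseteq> E" "e \<in> C"
  shows "card (faces X) = card (faces (X - {e})) + 1"
proof -
  have e: "e \<in> X" "e \<in> E" using C by auto
  let ?S = "{H \<in> faces X. H \<subseteq> side X e}" and ?O = "faces (X - {e}) - {side X e}"
  have fin: "finite (faces (X - {e}))" using C(3) by (intro finite_faces) auto
  have disj: "?O \<inter> ?S = {}" using old_face_not_in_side[OF e(2) C(3)] by auto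
  obtain F G where "?S = {F, G}" "F \<noteq> G"
    by (rule faces_in_side_cycle[OF C])
  then have S: "finite ?S" "card ?S = 2" by auto
  have "card (faces X) = card (?O \<union> ?S)"
    by (rule arg_cong[OF faces_insert[OF e(1) C(3)]])
  also have "\<dots> = card ?O + 2"
    using card_Un_disjoint[OF _ S(1) disj] fin S(2) by simp
  finally have "card (faces X) = card ?O + 2" .
  moreover have "card (faces (X - {e})) = Suc (card ?O)"
    using side_in_faces[OF e(2) C(3)] fin by (rule card.remove[rotated])
  ultimately show ?thesis by simp
qed

text \<open>One direction of Euler's formula. A maximal acyclic \<open>T\<close> has at most
  \<open>card V - 1\<close> edges; every further edge closes a cycle with edges of \<open>T\<close>,
  so adding it raises the number of faces by one, starting from at least one face.\<close>

lemma card_faces_ge: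
  assumes "V \<noteq> {}"
  shows "card E + 2 \<le> card (faces E) + card V"
proof -
  define P where "P T \<longleftrightarrow> T \<subseteq> E \<and> (\<forall>C. is_cycle C \<longrightarrow> \<not> C \<subseteq> T)" for T
  have "P {}" by (auto simp: P_def is_cycle_def)
  have "finite {T. P T}"
    by (rule finite_subset[of _ "Pow E"]) (use finite_E in \<open>auto simp: P_def\<close>)
  with \<open>P {}\<close> obtain T where T: "P T" and T_max: "\<And>S. P S \<Longrightarrow> T \<subseteq> S \<Longrightarrow> T = S"
    using finite_has_maximal[of "{T. P T}"] by auto
  have TE: "T \<subseteq> E" using T by (simp add: P_def)
  then have "finite T" using finite_E finite_subset by blast
  have cyc: "\<exists>C. is_cycle C \<and> C \<subseteq> insert e T \<and> e \<in> C" if eT: "e \<in> E - T" for e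
  proof -
    have "\<not> P (insert e T)" using T_max[of "insert e T"] eT by blast
    then obtain C where C: "is_cycle C" "C \<subseteq> insert e T"
      using eT TE by (auto simp: P_def)
    moreover have "\<not> C \<subseteq> T" using T C(1) by (simp add: P_def)
    ultimately show ?thesis by blast
  qed
  have "card Y + 1 \<le> card (faces (T \<union> Y))" if "Y \<subseteq> E - T" for Y
  proof -
    have "finite Y" using that finite_E finite_subset by blast
    then show ?thesis using that
    proof (induction Y rule: finite_induct)
      case empty
      have "faces T \<noteq> {}"
      proof -
        have "img T \<noteq> UNIV" using compact_img[OF TE] not_compact_UNIV by metis
        then show ?thesis by (auto simp: faces_def)
      qed
      then show ?case using finite_faces[OF TE] by (simp add: Suc_le_eq card_gt_0_iff)
    next
      case (insert e Y)
      obtain C where C: "is_cycle C" "C \<subseteq> insert e T" "e \<in> C"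
        using cyc[of e] insert.prems by auto
      have "card (faces (T \<union> insert e Y)) = card (faces (T \<union> insert e Y - {e})) + 1"
        by (rule card_faces_cycle[OF C(1)]) (use C insert.prems TE in auto)
      moreover have "T \<union> insert e Y - {e} = T \<union> Y" using insert by auto
      ultimately show ?case using insert by simp
    qed
  qed
  from this[of "E - T"] have "card (E - T) + 1 \<le> card (faces E)"
    using TE by (simp add: Un_absorb1)
  moreover have "card (E - T) = card E - card T" using card_Diff_subset TE \<open>finite T\<close> by blast
  moreover have "card T + 1 \<le> card V"
    by (rule acyclic_card_le[OF finite_V assms])
      (use T edge_V card_edge in \<open>auto simp: P_def\<close>)
  moreover have "card T \<le> card E" using TE finite_E by (simp add: card_mono)
  ultimately show ?thesis by linarith
qed

text \<open>Insides of cycles, together with the set of all faces, separate the faces modulo 2: opening an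
  edge on a cycle merges exactly two faces, and \<open>h\<close> is summed over each face so obtained.\<close>

lemma even_face_function:
  fixes h :: "complex set \<Rightarrow> nat"
  assumes "X \<subseteq> E" "even (sum h (faces X))"
    and "\<And>C. is_cycle C \<Longrightarrow> C \<subseteq> X \<Longrightarrow> even (\<Sum>F | F \<in> faces X \<and> F \<subseteq> inside (img C). h F)"
    and "F \<in> faces X"
  shows "even (h F)"
proof -
  have "finite X" using assms(1) finite_E finite_subset by blast
  then show ?thesis using assms
  proof (induction X arbitrary: h F rule: finite_induct)
    case empty
    then show ?case by (simp add: faces_empty)
  next
    case (insert e X)
    let ?X = "insert e X"
    have Xe: "?X - {e} = X" and e: "e \<in> E" and XE: "X \<subseteq> E" using insert by auto
    have fin: "finite (faces ?X)" "finite (faces X)"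
      using finite_faces insert.prems(1) by auto
    define k where "k G = (\<Sum>F | F \<in> faces ?X \<and> F \<subseteq> G. h F)" for G
    \<comment> \<open>Every face of \<open>?X\<close> lies in exactly one face of \<open>X\<close>,
      so sums over corresponding families regroup.\<close>
    have sum_k: "sum k {G \<in> faces X. P G} = (\<Sum>F | F \<in> faces ?X \<and> Q F. h F)"
      if PQ: "\<And>F G. F \<in> faces ?X \<Longrightarrow> G \<in> faces X \<Longrightarrow> F \<subseteq> G \<Longrightarrow> P G \<longleftrightarrow> Q F" for P Q
    proof -
      have "sum h (\<Union>G\<in>{G \<in> faces X. P G}. {F \<in> faces ?X. F \<subseteq> G}) = sum k {G \<in> faces X. P G}"
        unfolding k_def
      proof (rule sum.UNION_disjoint)
        show "\<forall>G\<in>{G \<in> faces X. P G}. \<forall>H\<in>{G \<in> faces X. P G}. G \<noteq> H \<longrightarrow>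
            {F \<in> faces ?X. F \<subseteq> G} \<inter> {F \<in> faces ?X. F \<subseteq> H} = {}"
          using face_superset_unique[of _ ?X _ _ X] by auto
      qed (use fin in auto)
      moreover have "F \<in> (\<Union>G\<in>{G \<in> faces X. P G}. {F \<in> faces ?X. F \<subseteq> G}) \<longleftrightarrow>
          F \<in> {F \<in> faces ?X. Q F}" for F
      proof -
        have "\<exists>G. G \<in> faces X \<and> F \<subseteq> G" if "F \<in> faces ?X"
          using face_superset[OF that, of X] by auto
        then show ?thesis using PQ[of F] by auto
      qed
      then have "(\<Union>G\<in>{G \<in> faces X. P G}. {F \<in> faces ?X. F \<subseteq> G}) = {F \<in> faces ?X. Q F}"
        by (rule set_eqI)
      ultimately show ?thesis by simp
    qed
    have even_k: "even (k G)" if "G \<in> faces X" for G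
    proof (rule insert.IH[OF XE _ _ that])
      show "even (sum k (faces X))"
        using sum_k[of "\<lambda>_. True" "\<lambda>_. True"] insert.prems(2) by simp
      fix C assume C: "is_cycle C" "C \<subseteq> X"
      have "sum k {G \<in> faces X. G \<subseteq> inside (img C)} = (\<Sum>F | F \<in> faces ?X \<and> F \<subseteq> inside (img C). h F)"
      proof (rule sum_k)
        fix F G assume FG: "F \<in> faces ?X" "G \<in> faces X" "F \<subseteq> G"
        have "C \<subseteq> E" using C XE by auto
        note J = Jordan_img(3)[OF C(1) this] connected_inside_or_outside[OF C(1) this]
        have "G \<subseteq> inside (img C) \<or> G \<subseteq> outside (img C)"
          using J(2) face_facts[OF FG(2)] img_mono[OF C(2)] by blast
        then show "G \<subseteq> inside (img C) \<longleftrightarrow> F \<subseteq> inside (img C)"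
          using FG(3) J(1) face_facts[OF FG(1)] by blast
      qed
      then show "even (\<Sum>G | G \<in> faces X \<and> G \<subseteq> inside (img C). k G)"
        using insert.prems(3)[OF C(1)] C(2) by auto
    qed
    have eside: "even (\<Sum>F | F \<in> faces ?X \<and> F \<subseteq> side ?X e. h F)"
      using even_k[of "side ?X e"] side_in_faces[OF e insert.prems(1)] Xe by (simp add: k_def)
    have old: "even (h G)" if G: "G \<in> faces X" "G \<noteq> side ?X e" for G
    proof -
      have "G \<in> faces ?X" using faces_insert[of e ?X] insert.prems(1) G Xe by auto
      then have "{F \<in> faces ?X. F \<subseteq> G} = {G}"
        using face_superset_unique[of _ ?X _ G ?X] by auto
      then show ?thesis using even_k[OF G(1)] by (simp add: k_def)
    qed
    have side_case: "even (h F)" if F: "F \<in> faces ?X" "F \<subseteq> side ?X e" for F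
    proof (cases "\<exists>C. is_cycle C \<and> C \<subseteq> ?X \<and> e \<in> C")
      case False
      obtain G where "{H \<in> faces ?X. H \<subseteq> side ?X e} = {G}"
        by (rule faces_in_side_no_cycle[OF insert.prems(1), of e]) (use False in auto)
      then show ?thesis using eside F by auto
    next
      case True
      then obtain C where C: "is_cycle C" "C \<subseteq> ?X" "e \<in> C" by blast
      obtain G H where GH: "{K \<in> faces ?X. K \<subseteq> side ?X e} = {G, H}" "G \<noteq> H"
        "G \<subseteq> inside (img C)" "H \<subseteq> outside (img C)"
        by (rule faces_in_side_cycle[OF C(1,2) insert.prems(1) C(3)])
      have "C \<subseteq> E" using C insert.prems(1) by auto
      note J = Jordan_img(3)[OF C(1) this]
      have G: "G \<in> faces ?X" "G \<subseteq> side ?X e" and H: "H \<in> faces ?X"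
        using eqset_imp_iff[OF GH(1), of G] eqset_imp_iff[OF GH(1), of H] by simp_all
      \<comment> \<open>Inside \<open>C\<close> only \<open>G\<close> is new. The other faces there
        contribute even values, which makes \<open>h G\<close> even; the sum over the merged face
        then settles \<open>h H\<close>.\<close>
      let ?I = "{F \<in> faces ?X. F \<subseteq> inside (img C)}"
      have "even (h F)" if F: "F \<in> ?I - {G}" for F
      proof -
        have "\<not> H \<subseteq> inside (img C)" using GH(4) J face_facts[OF H] by blast
        then have "F \<noteq> H" using F by auto
        then have "\<not> F \<subseteq> side ?X e" using F eqset_imp_iff[OF GH(1), of F] by simp
        then have "F \<in> faces X" "F \<noteq> side ?X e"
          using F faces_insert[of e ?X] insert.prems(1) Xe by auto
        then show ?thesis by (rule old)
      qed
      then have "even (sum h (?I - {G}))" by (rule dvd_sum)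
      moreover have "sum h ?I = h G + sum h (?I - {G})"
        using fin G GH(3) by (intro sum.remove) auto
      moreover have "even (sum h ?I)" using insert.prems(3)[OF C(1,2)] by simp
      ultimately have "even (h G)" by presburger
      moreover have "even (h G + h H)" using eside GH(1,2) by simp
      ultimately show ?thesis using F eqset_imp_iff[OF GH(1), of F] by auto
    qed
    have "F \<in> (faces X - {side ?X e}) \<union> {F \<in> faces ?X. F \<subseteq> side ?X e}"
      using insert.prems(4) faces_insert[of e ?X] insert.prems(1) Xe by simp
    then show ?case using side_case old by blast
  qed
qed

end

text \<open>\<open>cycle_at\<close> is 2-connectedness in the form that the parity arguments use: a
  cycle passing through a vertex along two prescribed edges. \<open>min_degree\<close> supplies the
  second edge, so that every edge lies on a cycle.\<close>

locale cyclic_plane_drawing = plane_drawing +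
  assumes cycle_at: "\<And>v a z. v \<in> V \<Longrightarrow> a \<in> star E v \<Longrightarrow> z \<in> star E v \<Longrightarrow> a \<noteq> z \<Longrightarrow>
      \<exists>C. is_cycle C \<and> C \<subseteq> E \<and> star C v = {a, z}"
    and min_degree: "\<And>v. v \<in> V \<Longrightarrow> 2 \<le> card (star E v)"
begin

text \<open>Incidence is tested by opening the edge instead of by the frontier of \<open>F\<close>,
  which makes the counts of \<open>side_meets_half\<close> directly available.
  \<open>face_meets_side\<close> later links it to closures.\<close>

definition boundary :: "complex set \<Rightarrow> 'a set set" where
  "boundary F = {e \<in> E. F \<subseteq> side E e}"

lemma finite_star [simp]: "finite (star E v)"
  using finite_E by (simp add: star_def)

lemma edge_on_cycle:
  assumes "e \<in> E"
  obtains C where "is_cycle C" "C \<subseteq> E" "e \<in> C"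
proof -
  have "e \<noteq> {}" using card_edge[OF assms] by auto
  then obtain v where v: "v \<in> e" "v \<in> V" using edge_V[OF assms] by blast
  then have e: "e \<in> star E v" using assms by (simp add: star_def)
  have "star E v \<noteq> {e}" using min_degree[OF v(2)] by auto
  with e obtain z where "z \<in> star E v" "e \<noteq> z" by blast
  with cycle_at[OF v(2) e] obtain C where "is_cycle C" "C \<subseteq> E" "star C v = {e, z}" by blast
  with that show ?thesis by (auto simp: star_def)
qed

lemma two_faces:
  assumes "e \<in> E"
  shows "card {F \<in> faces E. e \<in> boundary F} = 2"
proof -
  obtain C where C: "is_cycle C" "C \<subseteq> E" "e \<in> C" using edge_on_cycle[OF assms] .
  obtain F G where "{H \<in> faces E. H \<subseteq> side E e} = {F, G}" "F \<noteq> G"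
    by (rule faces_in_side_cycle[OF C(1,2) order_refl C(3)])
  with assms show ?thesis by (simp add: boundary_def)
qed

text \<open>An edge of \<open>C\<close> has exactly one of its two faces inside. For any other edge
  the connected set \<open>side E e\<close> misses \<open>img C\<close>, so both faces or none lie
  inside.\<close>

lemma faces_inside_at_edge:
  assumes C: "is_cycle C" "C \<subseteq> E" and e: "e \<in> E"
  shows "odd (card {F \<in> faces E. F \<subseteq> inside (img C) \<and> e \<in> boundary F}) \<longleftrightarrow> e \<in> C"
proof (cases "e \<in> C")
  case True
  obtain F where "{H \<in> faces E. H \<subseteq> side E e \<and> H \<subseteq> inside (img C)} = {F}"
    using side_meets_half[OF C order_refl True disjI1[OF refl]] by (elim exE)
  then have "{F \<in> faces E. F \<subseteq> inside (img C) \<and> e \<in> boundary F} = {F}"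
    using e by (simp add: boundary_def conj_ac)
  with True show ?thesis by simp
next
  case False
  then have "img C \<subseteq> img (E - {e})" using C by (intro img_mono) auto
  then have "side E e \<inter> img C = {}" using side_disjoint[of E e] by blast
  from connected_inside_or_outside[OF C connected_side this]
  consider "side E e \<subseteq> inside (img C)" | "side E e \<subseteq> outside (img C)" by blast
  then have "{F \<in> faces E. F \<subseteq> inside (img C) \<and> e \<in> boundary F} = {F \<in> faces E. e \<in> boundary F} \<or>
      {F \<in> faces E. F \<subseteq> inside (img C) \<and> e \<in> boundary F} = {}"
  proof cases
    case 1
    have "F \<subseteq> inside (img C)" if "e \<in> boundary F" for F
      using that order_trans[OF _ 1, of F] by (simp add: boundary_def)
    then show ?thesis by (intro disjI1 Collect_cong iffI) simp_all
  next
    case 2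
    have "\<not> F \<subseteq> inside (img C)" if F: "F \<in> faces E" "e \<in> boundary F" for F
    proof -
      have "F \<subseteq> outside (img C)" "F \<noteq> {}"
        using F 2 face_facts[OF F(1)] by (auto simp: boundary_def)
      then show ?thesis using Jordan_img(3)[OF C] by blast
    qed
    then show ?thesis by (intro disjI2 Collect_empty_eq[THEN iffD2] allI notI) (elim conjE, simp)
  qed
  then have "card {F \<in> faces E. F \<subseteq> inside (img C) \<and> e \<in> boundary F} = 2 \<or>
      card {F \<in> faces E. F \<subseteq> inside (img C) \<and> e \<in> boundary F} = 0"
    by (elim disjE) (simp_all only: two_faces[OF e] card.empty, simp_all)
  then have "even (card {F \<in> faces E. F \<subseteq> inside (img C) \<and> e \<in> boundary F})"
    by (elim disjE) simp_all
  with False show ?thesis by simp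
qed

lemma sum_star_boundary:
  assumes "S \<subseteq> faces E" "\<And>F. F \<in> S \<Longrightarrow> star (boundary F) v \<subseteq> A" "A \<subseteq> star E v"
  shows "(\<Sum>F\<in>S. card (star (boundary F) v)) = (\<Sum>e\<in>A. card {F \<in> S. e \<in> boundary F})"
proof -
  have fin: "finite S" "finite A"
    using assms finite_faces[OF order_refl] finite_subset finite_star by metis+
  have "(\<Sum>F\<in>S. card (star (boundary F) v)) = (\<Sum>F\<in>S. \<Sum>e\<in>A. if e \<in> boundary F then 1 else 0)"
  proof (rule sum.cong[OF refl])
    fix F assume "F \<in> S"
    then have "star (boundary F) v = A \<inter> {e. e \<in> boundary F}"
      using assms(2)[of F] assms(3) by (auto simp: star_def)
    then show "card (star (boundary F) v) = (\<Sum>e\<in>A. if e \<in> boundary F then 1 else 0)"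
      using fin by (simp add: sum.If_cases)
  qed
  also have "\<dots> = (\<Sum>e\<in>A. \<Sum>F\<in>S. if e \<in> boundary F then 1 else 0)" by (rule sum.swap)
  also have "\<dots> = (\<Sum>e\<in>A. card {F \<in> S. e \<in> boundary F})"
    using fin by (simp add: sum.If_cases Collect_conj_eq)
  finally show ?thesis .
qed

text \<open>\<open>even_face_function\<close> is applied to the number of boundary edges at
  \<open>v\<close>. Over all faces every edge counts twice; over the faces inside \<open>C\<close>
  the edges with odd count are those of \<open>C\<close> at \<open>v\<close>, and their number is
  even.\<close>

lemma even_boundary:
  assumes "F \<in> faces E"
  shows "even (card (star (boundary F) v))"
proof (rule even_face_function[OF order_refl _ _ assms, where h = "\<lambda>F. card (star (boundary F) v)"])
  have sub: "star (boundary F) v \<subseteq> star E v" for F by (auto simp: star_def boundary_def)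
  show "even (\<Sum>F\<in>faces E. card (star (boundary F) v))"
    unfolding sum_star_boundary[OF order_refl sub order_refl]
    by (intro dvd_sum) (simp add: two_faces star_def)
  fix C assume C: "is_cycle C" "C \<subseteq> E"
  let ?I = "{F \<in> faces E. F \<subseteq> inside (img C)}"
  let ?n = "\<lambda>e. card {F \<in> ?I. e \<in> boundary F}"
  have odd_n: "odd (?n e) \<longleftrightarrow> e \<in> C" if "e \<in> star E v" for e
    using faces_inside_at_edge[OF C, of e] that by (simp add: star_def conj_assoc)
  have "(\<Sum>F\<in>?I. card (star (boundary F) v)) = (\<Sum>e\<in>star E v. ?n e)"
    by (rule sum_star_boundary) (use sub in auto)
  moreover have "even (\<Sum>e\<in>star E v. ?n e) \<longleftrightarrow> even (card {e \<in> star E v. odd (?n e)})"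
    by (rule even_sum_iff) simp
  moreover have "{e \<in> star E v. odd (?n e)} = star C v"
    using odd_n C(2) by (auto simp: star_def)
  ultimately show "even (\<Sum>F | F \<in> faces E \<and> F \<subseteq> inside (img C). card (star (boundary F) v))"
    using even_degree_is_cycle[OF C(1), of v] by simp
qed

text \<open>The faces at a vertex form a single cyclic sequence.\<close>

lemma link_connected:
  assumes v: "v \<in> V" and A: "A \<subseteq> star E v" "A \<noteq> {}"
    and closed: "\<And>F. F \<in> faces E \<Longrightarrow> boundary F \<inter> A \<noteq> {} \<Longrightarrow> star (boundary F) v \<subseteq> A"
  shows "A = star E v"
proof (rule ccontr)
  assume "A \<noteq> star E v"
  with A obtain a z where az: "a \<in> A" "z \<in> star E v" "z \<notin> A" by blast
  then obtain C where C: "is_cycle C" "C \<subseteq> E" "star C v = {a, z}"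
    using cycle_at[OF v, of a z] A by blast
  \<comment> \<open>At \<open>v\<close> the cycle uses \<open>A\<close> only in \<open>a\<close>.
    Among the incidences of edges of \<open>A\<close> with the faces inside \<open>C\<close>,
    \<open>a\<close> contributes an odd number and every other edge an even one, while even stars
    make the total even.\<close>
  let ?S = "{F \<in> faces E. F \<subseteq> inside (img C) \<and> boundary F \<inter> A \<noteq> {}}"
  let ?n = "\<lambda>e. card {F \<in> ?S. e \<in> boundary F}"
  have odd_n: "odd (?n e) \<longleftrightarrow> e = a" if "e \<in> A" for e
  proof -
    have "{F \<in> ?S. e \<in> boundary F} = {F \<in> faces E. F \<subseteq> inside (img C) \<and> e \<in> boundary F}"
      using that by auto
    moreover have "e \<in> C \<longleftrightarrow> e = a" "e \<in> E"
      using that A C(3) az by (auto simp: star_def)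
    ultimately show ?thesis using faces_inside_at_edge[OF C(1,2), of e] by simp
  qed
  have "finite A" using A(1) finite_star finite_subset by blast
  then have "even (\<Sum>e\<in>A. ?n e) \<longleftrightarrow> even (card {e \<in> A. odd (?n e)})"
    by (rule even_sum_iff)
  moreover have "{e \<in> A. odd (?n e)} = {a}" using odd_n az(1) by blast
  ultimately have "odd (\<Sum>e\<in>A. ?n e)" by simp
  moreover have "(\<Sum>F\<in>?S. card (star (boundary F) v)) = (\<Sum>e\<in>A. ?n e)"
    by (rule sum_star_boundary) (use closed A(1) in auto)
  moreover have "even (\<Sum>F\<in>?S. card (star (boundary F) v))"
    by (intro dvd_sum) (auto intro: even_boundary)
  ultimately show False by simp
qed

end

section \<open>Faces of a 2-connected drawing\<close>

lemma contains_C6I: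
  assumes "distinct [a, b, c, d, e, f]" "{a, b, c, d, e, f} \<subseteq> V"
    "{a, b} \<in> E" "{b, c} \<in> E" "{c, d} \<in> E" "{d, e} \<in> E" "{e, f} \<in> E" "{f, a} \<in> E"
  shows "contains_C6 V E"
proof -
  let ?f = "\<lambda>i. [a, b, c, d, e, f] ! i"
  have six: "i < 6 \<longleftrightarrow> i = 0 \<or> i = 1 \<or> i = 2 \<or> i = 3 \<or> i = 4 \<or> i = 5" for i :: nat by auto
  have "inj_on ?f {0..<6}"
    using inj_on_nth[OF assms(1), of "{0..<6}"] by auto
  moreover have "?f ` {0..<6} \<subseteq> V"
    using assms(2) by (auto simp: six)
  moreover have "\<forall>i<6. {?f i, ?f ((i + 1) mod 6)} \<in> E"
    using assms(3-8) unfolding six by auto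
  ultimately show ?thesis unfolding contains_C6_def by (intro exI[of _ ?f] conjI)
qed

text \<open>All that the counting needs from topology, with faces reduced to abstract names.
  \<open>link\<close> says that the faces at \<open>v\<close> form one cyclic sequence: a nonempty
  edge set at \<open>v\<close> that is closed under passing through faces is the whole star.\<close>

locale face_system =
  fixes V :: "'a set" and E :: "'a set set" and Fs :: "'f set" and bd :: "'f \<Rightarrow> 'a set set"
  assumes finite_V: "finite V" and finite_Fs: "finite Fs"
    and edges: "\<And>e. e \<in> E \<Longrightarrow> e \<subseteq> V \<and> card e = 2"
    and bd_E: "\<And>F. F \<in> Fs \<Longrightarrow> bd F \<subseteq> E"
    and bd_nonempty: "\<And>F. F \<in> Fs \<Longrightarrow> bd F \<noteq> {}"
    and two_faces: "\<And>e. e \<in> E \<Longrightarrow> card {F \<in> Fs. e \<in> bd F} = 2"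
    and even_bd: "\<And>F v. F \<in> Fs \<Longrightarrow> even (card (star (bd F) v))"
    and link: "\<And>v A. v \<in> V \<Longrightarrow> A \<subseteq> star E v \<Longrightarrow> A \<noteq> {} \<Longrightarrow>
      (\<And>F. F \<in> Fs \<Longrightarrow> bd F \<inter> A \<noteq> {} \<Longrightarrow> star (bd F) v \<subseteq> A) \<Longrightarrow> A = star E v"
    and degree3: "\<And>v. v \<in> V \<Longrightarrow> 3 \<le> card (star E v)"
    and connected: "\<And>X. X \<subseteq> V \<Longrightarrow> X \<noteq> {} \<Longrightarrow> X \<noteq> V \<Longrightarrow> \<exists>x\<in>X. \<exists>y\<in>V - X. {x, y} \<in> E"
    and card_V: "6 \<le> card V"
    and no_K4: "\<not> contains_K4 V E"
    and no_C6: "\<not> contains_C6 V E"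
begin

definition adj :: "'a \<Rightarrow> 'a \<Rightarrow> bool" where
  "adj x y \<longleftrightarrow> {x, y} \<in> E"

lemma adj_sym: "adj x y \<longleftrightarrow> adj y x"
  by (simp add: adj_def insert_commute)

lemma adj_V: "adj x y \<Longrightarrow> x \<in> V \<and> y \<in> V \<and> x \<noteq> y"
  using edges[of "{x, y}"] by (auto simp: adj_def)

lemma finite_E: "finite E"
  using finite_V edges finite_subset[of E "Pow V"] by blast

lemma finite_bd: "F \<in> Fs \<Longrightarrow> finite (bd F)"
  using bd_E finite_E finite_subset by blast

lemma K4:
  assumes "distinct [a, b, c, d]" "adj a b" "adj a c" "adj a d" "adj b c" "adj b d" "adj c d"
  shows False
proof -
  let ?f = "\<lambda>i. [a, b, c, d] ! i"
  have four: "i < 4 \<longleftrightarrow> i = 0 \<or> i = 1 \<or> i = 2 \<or> i = 3" for i :: nat by auto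
  have "inj_on ?f {0..<4}"
    using inj_on_nth[OF assms(1), of "{0..<4}"] by auto
  moreover have "?f ` {0..<4} \<subseteq> V"
    using assms(2-7) adj_V by (fastforce simp: four)
  moreover have "\<forall>i<4. \<forall>j<4. i \<noteq> j \<longrightarrow> {?f i, ?f j} \<in> E"
    using assms(2-7) unfolding four by (auto simp: adj_def insert_commute)
  ultimately have "contains_K4 V E" unfolding contains_K4_def by blast
  with no_K4 show False ..
qed

lemma C6:
  assumes "distinct [a, b, c, d, e, f]"
    "adj a b" "adj b c" "adj c d" "adj d e" "adj e f" "adj f a"
  shows False
  using contains_C6I[OF assms(1), of V E] assms(2-7) adj_V no_C6 by (simp add: adj_def)

text \<open>An even edge set through \<open>{u, v}\<close> consists of a cycle and an even rest, which is empty or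
  has at least three edges.\<close>

lemma face_cycle:
  assumes "F \<in> Fs" "{u, v} \<in> bd F"
  obtains p where "distinct p" "3 \<le> length p" "hd p = u" "last p = v"
    "insert {u, v} (ledges p) \<subseteq> bd F" "card (insert {u, v} (ledges p)) = length p"
    "insert {u, v} (ledges p) = bd F \<or> length p + 3 \<le> card (bd F)"
proof -
  have c2: "\<And>e. e \<in> bd F \<Longrightarrow> card e = 2" using edges bd_E[OF assms(1)] by blast
  note fin = finite_bd[OF assms(1)]
  obtain C where C: "is_cycle C" "C \<subseteq> bd F" "{u, v} \<in> C"
    by (rule even_edge_set_cycle[OF fin c2 even_bd[OF assms(1)] assms(2)])
  obtain p u' v' where p: "upath (C - {{u, v}}) u' p v'" "{u, v} = {u', v'}" "u' \<noteq> v'"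
    "C = insert {u, v} (ledges p)" "{u, v} \<notin> ledges p" "3 \<le> length p"
    by (rule is_cycle_through[OF C(1,3)])
  define q where "q = (if u' = u then p else rev p)"
  have rev: "ledges (rev xs) = ledges xs" for xs :: "'a list"
  proof (induction xs rule: ledges.induct)
    case (1 x y xs)
    then show ?case using ledges_append[of "rev (y # xs)" "[x]"]
      by (auto simp: insert_commute)
  qed auto
  have uv: "u' = u \<and> v' = v \<or> u' = v \<and> v' = u" using p(2) by (auto simp: doubleton_eq_iff)
  have q: "distinct q" "3 \<le> length q" "hd q = u" "last q = v" "ledges q = ledges p" "length q = length p"
    using p uv by (auto simp: q_def upath_def rev hd_rev last_rev)
  have dp: "distinct p" using p(1) by (simp add: upath_def)
  have card_C: "card C = length p"
    using p(4,5,6) card_ledges[OF dp] by simp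
  have "C = bd F \<or> length p + 3 \<le> card (bd F)"
  proof (cases "bd F - C = {}")
    case True
    then show ?thesis using C(2) by auto
  next
    case False
    then obtain e where e: "e \<in> bd F - C" by blast
    then obtain a b where ab: "{a, b} \<in> bd F - C" using c2[of e] by (auto simp: card_2_iff)
    have "even (card (star (bd F - C) w))" for w
    proof -
      have "star (bd F - C) w = star (bd F) w - star C w" by (auto simp: star_def)
      moreover have "star C w \<subseteq> star (bd F) w" "finite (star C w)"
        using C(2) finite_subset[OF C(2) fin] by (auto simp: star_def)
      moreover have "card (star C w) \<le> card (star (bd F) w)"
        using calculation fin by (intro card_mono) (auto simp: star_def)
      ultimately show ?thesis
        using even_bd[OF assms(1), of w] even_degree_is_cycle[OF C(1), of w]
        by (simp add: card_Diff_subset)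
    qed
    then obtain D where D: "is_cycle D" "D \<subseteq> bd F - C"
      using even_edge_set_cycle[of "bd F - C" a b] fin c2 ab by blast
    obtain q where q: "distinct q" "3 \<le> length q" "D = insert {last q, hd q} (ledges q)"
      using D(1) by (auto simp: is_cycle_def)
    then have "card D = length q"
      using hd_last_notin_ledges[OF q(1,2)] card_ledges[OF q(1)] by simp
    then have "3 \<le> card (bd F - C)"
      using q(2) card_mono[OF _ D(2)] fin by simp
    moreover have "card (bd F) = card C + card (bd F - C)"
      using C(2) fin card_Diff_subset[of C "bd F"] card_mono[OF fin C(2)] finite_subset[OF C(2) fin] by simp
    ultimately show ?thesis using card_C by simp
  qed
  with q p(4) C(2) card_C show ?thesis by (intro that[of q]) simp_all
qed

lemma card_bd_ge3:
  assumes "F \<in> Fs"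
  shows "3 \<le> card (bd F)"
proof -
  obtain e where e: "e \<in> bd F" using bd_nonempty[OF assms] by blast
  then have "card e = 2" using edges bd_E[OF assms] by blast
  then obtain u v where "{u, v} \<in> bd F" using e by (auto simp: card_2_iff)
  from face_cycle[OF assms this] show ?thesis
    by (metis add_leD2 order_refl)
qed

definition tri :: "'f \<Rightarrow> 'a \<Rightarrow> 'a \<Rightarrow> 'a \<Rightarrow> bool" where
  "tri F a b c \<longleftrightarrow> F \<in> Fs \<and> distinct [a, b, c] \<and> bd F = {{a, b}, {b, c}, {c, a}}"

definition quad :: "'f \<Rightarrow> 'a \<Rightarrow> 'a \<Rightarrow> 'a \<Rightarrow> 'a \<Rightarrow> bool" where
  "quad F a b c d \<longleftrightarrow>
    F \<in> Fs \<and> distinct [a, b, c, d] \<and> bd F = {{a, b}, {b, c}, {c, d}, {d, a}}"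

lemma tri_rot: "tri F a b c \<Longrightarrow> tri F b c a"
  and tri_flip: "tri F a b c \<Longrightarrow> tri F b a c"
  by (auto simp: tri_def insert_commute)

lemma quad_rot: "quad F a b c d \<Longrightarrow> quad F b c d a"
  and quad_flip: "quad F a b c d \<Longrightarrow> quad F b a d c"
  by (auto simp: quad_def insert_commute)

lemma tri_adj: "tri F a b c \<Longrightarrow> adj a b \<and> adj b c \<and> adj c a \<and> a \<noteq> b \<and> b \<noteq> c \<and> c \<noteq> a"
  using bd_E[of F] by (auto simp: tri_def adj_def)

lemma quad_adj: "quad F a b c d \<Longrightarrow>
    adj a b \<and> adj b c \<and> adj c d \<and> adj d a \<and> distinct [a, b, c, d]"
  using bd_E[of F] by (auto simp: quad_def adj_def)

lemma card_tri: "tri F a b c \<Longrightarrow> card (bd F) = 3"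
  by (auto simp: tri_def doubleton_eq_iff card_insert_if)

lemma card_quad: "quad F a b c d \<Longrightarrow> card (bd F) = 4"
  by (auto simp: quad_def doubleton_eq_iff card_insert_if)

lemma triE:
  assumes "F \<in> Fs" "card (bd F) = 3" "{a, b} \<in> bd F"
  obtains c where "tri F a b c"
proof -
  obtain p where p: "distinct p" "3 \<le> length p" "hd p = a" "last p = b"
    "insert {a, b} (ledges p) \<subseteq> bd F" "card (insert {a, b} (ledges p)) = length p"
    "insert {a, b} (ledges p) = bd F \<or> length p + 3 \<le> card (bd F)"
    by (rule face_cycle[OF assms(1,3)])
  have "length p = 3" using p assms(2) by auto
  then obtain c where "p = [a, c, b]" using p(3,4)
    by (auto simp: numeral_3_eq_3 length_Suc_conv)
  with p assms that[of c] show ?thesis by (auto simp: tri_def insert_commute)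
qed

lemma quadE:
  assumes "F \<in> Fs" "card (bd F) = 4" "{a, b} \<in> bd F"
  obtains c d where "quad F a b c d"
proof -
  obtain p where p: "distinct p" "3 \<le> length p" "hd p = a" "last p = b"
    "insert {a, b} (ledges p) \<subseteq> bd F" "card (insert {a, b} (ledges p)) = length p"
    "insert {a, b} (ledges p) = bd F \<or> length p + 3 \<le> card (bd F)"
    by (rule face_cycle[OF assms(1,3)])
  have "length p = 4" using p assms(2) by auto
  then obtain c d where "p = [a, d, c, b]" using p(3,4)
    by (auto simp: eval_nat_numeral length_Suc_conv)
  with p assms that[of c d] show ?thesis by (auto simp: quad_def insert_commute)
qed

lemma edge_two_faces:
  assumes "F \<in> Fs" "G \<in> Fs" "H \<in> Fs" "e \<in> bd F" "e \<in> bd G" "e \<in> bd H" "F \<noteq> G"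
  shows "H = F \<or> H = G"
proof (rule ccontr)
  assume *: "\<not> ?thesis"
  have "{F, G, H} \<subseteq> {F \<in> Fs. e \<in> bd F}" using assms by auto
  then have "card {F, G, H} \<le> card {F \<in> Fs. e \<in> bd F}"
    using finite_Fs by (intro card_mono) auto
  with * assms two_faces[of e] bd_E[of F] show False by auto
qed

lemma other_face:
  assumes "F \<in> Fs" "e \<in> bd F"
  obtains G where "G \<in> Fs" "e \<in> bd G" "G \<noteq> F"
proof -
  have "card {F \<in> Fs. e \<in> bd F} = 2" using assms two_faces bd_E by blast
  then obtain G H where "{F \<in> Fs. e \<in> bd F} = {G, H}" "G \<noteq> H" by (auto simp: card_2_iff)
  then show ?thesis using that by (metis (mono_tags, lifting) insertCI mem_Collect_eq)
qed

text \<open>If both faces of every edge in \<open>A\<close> belong to \<open>S\<close>, no further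
  face touches \<open>A\<close>, so \<open>link\<close> makes \<open>A\<close> the whole star. In
  this way a vertex surrounded by known faces gets a known degree.\<close>

lemma link_closed:
  assumes "A \<noteq> {}" "\<And>F. F \<in> S \<Longrightarrow> F \<in> Fs \<and> star (bd F) v \<subseteq> A"
    and "\<And>e. e \<in> A \<Longrightarrow> v \<in> e \<and> (\<exists>F\<in>S. \<exists>G\<in>S. F \<noteq> G \<and> e \<in> bd F \<and> e \<in> bd G)"
  shows "star E v = A"
proof -
  have sub: "A \<subseteq> star E v" using assms(2,3) bd_E by (fastforce simp: star_def)
  obtain e where "e \<in> A" using assms(1) by blast
  then have "v \<in> V" using assms(3) sub edges[of e] by (auto simp: star_def)
  then have "A = star E v"
  proof (rule link[OF _ sub assms(1)])
    fix F assume F: "F \<in> Fs" "bd F \<inter> A \<noteq> {}"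
    then obtain e where e: "e \<in> bd F" "e \<in> A" by blast
    then obtain G H where "G \<in> S" "H \<in> S" "G \<noteq> H" "e \<in> bd G" "e \<in> bd H" using assms(3) by blast
    then have "F \<in> S" using edge_two_faces[of G H F e] assms(2) F(1) e(1) by blast
    then show "star (bd F) v \<subseteq> A" using assms(2) by blast
  qed
  then show ?thesis ..
qed

lemma star_tri: "tri F a b c \<Longrightarrow> star (bd F) a = {{a, b}, {a, c}}"
  by (auto simp: tri_def star_def insert_commute)

lemma star_quad: "quad F a b c d \<Longrightarrow> star (bd F) a = {{a, b}, {a, d}}"
  by (auto simp: quad_def star_def insert_commute)

text \<open>Two faces with the same corner at \<open>v\<close> would already close the cyclic
  sequence around \<open>v\<close>, leaving degree 2.\<close>

lemma no_common_corner:
  assumes "F \<in> Fs" "G \<in> Fs" "F \<noteq> G"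
    "star (bd F) v = {{v, a}, {v, b}}" "star (bd G) v = {{v, a}, {v, b}}"
  shows False
proof -
  have m: "e \<in> star (bd F) v \<Longrightarrow> v \<in> e \<and> e \<in> bd F" "e \<in> star (bd G) v \<Longrightarrow> v \<in> e \<and> e \<in> bd G" for e
    by (auto simp: star_def)
  have s: "star E v = {{v, a}, {v, b}}"
    by (rule link_closed[of _ "{F, G}"]) (use assms m in auto)
  have "{v, a} \<in> E" using s by (auto simp: star_def)
  then have "v \<in> V" using edges by blast
  from degree3[OF this] s have "3 \<le> card {{v, a}, {v, b}}" by simp
  also have "\<dots> \<le> 2" by (simp add: card_insert_if)
  finally show False by simp
qed

lemma tri_tri_apex:
  assumes "tri F a b c" "tri G a b d" "F \<noteq> G"
  shows "c \<noteq> d"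
proof
  assume "c = d"
  then show False
    using no_common_corner[of F G a b c] assms star_tri by (auto simp: tri_def)
qed

text \<open>\<open>x = d\<close> or \<open>x = c\<close> would give the two faces a common corner at
  \<open>a\<close> or \<open>b\<close>.\<close>

lemma tri_quad_apex:
  assumes "tri T a b x" "quad F a b c d"
  shows "x \<notin> {a, b, c, d}"
proof -
  have TF: "T \<noteq> F" "T \<in> Fs" "F \<in> Fs"
    using card_tri[OF assms(1)] card_quad[OF assms(2)] assms by (auto simp: tri_def quad_def)
  have "x \<noteq> d"
    using no_common_corner[OF TF(2,3,1), of a b x] star_tri[OF assms(1)] star_quad[OF assms(2)] by auto
  moreover have "x \<noteq> c"
    using no_common_corner[OF TF(2,3,1), of b a x]
      star_tri[OF tri_flip[OF assms(1)]] star_quad[OF quad_flip[OF assms(2)]] by auto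
  ultimately show ?thesis using tri_adj[OF assms(1)] by auto
qed

section \<open>Wheels with four spokes\<close>

definition wheel :: "'a \<Rightarrow> 'a \<Rightarrow> 'a \<Rightarrow> 'a \<Rightarrow> 'a \<Rightarrow> bool" where
  "wheel c p q r s \<longleftrightarrow> distinct [c, p, q, r, s] \<and> adj c p \<and> adj c q \<and> adj c r \<and> adj c s \<and>
    adj p q \<and> adj q r \<and> adj r s \<and> adj s p"

definition wheel_edges :: "'a \<Rightarrow> 'a \<Rightarrow> 'a \<Rightarrow> 'a \<Rightarrow> 'a \<Rightarrow> 'a set set" where
  "wheel_edges c p q r s =
    {{c, p}, {c, q}, {c, r}, {c, s}, {p, q}, {q, r}, {r, s}, {s, p}}"

text \<open>A chord between opposite rim vertices would complete a K4 with the hub and a rim vertex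
  between them.\<close>

lemma wheel_adj_edges:
  assumes W: "wheel c p q r s" and uv: "adj u v" "u \<in> {c, p, q, r, s}" "v \<in> {c, p, q, r, s}"
  shows "{u, v} \<in> wheel_edges c p q r s"
proof -
  have "\<not> adj p r" "\<not> adj q s"
    using W K4[of c p q r] K4[of c q r s] by (auto simp: wheel_def adj_sym)
  then show ?thesis
    using uv adj_V[OF uv(1)] adj_sym[of p r] adj_sym[of q s]
    by (auto simp: wheel_edges_def doubleton_eq_iff)
qed

lemma wheel_rot: "wheel c p q r s \<Longrightarrow> wheel c q r s p"
  by (auto simp: wheel_def)

text \<open>Inner paths of lengths 2, 3 and 4: whichever of the lengths 4, 3 and 2 an outer path
  between the same ends has, one of them completes it to a 6-cycle.\<close>

definition linked :: "'a set \<Rightarrow> 'a \<Rightarrow> 'a \<Rightarrow> bool" where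
  "linked P u v \<longleftrightarrow>
    (\<exists>a\<in>P. distinct [u, a, v] \<and> adj u a \<and> adj a v) \<and>
    (\<exists>a\<in>P. \<exists>b\<in>P. distinct [u, a, b, v] \<and> adj u a \<and> adj a b \<and> adj b v) \<and>
    (\<exists>a\<in>P. \<exists>b\<in>P. \<exists>d\<in>P. distinct [u, a, b, d, v] \<and>
      adj u a \<and> adj a b \<and> adj b d \<and> adj d v)"

lemma linkedI:
  assumes "a1 \<in> P" "distinct [u, a1, v]" "adj u a1" "adj a1 v"
    "a2 \<in> P" "b2 \<in> P" "distinct [u, a2, b2, v]" "adj u a2" "adj a2 b2" "adj b2 v"
    "a3 \<in> P" "b3 \<in> P" "d3 \<in> P" "distinct [u, a3, b3, d3, v]"
    "adj u a3" "adj a3 b3" "adj b3 d3" "adj d3 v"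
  shows "linked P u v"
  unfolding linked_def using assms by blast

lemma linked_sym:
  assumes "linked P u v"
  shows "linked P v u"
proof -
  obtain a1 a2 b2 a3 b3 d3 where "a1 \<in> P" "distinct [u, a1, v]" "adj u a1" "adj a1 v"
    "a2 \<in> P" "b2 \<in> P" "distinct [u, a2, b2, v]" "adj u a2" "adj a2 b2" "adj b2 v"
    "a3 \<in> P" "b3 \<in> P" "d3 \<in> P" "distinct [u, a3, b3, d3, v]"
    "adj u a3" "adj a3 b3" "adj b3 d3" "adj d3 v"
    using assms unfolding linked_def by blast
  then show ?thesis
    by (intro linkedI[of a1 P v u b2 a2 d3 b3 a3]) (auto simp: adj_sym)
qed

lemma wheel_linked:
  assumes W: "wheel c p q r s" and uv: "u \<in> {c, p, q, r, s}" "v \<in> {c, p, q, r, s}" "u \<noteq> v"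
  shows "linked {c, p, q, r, s} u v"
proof -
  let ?P = "{c, p, q, r, s}"
  \<comment> \<open>Up to rotation there are three kinds of pairs: hub and rim vertex, neighbours on
    the rim, opposite rim vertices. The witnesses are the inner vertices of the paths of lengths 2,
    3 and 4, in this order.\<close>
  have base: "linked ?P c p \<and> linked ?P p q \<and> linked ?P p r"
    if "?P = {c, p, q, r, s}" "wheel c p q r s" for p q r s
  proof -
    note w = that(2)[unfolded wheel_def]
    have "linked {c, p, q, r, s} c p"
      by (rule linkedI[of q _ _ _ r q s r q]) (use w in \<open>auto simp: adj_sym\<close>)
    moreover have "linked {c, p, q, r, s} p q"
      by (rule linkedI[of c _ _ _ c r s c r]) (use w in \<open>auto simp: adj_sym\<close>)
    moreover have "linked {c, p, q, r, s} p r"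
      by (rule linkedI[of c _ _ _ q c q c s]) (use w in \<open>auto simp: adj_sym\<close>)
    ultimately show ?thesis using that(1) by simp
  qed
  have W1: "wheel c q r s p" by (rule wheel_rot[OF W])
  have W2: "wheel c r s p q" by (rule wheel_rot[OF W1])
  have W3: "wheel c s p q r" by (rule wheel_rot[OF W2])
  have P: "?P = {c, q, r, s, p}" "?P = {c, r, s, p, q}" "?P = {c, s, p, q, r}" by auto
  have "linked ?P c p" "linked ?P p q" "linked ?P p r" using base[OF refl W] by blast+
  moreover have "linked ?P c q" "linked ?P q r" "linked ?P q s" using base[OF P(1) W1] by blast+
  moreover have "linked ?P c r" "linked ?P r s" using base[OF P(2) W2] by blast+
  moreover have "linked ?P c s" "linked ?P s p" using base[OF P(3) W3] by blast+
  ultimately show ?thesis using uv linked_sym[of ?P] by blast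
qed

text \<open>An outer path with one, two or three inner vertices is closed to a 6-cycle by the inner
  path of length 4, 3 or 2.\<close>

lemma no_ear:
  assumes "linked P u v" "u \<in> P" "v \<in> P"
  shows "x \<notin> P \<Longrightarrow> adj u x \<Longrightarrow> adj x v \<Longrightarrow> False"
    and "x \<notin> P \<Longrightarrow> y \<notin> P \<Longrightarrow> adj u x \<Longrightarrow> adj x y \<Longrightarrow> adj y v \<Longrightarrow> False"
    and "x \<notin> P \<Longrightarrow> y \<notin> P \<Longrightarrow> z \<notin> P \<Longrightarrow> x \<noteq> z \<Longrightarrow>
      adj u x \<Longrightarrow> adj x y \<Longrightarrow> adj y z \<Longrightarrow> adj z v \<Longrightarrow> False"
proof -
  obtain a1 a2 b2 a3 b3 d3 where a: "a1 \<in> P" "distinct [u, a1, v]" "adj u a1" "adj a1 v"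
    "a2 \<in> P" "b2 \<in> P" "distinct [u, a2, b2, v]" "adj u a2" "adj a2 b2" "adj b2 v"
    "a3 \<in> P" "b3 \<in> P" "d3 \<in> P" "distinct [u, a3, b3, d3, v]"
    "adj u a3" "adj a3 b3" "adj b3 d3" "adj d3 v"
    using assms unfolding linked_def by blast
  show False if "x \<notin> P" "adj u x" "adj x v"
    by (rule C6[of u a3 b3 d3 v x]) (use a that assms(2,3) in \<open>auto simp: adj_sym\<close>)
  show False if "x \<notin> P" "y \<notin> P" "adj u x" "adj x y" "adj y v"
    by (rule C6[of u a2 b2 v y x]) (use a that assms(2,3) adj_V[of x y] in \<open>auto simp: adj_sym\<close>)
  show False if "x \<notin> P" "y \<notin> P" "z \<notin> P" "x \<noteq> z" "adj u x" "adj x y" "adj y z" "adj z v"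
    by (rule C6[of u a1 v z y x]) (use a that assms(2,3) adj_V[of x y] adj_V[of y z] in \<open>auto simp: adj_sym\<close>)
qed

text \<open>The boundary contains a cycle through \<open>e\<close> of length at most 6, and length 6
  is excluded. On a shorter one every stretch outside the wheel would be an ear with at most three
  inner vertices. So the cycle stays among the five vertices, where all edges are wheel edges. A
  boundary that is not just this cycle has at least three more edges, which leaves only 3 +
  3.\<close>

lemma wheel_face_cycle:
  assumes W: "wheel c p q r s" and F: "F \<in> Fs" "card (bd F) \<le> 6"
    and e: "e \<in> bd F" "e \<in> wheel_edges c p q r s"
  obtains C where "is_cycle C" "e \<in> C" "C \<subseteq> bd F" "C \<subseteq> wheel_edges c p q r s"
    "C = bd F \<or> card C = 3 \<and> card (bd F) = 6"
proof -
  let ?W = "wheel_edges c p q r s"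
  define P where "P = {c, p, q, r, s}"
  obtain u v where uv: "e = {u, v}" "u \<in> P" "v \<in> P" "adj u v" "u \<noteq> v"
    using e(2) W unfolding wheel_edges_def wheel_def P_def by (auto simp: adj_sym)
  obtain l where l: "distinct l" "3 \<le> length l" "hd l = u" "last l = v"
    "insert {u, v} (ledges l) \<subseteq> bd F" "card (insert {u, v} (ledges l)) = length l"
    "insert {u, v} (ledges l) = bd F \<or> length l + 3 \<le> card (bd F)"
    using face_cycle[OF F(1)] e(1) uv(1) by metis
  have adjI: "adj x y" if "{x, y} \<in> ledges l" for x y
    using that l(5) bd_E[OF F(1)] by (auto simp: adj_def)
  have ear: "linked P x y" if "x \<in> P" "y \<in> P" "x \<noteq> y" for x y
    using wheel_linked[OF W] that unfolding P_def .
  have inW: "{x, y} \<in> ?W" if "adj x y" "x \<in> P" "y \<in> P" for x y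
    using wheel_adj_edges[OF W] that unfolding P_def .
  have "ledges l \<subseteq> ?W"
  proof -
    consider "length l = 3" | "length l = 4" | "length l = 5" | "length l = 6"
      using l(2,6,7) F(2) by fastforce
    then show ?thesis
    proof cases
      case 1
      then obtain x where x: "l = [u, x, v]"
        using l(3,4) by (auto simp: numeral_3_eq_3 length_Suc_conv)
      then have a: "adj u x" "adj x v" using adjI by auto
      then have "x \<in> P" using no_ear(1)[OF ear[OF uv(2,3,5)] uv(2,3)] by blast
      with a uv inW show ?thesis unfolding x by simp
    next
      case 2
      then obtain x y where x: "l = [u, x, y, v]"
        using l(3,4) by (auto simp: eval_nat_numeral length_Suc_conv)
      then have a: "adj u x" "adj x y" "adj y v" and d: "distinct [u, x, y, v]" using adjI l(1) by auto
      have "x \<in> P \<or> y \<in> P" using no_ear(2)[OF ear[OF uv(2,3,5)] uv(2,3)] a by blast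
      moreover have "y \<in> P" if "x \<in> P"
        using no_ear(1)[OF ear[OF that uv(3)] that uv(3)] a d by auto
      moreover have "x \<in> P" if "y \<in> P"
        using no_ear(1)[OF ear[OF uv(2) that] uv(2) that] a d by auto
      ultimately have "x \<in> P" "y \<in> P" by blast+
      with a uv inW show ?thesis unfolding x by simp
    next
      case 3
      then obtain x y z where x: "l = [u, x, y, z, v]"
        using l(3,4) by (auto simp: eval_nat_numeral length_Suc_conv)
      then have a: "adj u x" "adj x y" "adj y z" "adj z v" and d: "distinct [u, x, y, z, v]"
        using adjI l(1) by auto
      have "x \<in> P \<or> y \<in> P \<or> z \<in> P"
        using no_ear(3)[OF ear[OF uv(2,3,5)] uv(2,3)] a d by auto
      moreover have "y \<in> P \<or> z \<in> P" if "x \<in> P"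
        using no_ear(2)[OF ear[OF that uv(3)] that uv(3)] a d by auto
      moreover have "x \<in> P \<or> y \<in> P" if "z \<in> P"
        using no_ear(2)[OF ear[OF uv(2) that] uv(2) that] a d by auto
      moreover have "x \<in> P" if "y \<in> P"
        using no_ear(1)[OF ear[OF uv(2) that] uv(2) that] a d by auto
      moreover have "z \<in> P" if "y \<in> P"
        using no_ear(1)[OF ear[OF that uv(3)] that uv(3)] a d by auto
      moreover have "y \<in> P" if "x \<in> P" "z \<in> P"
        using no_ear(1)[OF ear[OF that] that] a d by auto
      ultimately have "x \<in> P" "y \<in> P" "z \<in> P" by blast+
      with a uv inW show ?thesis unfolding x by simp
    next
      case 4
      then obtain x y z w where x: "l = [u, x, y, z, w, v]"
        using l(3,4) by (auto simp: eval_nat_numeral length_Suc_conv)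
      then show ?thesis
        using C6[of u x y z w v] adjI l(1) uv(4) by (auto simp: adj_sym)
    qed
  qed
  moreover have "is_cycle (insert e (ledges l))"
    unfolding is_cycle_def using l(1-4) uv(1) by (intro exI[of _ l]) (auto simp: insert_commute)
  moreover have "insert e (ledges l) = bd F \<or> card (insert e (ledges l)) = 3 \<and> card (bd F) = 6"
    using l(2,6,7) F(2) uv(1) by auto
  ultimately show ?thesis using that[of "insert e (ledges l)"] l(5) uv(1) e(2) by simp
qed

end

context face_system
begin

lemma tri_swap: "tri F a b c \<Longrightarrow> tri F a c b"
  by (auto simp: tri_def insert_commute)

lemma tri_edges: "tri F a b c \<Longrightarrow> F \<in> Fs \<and> {a, b} \<in> bd F \<and> {b, c} \<in> bd F \<and> {c, a} \<in> bd F"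
  by (auto simp: tri_def)

lemma quad_edges:
  "quad F a b c d \<Longrightarrow> F \<in> Fs \<and> {a, b} \<in> bd F \<and> {b, c} \<in> bd F \<and> {c, d} \<in> bd F \<and> {d, a} \<in> bd F"
  by (auto simp: quad_def)

lemma tri_vertices: "tri F a b c \<Longrightarrow> e \<in> bd F \<Longrightarrow> e \<subseteq> {a, b, c}"
  by (auto simp: tri_def)

lemma quad_vertices: "quad F a b c d \<Longrightarrow> e \<in> bd F \<Longrightarrow> e \<subseteq> {a, b, c, d}"
  by (auto simp: quad_def)

text \<open>A cycle cannot end at \<open>v\<close>, since its degree there is even.\<close>

lemma cycle_next:
  assumes "is_cycle C" "a \<in> C" "v \<in> a" "\<And>e. e \<in> C \<Longrightarrow> v \<in> e \<Longrightarrow> e = a \<or> e = b"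
  shows "b \<in> C"
proof (rule ccontr)
  assume "b \<notin> C"
  then have "star C v = {a}" using assms(2-4) by (auto simp: star_def)
  then show False using even_degree_is_cycle[OF assms(1), of v] by simp
qed

text \<open>The three faces lead around \<open>p\<close> from \<open>{p, q}\<close> over
  \<open>{p, c}\<close> and \<open>{p, s}\<close> back to \<open>{p, q}\<close>, so the link
  closes.\<close>

lemma wheel_corner:
  assumes "tri T1 c p q" "tri T4 c s p" "quad F p q r s" "distinct [c, p, q, r, s]"
  shows "star E p = {{p, c}, {p, q}, {p, s}}"
proof (rule link_closed[of _ "{T1, T4, F}"])
  have t: "star (bd T1) p = {{p, q}, {p, c}}" "star (bd T4) p = {{p, c}, {p, s}}"
    "star (bd F) p = {{p, q}, {p, s}}"
    using star_tri[OF tri_rot[OF assms(1)]] star_tri[OF tri_rot[OF tri_rot[OF assms(2)]]]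
      star_quad[OF assms(3)] by auto
  then show "G \<in> Fs \<and> star (bd G) p \<subseteq> {{p, c}, {p, q}, {p, s}}" if "G \<in> {T1, T4, F}" for G
    using that tri_edges[OF assms(1)] tri_edges[OF assms(2)] quad_edges[OF assms(3)] by auto
  have "T1 \<noteq> T4"
    using tri_vertices[OF assms(2), of "{p, q}"] tri_edges[OF assms(1)] assms(4) by auto
  moreover have "T1 \<noteq> F" "T4 \<noteq> F"
    using card_tri[OF assms(1)] card_tri[OF assms(2)] card_quad[OF assms(3)] by auto
  moreover have "{p, c} \<in> bd T1" "{p, c} \<in> bd T4" "{p, q} \<in> bd T1" "{p, q} \<in> bd F"
    "{p, s} \<in> bd T4" "{p, s} \<in> bd F"
    using t by (auto simp: star_def)
  ultimately show "p \<in> e \<and> (\<exists>F'\<in>{T1, T4, F}. \<exists>G\<in>{T1, T4, F}. F' \<noteq> G \<and> e \<in> bd F' \<and> e \<in> bd G)"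
    if "e \<in> {{p, c}, {p, q}, {p, s}}" for e
    using that by blast
qed simp

text \<open>Four triangles and the outer quadrilateral close the link at all five vertices, so no
  edge leaves them, although the graph is connected and has a sixth vertex.\<close>

lemma no_isolated_wheel:
  assumes T: "tri T1 c p q" "tri T2 c q r" "tri T3 c r s" "tri T4 c s p"
    and F: "quad F p q r s" and d: "distinct [c, p, q, r, s]"
  shows False
proof -
  let ?P = "{c, p, q, r, s}"
  have p: "star E p = {{p, c}, {p, q}, {p, s}}"
    by (rule wheel_corner[OF T(1,4) F d])
  have q: "star E q = {{q, c}, {q, r}, {q, p}}"
    by (rule wheel_corner[OF T(2,1) quad_rot[OF F]]) (use d in auto)
  have r: "star E r = {{r, c}, {r, s}, {r, q}}"
    by (rule wheel_corner[OF T(3,2) quad_rot[OF quad_rot[OF F]]]) (use d in auto)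
  have s: "star E s = {{s, c}, {s, p}, {s, r}}"
    by (rule wheel_corner[OF T(4,3) quad_rot[OF quad_rot[OF quad_rot[OF F]]]]) (use d in auto)
  have t: "star (bd T1) c = {{c, p}, {c, q}}" "star (bd T2) c = {{c, q}, {c, r}}"
    "star (bd T3) c = {{c, r}, {c, s}}" "star (bd T4) c = {{c, s}, {c, p}}"
    using T[THEN star_tri] by auto
  have ne: "T1 \<noteq> T2" "T2 \<noteq> T3" "T3 \<noteq> T4" "T4 \<noteq> T1"
    using tri_vertices[OF T(1), of "{q, r}"] tri_edges[OF T(2)]
      tri_vertices[OF T(2), of "{r, s}"] tri_edges[OF T(3)]
      tri_vertices[OF T(3), of "{s, p}"] tri_edges[OF T(4)]
      tri_vertices[OF T(4), of "{p, q}"] tri_edges[OF T(1)] d by auto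
  have m: "{c, p} \<in> bd T1" "{c, p} \<in> bd T4" "{c, q} \<in> bd T1" "{c, q} \<in> bd T2"
    "{c, r} \<in> bd T2" "{c, r} \<in> bd T3" "{c, s} \<in> bd T3" "{c, s} \<in> bd T4"
    using t by (auto simp: star_def)
  have c: "star E c = {{c, p}, {c, q}, {c, r}, {c, s}}"
  proof (rule link_closed[of _ "{T1, T2, T3, T4}"])
    have "T1 \<in> Fs" "T2 \<in> Fs" "T3 \<in> Fs" "T4 \<in> Fs" using T by (simp_all add: tri_def)
    then show "G \<in> Fs \<and> star (bd G) c \<subseteq> {{c, p}, {c, q}, {c, r}, {c, s}}" if "G \<in> {T1, T2, T3, T4}" for G
      using that t by (elim insertE emptyE) simp_all
    show "c \<in> e \<and> (\<exists>F\<in>{T1, T2, T3, T4}. \<exists>G\<in>{T1, T2, T3, T4}. F \<noteq> G \<and> e \<in> bd F \<and> e \<in> bd G)"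
      if "e \<in> {{c, p}, {c, q}, {c, r}, {c, s}}" for e
      using that ne m by (elim insertE emptyE) simp_all
  qed simp
  have "card ?P \<le> 5" by (simp add: card_insert_if)
  then have "?P \<noteq> V" using card_V by auto
  moreover have "?P \<subseteq> V"
    using T[THEN tri_adj] adj_V by blast
  ultimately obtain x y where xy: "x \<in> ?P" "y \<in> V - ?P" "{x, y} \<in> E"
    using connected[of ?P] by auto
  then have "{x, y} \<in> star E x" by (simp add: star_def)
  then show False using xy(1,2) p q r s c by (auto simp: doubleton_eq_iff)
qed

section \<open>The discharging rule\<close>

definition Tri :: "'f set" where "Tri = {F \<in> Fs. card (bd F) = 3}"
definition Big :: "'f set" where "Big = Fs - Tri"

text \<open>Written as a sum over triangles to allow an exchange of summations in
  \<open>sum_recv_le\<close>. For a big face it is the number of its edges that lie on triangles, by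
  \<open>tri_edge_count_eq\<close>.\<close>

definition tri_edge_count :: "'f \<Rightarrow> nat" where
  "tri_edge_count F = (\<Sum>T\<in>Tri. card (bd T \<inter> bd F))"

text \<open>The charge per edge shared with a triangle. A big face without such edges gets share 0
  from the division by 0 and simply keeps its charge.\<close>

definition share :: "'f \<Rightarrow> real" where
  "share F = (2 * real (card (bd F)) - 7) / real (tri_edge_count F)"

definition weight :: "'a set \<Rightarrow> real" where
  "weight e = (\<Sum>F | F \<in> Big \<and> e \<in> bd F. share F)"

definition recv :: "'f \<Rightarrow> real" where
  "recv T = (\<Sum>e\<in>bd T. weight e)"

lemma finite_Tri: "finite Tri" and finite_Big: "finite Big"
  using finite_Fs by (auto simp: Tri_def Big_def)

lemma tri_Tri: "tri T a b c \<Longrightarrow> T \<in> Tri"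
  using card_tri tri_edges by (auto simp: Tri_def)

lemma quad_Big: "quad F a b c d \<Longrightarrow> F \<in> Big"
  using card_quad quad_edges by (fastforce simp: Tri_def Big_def)

lemma Big_card: "F \<in> Big \<Longrightarrow> F \<in> Fs \<and> 4 \<le> card (bd F)"
  using card_bd_ge3[of F] by (auto simp: Tri_def Big_def)

lemma tri_edge_count_eq:
  assumes "F \<in> Big"
  shows "tri_edge_count F = card {e \<in> bd F. \<exists>T\<in>Tri. e \<in> bd T}"
proof -
  have F: "F \<in> Fs" "F \<notin> Tri" using assms by (auto simp: Big_def)
  have "bd T \<inter> bd F \<inter> (bd T' \<inter> bd F) = {}" if "T \<in> Tri" "T' \<in> Tri" "T \<noteq> T'" for T T'
    using edge_two_faces[of T T' F] that F by (auto simp: Tri_def)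
  then have "tri_edge_count F = card (\<Union>T\<in>Tri. bd T \<inter> bd F)"
    unfolding tri_edge_count_def using finite_Tri finite_bd[OF F(1)]
    by (intro card_UN_disjoint[symmetric]) auto
  also have "(\<Union>T\<in>Tri. bd T \<inter> bd F) = {e \<in> bd F. \<exists>T\<in>Tri. e \<in> bd T}" by auto
  finally show ?thesis .
qed

lemma tri_edge_count_le: "F \<in> Big \<Longrightarrow> tri_edge_count F \<le> card (bd F)"
  using Big_card[of F] finite_bd[of F] by (simp add: tri_edge_count_eq card_mono)

lemma tri_edge_count_pos:
  assumes "F \<in> Big" "T \<in> Tri" "e \<in> bd T" "e \<in> bd F"
  shows "1 \<le> tri_edge_count F"
  using assms Big_card[of F] finite_bd[of F] unfolding tri_edge_count_eq[OF assms(1)]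
  by (auto simp: Suc_le_eq card_gt_0_iff)

lemma share_nonneg: "F \<in> Big \<Longrightarrow> 0 \<le> share F"
  using Big_card[of F] by (simp add: share_def)

lemma weight_nonneg: "0 \<le> weight e"
  unfolding weight_def by (intro sum_nonneg) (auto intro: share_nonneg)

lemma weight_eq:
  assumes "F \<in> Big" "T \<in> Tri" "e \<in> bd T" "e \<in> bd F"
  shows "weight e = share F"
proof -
  have "{G \<in> Big. e \<in> bd G} = {F}"
    using edge_two_faces[of T F _ e] assms by (auto simp: Big_def Tri_def)
  then show ?thesis by (simp add: weight_def)
qed

text \<open>A \<open>k\<close>-face divides \<open>2 k - 7\<close> among at most \<open>k\<close>
  edges. The quotient grows with \<open>k\<close>: it is 3/5 for \<open>k = 5\<close> and reaches 1
  at \<open>k = 7\<close>. A 6-face has charge 5, which gives 1 each as soon as one of its edges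
  borders no triangle.\<close>

lemma share_ge:
  assumes F: "F \<in> Big" "1 \<le> tri_edge_count F"
  shows "1 / real (tri_edge_count F) \<le> share F"
    and "5 \<le> card (bd F) \<Longrightarrow> 3/5 \<le> share F"
    and "7 \<le> card (bd F) \<Longrightarrow> 1 \<le> share F"
    and "6 \<le> card (bd F) \<Longrightarrow> tri_edge_count F \<le> 5 \<Longrightarrow> 1 \<le> share F"
proof -
  have b: "4 \<le> card (bd F)" using Big_card[OF F(1)] by simp
  have t: "real (tri_edge_count F) \<le> real (card (bd F))" "0 < real (tri_edge_count F)"
    using tri_edge_count_le[OF F(1)] F(2) by auto
  show "1 / real (tri_edge_count F) \<le> share F"
    unfolding share_def using b t by (intro divide_right_mono) auto
  show "3/5 \<le> share F" if "5 \<le> card (bd F)"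
    unfolding share_def using that t by (simp add: field_simps)
  show "1 \<le> share F" if "7 \<le> card (bd F)"
    unfolding share_def using that t by (simp add: field_simps)
  show "1 \<le> share F" if "6 \<le> card (bd F)" "tri_edge_count F \<le> 5"
    unfolding share_def using that t by (simp add: field_simps)
qed

lemma sum_recv_le: "(\<Sum>T\<in>Tri. recv T) \<le> (\<Sum>F\<in>Big. 2 * real (card (bd F)) - 7)"
proof -
  have fb: "finite (bd T)" if "T \<in> Tri" for T using that finite_bd by (simp add: Tri_def)
  have "(\<Sum>T\<in>Tri. recv T) = (\<Sum>T\<in>Tri. \<Sum>F\<in>Big. real (card (bd T \<inter> bd F)) * share F)"
  proof (rule sum.cong[OF refl])
    fix T assume T: "T \<in> Tri"
    have "recv T = (\<Sum>e\<in>bd T. \<Sum>F\<in>Big. if e \<in> bd F then share F else 0)"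
      unfolding recv_def weight_def using finite_Big
      by (simp add: sum.If_cases Collect_conj_eq)
    also have "\<dots> = (\<Sum>F\<in>Big. \<Sum>e\<in>bd T. if e \<in> bd F then share F else 0)"
      by (rule sum.swap)
    also have "\<dots> = (\<Sum>F\<in>Big. real (card (bd T \<inter> bd F)) * share F)"
      using fb[OF T] by (simp add: sum.If_cases)
    finally show "recv T = (\<Sum>F\<in>Big. real (card (bd T \<inter> bd F)) * share F)" .
  qed
  also have "\<dots> = (\<Sum>F\<in>Big. \<Sum>T\<in>Tri. real (card (bd T \<inter> bd F)) * share F)"
    by (rule sum.swap)
  also have "\<dots> = (\<Sum>F\<in>Big. real (tri_edge_count F) * share F)"
    by (simp add: tri_edge_count_def sum_distrib_right)
  also have "\<dots> \<le> (\<Sum>F\<in>Big. 2 * real (card (bd F)) - 7)"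
  proof (rule sum_mono)
    fix F assume "F \<in> Big"
    then have "4 \<le> card (bd F)" using Big_card by simp
    \<comment> \<open>An equality unless \<open>tri_edge_count F\<close> is 0, when the left side is
      0.\<close>
    then show "real (tri_edge_count F) * share F \<le> 2 * real (card (bd F)) - 7"
      by (simp add: share_def)
  qed
  finally show ?thesis .
qed

lemma recv_tri:
  assumes "tri T a b c"
  shows "recv T = weight {a, b} + weight {b, c} + weight {c, a}"
proof -
  have "bd T = {{a, b}, {b, c}, {c, a}}" "distinct [a, b, c]" using assms by (auto simp: tri_def)
  then show ?thesis by (auto simp: recv_def doubleton_eq_iff)
qed

section \<open>Fans of three triangles\<close>

definition fan :: "'a \<Rightarrow> 'a \<Rightarrow> 'a \<Rightarrow> 'a \<Rightarrow> 'a \<Rightarrow> 'f \<Rightarrow> 'f \<Rightarrow> 'f \<Rightarrow> bool" where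
  "fan c p q r s N T M \<longleftrightarrow>
    tri N c p q \<and> tri T c q r \<and> tri M c r s \<and> distinct [c, p, q, r, s]"

text \<open>\<open>p = s\<close> would make \<open>c\<close>, \<open>p\<close>, \<open>q\<close>,
  \<open>r\<close> a K4; \<open>p = r\<close> or \<open>q = s\<close> would give two of the
  triangles a common corner.\<close>

lemma fanI:
  assumes "tri N c p q" "tri T c q r" "tri M c r s" "N \<noteq> T" "T \<noteq> M"
  shows "fan c p q r s N T M"
proof -
  have "p \<noteq> r" using tri_tri_apex[OF tri_swap[OF assms(1)] assms(2,4)] .
  moreover have "q \<noteq> s" using tri_tri_apex[OF tri_swap[OF assms(2)] assms(3,5)] .
  moreover have "p \<noteq> s"
    using K4[of c p q r] assms(1-3)[THEN tri_adj] calculation by (auto simp: adj_sym)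
  ultimately show ?thesis
    using assms(1-3) assms(1-3)[THEN tri_adj] by (auto simp: fan_def)
qed

lemma fan_sym: "fan c p q r s N T M \<Longrightarrow> fan c s r q p M T N"
  using tri_swap by (auto simp: fan_def)

lemma fan_adj:
  assumes "fan c p q r s N T M"
  shows "adj c p" "adj c q" "adj c r" "adj c s" "adj p q" "adj q r" "adj r s"
    "\<not> adj p r" "\<not> adj q s" "distinct [c, p, q, r, s]"
proof -
  have t: "tri N c p q" "tri T c q r" "tri M c r s" and d: "distinct [c, p, q, r, s]"
    using assms by (auto simp: fan_def)
  show a: "adj c p" "adj c q" "adj c r" "adj c s" "adj p q" "adj q r" "adj r s"
    using t[THEN tri_adj] by (auto simp: adj_sym)
  show "\<not> adj p r" using K4[of c p q r] a d by (auto simp: adj_sym)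
  show "\<not> adj q s" using K4[of c q r s] a d by (auto simp: adj_sym)
  show "distinct [c, p, q, r, s]" by fact
qed

lemma fan_faces:
  assumes f: "fan c p q r s N T M"
  shows "N \<noteq> T" "T \<noteq> M" "N \<noteq> M"
    "F \<in> Fs \<Longrightarrow> {c, q} \<in> bd F \<Longrightarrow> F = N \<or> F = T"
    "F \<in> Fs \<Longrightarrow> {c, r} \<in> bd F \<Longrightarrow> F = T \<or> F = M"
proof -
  have t: "tri N c p q" "tri T c q r" "tri M c r s" and d: "distinct [c, p, q, r, s]"
    using f by (auto simp: fan_def)
  note e = t[THEN tri_edges]
  show ne: "N \<noteq> T" "T \<noteq> M" "N \<noteq> M"
    using e tri_vertices[OF t(1), of "{q, r}"] tri_vertices[OF t(2), of "{r, s}"]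
      tri_vertices[OF t(1), of "{r, s}"] d by auto
  show "F = N \<or> F = T" if "F \<in> Fs" "{c, q} \<in> bd F"
    using edge_two_faces[of N T F "{c, q}"] that e ne by (auto simp: insert_commute)
  show "F = T \<or> F = M" if "F \<in> Fs" "{c, r} \<in> bd F"
    using edge_two_faces[of T M F "{c, r}"] that e ne by (auto simp: insert_commute)
qed

text \<open>A triangle beyond \<open>{p, q}\<close> with apex \<open>w\<close> would give the
  6-cycle \<open>p w q r s c\<close>; \<open>w\<close> is neither \<open>r\<close> nor
  \<open>s\<close> because the chords are missing.\<close>

lemma fan_outer_rim:
  assumes f: "fan c p q r s N T M" and G: "tri G p q w" "G \<noteq> N"
  shows False
proof -
  note a = fan_adj[OF f]
  have N: "tri N p q c" using f tri_rot by (auto simp: fan_def)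
  have g: "adj q w" "adj w p" using tri_adj[OF G(1)] by auto
  have "w \<noteq> c" using tri_tri_apex[OF G(1) N G(2)] by simp
  moreover have "w \<noteq> r" "w \<noteq> s" using a g by (auto simp: adj_sym)
  ultimately show False
    using C6[of p w q r s c] a g adj_V[OF g(1)] adj_V[OF g(2)] by (auto simp: adj_sym)
qed

text \<open>Any other apex gives the 6-cycle \<open>c w p q r s\<close>. So the fan can continue
  around \<open>c\<close> only by closing up to a wheel.\<close>

lemma fan_outer_spoke:
  assumes f: "fan c p q r s N T M" and G: "tri G c p w" "G \<noteq> N"
  shows "w = s"
proof (rule ccontr)
  assume "w \<noteq> s"
  note a = fan_adj[OF f]
  have N: "tri N c p q" using f by (auto simp: fan_def)
  have g: "adj p w" "adj w c" using tri_adj[OF G(1)] by auto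
  have "w \<noteq> q" using tri_tri_apex[OF G(1) N G(2)] by simp
  moreover have "w \<noteq> r" using a g by (auto simp: adj_sym)
  ultimately show False
    using C6[of c w p q r s] a g adj_V[OF g(1)] adj_V[OF g(2)] \<open>w \<noteq> s\<close> by (auto simp: adj_sym)
qed

text \<open>The fourth triangle completes a wheel. If \<open>F\<close> were short,
  \<open>wheel_face_cycle\<close> would put a cycle of its boundary into the wheel. Each spoke
  already has two triangles, so this cycle is the rim, and \<open>F\<close> is the quadrilateral
  excluded by \<open>no_isolated_wheel\<close>.\<close>

lemma closed_fan_rim:
  assumes f: "fan c p q r s N T M" and G: "tri G c p s"
    and F: "F \<in> Fs" "F \<noteq> T" "{q, r} \<in> bd F"
  shows "7 \<le> card (bd F)"
proof (rule ccontr)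
  assume "\<not> ?thesis"
  then have k: "card (bd F) \<le> 6" by simp
  note a = fan_adj[OF f]
  have t: "tri N c p q" "tri T c q r" "tri M c r s" and d: "distinct [c, p, q, r, s]"
    using f by (auto simp: fan_def)
  have W: "wheel c p q r s" using a tri_adj[OF G] adj_sym[of s p] by (auto simp: wheel_def)
  have FN: "F \<noteq> N" "F \<noteq> M" "F \<noteq> G"
    using tri_vertices[OF t(1), of "{q, r}"] tri_vertices[OF t(3), of "{q, r}"]
      tri_vertices[OF G, of "{q, r}"] F(3) d by auto
  have NG: "N \<noteq> G" "M \<noteq> G"
    using tri_vertices[OF t(1), of "{p, s}"] tri_vertices[OF t(3), of "{p, s}"] tri_edges[OF G] d
    by (auto simp: insert_commute)
  have spokes: "{c, p} \<notin> bd F" "{c, q} \<notin> bd F" "{c, r} \<notin> bd F" "{c, s} \<notin> bd F"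
    using edge_two_faces[of N G F "{c, p}"] edge_two_faces[of M G F "{c, s}"]
      fan_faces(4,5)[OF f F(1)] FN F(1,2) NG t[THEN tri_edges] tri_edges[OF G]
    by (auto simp: insert_commute)
  obtain C where C: "is_cycle C" "{q, r} \<in> C" "C \<subseteq> bd F" "C \<subseteq> wheel_edges c p q r s"
    "C = bd F \<or> card C = 3 \<and> card (bd F) = 6"
    by (rule wheel_face_cycle[OF W F(1) k F(3)]) (auto simp: wheel_edges_def)
  have sub: "C \<subseteq> {{p, q}, {q, r}, {r, s}, {s, p}}"
    using C(3,4) spokes unfolding wheel_edges_def by blast
  have "{p, q} \<in> C" "{r, s} \<in> C"
    by (rule cycle_next[OF C(1,2), of q], simp, use sub d in auto)
      (rule cycle_next[OF C(1,2), of r], simp, use sub d in auto)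
  moreover have "{s, p} \<in> C"
    by (rule cycle_next[OF C(1) \<open>{p, q} \<in> C\<close>, of p], simp, use sub d in auto)
  ultimately have CC: "C = {{p, q}, {q, r}, {r, s}, {s, p}}" using sub C(2) by blast
  then have "card C = 4" using d by (auto simp: doubleton_eq_iff card_insert_if)
  then have "bd F = C" using C(5) by auto
  then have "quad F p q r s" using CC F(1) d by (auto simp: quad_def)
  from no_isolated_wheel[OF t tri_swap[OF G] this d] show False .
qed

text \<open>A triangle beyond the end spoke \<open>{c, p}\<close> would have apex \<open>s\<close>
  and isolate the wheel. If \<open>F\<close> is short, the cycle that it has inside the wheel can
  only be \<open>c p s\<close>, and since \<open>F\<close> is not that triangle it has length 6. Its
  edge \<open>{s, p}\<close> has \<open>Q\<close> on the other side, so at most five edges share the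
  charge 5.\<close>

lemma quad_fan_spoke:
  assumes f: "fan c p q r s N T M" and Q: "quad Q p q r s"
    and F: "F \<in> Fs" "F \<noteq> N" "{c, p} \<in> bd F"
  shows "F \<in> Big" "1 \<le> share F"
proof -
  note a = fan_adj[OF f]
  have t: "tri N c p q" "tri T c q r" "tri M c r s" and d: "distinct [c, p, q, r, s]"
    using f by (auto simp: fan_def)
  note e = t[THEN tri_edges] quad_edges[OF Q]
  have no_tri: False if "tri F c p s"
    by (rule no_isolated_wheel[OF t tri_swap[OF that] Q d])
  show FB: "F \<in> Big"
  proof (rule ccontr)
    assume "F \<notin> Big"
    then have "card (bd F) = 3" using F(1) by (auto simp: Big_def Tri_def)
    then obtain w where w: "tri F c p w" using triE[OF F(1) _ F(3)] by blast
    with fan_outer_spoke[OF f w F(2)] no_tri show False by simp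
  qed
  have NT: "N \<in> Tri" using tri_Tri[OF t(1)] .
  have pos: "1 \<le> tri_edge_count F"
    using tri_edge_count_pos[OF FB NT _ F(3)] e by auto
  show "1 \<le> share F"
  proof (cases "7 \<le> card (bd F)")
    case True
    then show ?thesis by (rule share_ge(3)[OF FB pos])
  next
    case False
    then have k: "card (bd F) \<le> 6" by simp
    have W: "wheel c p q r s" using a quad_adj[OF Q] by (auto simp: wheel_def)
    have FN: "F \<noteq> T" "F \<noteq> M" "F \<noteq> Q"
      using tri_vertices[OF t(2), of "{c, p}"] tri_vertices[OF t(3), of "{c, p}"]
        quad_vertices[OF Q, of "{c, p}"] F(3) d by auto
    have NQ: "N \<noteq> Q" "T \<noteq> Q" "M \<noteq> Q"
      using card_quad[OF Q] t[THEN card_tri] by auto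
    have inner: "{c, q} \<notin> bd F" "{c, r} \<notin> bd F" "{p, q} \<notin> bd F" "{q, r} \<notin> bd F" "{r, s} \<notin> bd F"
      using edge_two_faces[of N Q F "{p, q}"] edge_two_faces[of T Q F "{q, r}"]
        edge_two_faces[of M Q F "{r, s}"] fan_faces(4,5)[OF f F(1)] FN F(1,2) NQ e by auto
    obtain C where C: "is_cycle C" "{c, p} \<in> C" "C \<subseteq> bd F" "C \<subseteq> wheel_edges c p q r s"
      "C = bd F \<or> card C = 3 \<and> card (bd F) = 6"
      by (rule wheel_face_cycle[OF W F(1) k F(3)]) (auto simp: wheel_edges_def)
    have sub: "C \<subseteq> {{c, p}, {c, s}, {s, p}}"
      using C(3,4) inner unfolding wheel_edges_def by blast
    have "{c, s} \<in> C" "{s, p} \<in> C"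
      by (rule cycle_next[OF C(1,2), of c], simp, use sub d in auto)
        (rule cycle_next[OF C(1,2), of p], simp, use sub d in auto)
    then have CC: "C = {{c, p}, {c, s}, {s, p}}" using sub C(2) by blast
    have "C \<noteq> bd F"
    proof
      assume "C = bd F"
      then have "tri F c p s" using CC F(1) d by (auto simp: tri_def insert_commute)
      then show False by (rule no_tri)
    qed
    with C(5) have k6: "card (bd F) = 6" by blast
    have sp: "{s, p} \<in> bd F" using \<open>{s, p} \<in> C\<close> C(3) by blast
    have "{s, p} \<notin> bd T'" if "T' \<in> Tri" for T'
      using edge_two_faces[of F Q T' "{s, p}"] that FN(3) F(1) FB quad_Big[OF Q] sp e
      by (auto simp: Tri_def Big_def)
    then have "{e \<in> bd F. \<exists>T\<in>Tri. e \<in> bd T} \<subseteq> bd F - {{s, p}}" by auto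
    then have "tri_edge_count F \<le> card (bd F - {{s, p}})"
      unfolding tri_edge_count_eq[OF FB] using finite_bd[OF F(1)] by (intro card_mono) auto
    also have "\<dots> = 5" using sp k6 finite_bd[OF F(1)] by simp
    finally show ?thesis using share_ge(4)[OF FB pos] k6 by simp
  qed
qed

text \<open>Distinct apexes would give the 6-cycle \<open>a x b y c d\<close>.\<close>

lemma quad_apex_adjacent:
  assumes Q: "quad F a b c d" and T: "tri T a b x" "tri T' b c y"
  shows "x = y"
proof (rule ccontr)
  assume "x \<noteq> y"
  have "x \<notin> {a, b, c, d}" "y \<notin> {a, b, c, d}"
    using tri_quad_apex[OF T(1) Q] tri_quad_apex[OF T(2) quad_rot[OF Q]] by auto
  then show False
    using C6[of a x b y c d] \<open>x \<noteq> y\<close> quad_adj[OF Q] T[THEN tri_adj] by (auto simp: adj_sym)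
qed

text \<open>Distinct apexes would give the 6-cycle \<open>a x b c y d\<close>.\<close>

lemma quad_apex_opposite:
  assumes Q: "quad F a b c d" and T: "tri T a b x" "tri T' c d y"
  shows "x = y"
proof (rule ccontr)
  assume "x \<noteq> y"
  have "x \<notin> {a, b, c, d}" "y \<notin> {a, b, c, d}"
    using tri_quad_apex[OF T(1) Q] tri_quad_apex[OF T(2) quad_rot[OF quad_rot[OF Q]]] by auto
  then show False
    using C6[of a x b c y d] \<open>x \<noteq> y\<close> quad_adj[OF Q] T[THEN tri_adj] by (auto simp: adj_sym)
qed

text \<open>All three triangles have the same apex, hence form a fan; a triangle on the fourth edge
  would have this apex too and isolate a wheel.\<close>

lemma quad_three:
  assumes Q: "quad F a b c d" and T: "tri N a b x" "tri T b c y" "tri M c d z"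
  shows "fan x a b c d N T M"
    and "T' \<in> Tri \<Longrightarrow> {d, a} \<notin> bd T'"
proof -
  have xyz: "y = x" "z = x"
    using quad_apex_adjacent[OF Q T(1,2)] quad_apex_adjacent[OF quad_rot[OF Q] T(2,3)] by auto
  have d: "distinct [x, a, b, c, d]"
    using tri_quad_apex[OF T(1) Q] quad_adj[OF Q] by auto
  have t: "tri N x a b" "tri T x b c" "tri M x c d"
    using T xyz tri_rot by blast+
  then show "fan x a b c d N T M" using d by (simp add: fan_def)
  show "{d, a} \<notin> bd T'" if T': "T' \<in> Tri"
  proof
    assume "{d, a} \<in> bd T'"
    then obtain w where w: "tri T' d a w" using triE[of T' d a] T' by (auto simp: Tri_def)
    have "x = w"
      using quad_apex_adjacent[OF quad_rot[OF quad_rot[OF quad_rot[OF Q]]] w T(1)] by simp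
    then have "tri T' x d a" using w tri_rot by blast
    from no_isolated_wheel[OF t this Q d] show False .
  qed
qed

end

section \<open>How much charge an edge carries\<close>

context face_system
begin

definition tri_edges_of :: "'f \<Rightarrow> 'a set set" where
  "tri_edges_of F = {e \<in> bd F. \<exists>T\<in>Tri. e \<in> bd T}"

lemma tri_edges_of_tri:
  assumes "{a, b} \<in> tri_edges_of F"
  obtains T x where "tri T a b x"
proof -
  obtain T where "T \<in> Tri" "{a, b} \<in> bd T" using assms by (auto simp: tri_edges_of_def)
  then show ?thesis using triE[of T a b] that by (auto simp: Tri_def)
qed

lemma tri_edge_count_remove:
  assumes F: "F \<in> Big" and X: "X \<subseteq> bd F" "X \<inter> tri_edges_of F = {}"
  shows "tri_edge_count F \<le> card (bd F) - card X"
proof -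
  have fin: "finite (bd F)" using F finite_bd by (simp add: Big_def)
  have "tri_edges_of F \<subseteq> bd F - X" using X by (auto simp: tri_edges_of_def)
  then have "card (tri_edges_of F) \<le> card (bd F - X)" using fin by (intro card_mono) auto
  also have "\<dots> = card (bd F) - card X"
    using X(1) fin finite_subset by (intro card_Diff_subset) auto
  finally show ?thesis by (simp add: tri_edge_count_eq[OF F] tri_edges_of_def)
qed

lemma quad_three_consecutive:
  assumes Q: "quad F a b c d"
    and e: "{a, b} \<in> tri_edges_of F" "{b, c} \<in> tri_edges_of F" "{c, d} \<in> tri_edges_of F"
  shows "\<exists>x p q r s N T M. fan x p q r s N T M \<and> quad F p q r s \<and> {s, p} \<notin> tri_edges_of F"
proof -
  obtain N x T y M z where t: "tri N a b x" "tri T b c y" "tri M c d z"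
    using tri_edges_of_tri e by metis
  have "{d, a} \<notin> tri_edges_of F"
    using quad_three(2)[OF Q t] by (auto simp: tri_edges_of_def)
  with quad_three(1)[OF Q t] Q show ?thesis by blast
qed

text \<open>At most one edge of \<open>F\<close> borders no triangle; a rotation makes it the last
  one.\<close>

lemma quad_count_three:
  assumes Q: "quad F a b c d" and n: "3 \<le> tri_edge_count F"
  shows "\<exists>x p q r s N T M. fan x p q r s N T M \<and> quad F p q r s \<and> {s, p} \<notin> tri_edges_of F"
proof -
  have two: "e \<in> tri_edges_of F \<or> e' \<in> tri_edges_of F" if "e \<in> bd F" "e' \<in> bd F" "e \<noteq> e'" for e e'
  proof (rule ccontr)
    assume "\<not> ?thesis"
    then have "tri_edge_count F \<le> card (bd F) - card {e, e'}"
      using that by (intro tri_edge_count_remove[OF quad_Big[OF Q]]) auto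
    with that n card_quad[OF Q] show False by simp
  qed
  have ne: "{a, b} \<noteq> {b, c}" "{a, b} \<noteq> {c, d}" "{a, b} \<noteq> {d, a}" "{b, c} \<noteq> {c, d}"
    "{b, c} \<noteq> {d, a}" "{c, d} \<noteq> {d, a}"
    using quad_adj[OF Q] by (auto simp: doubleton_eq_iff)
  note Q1 = quad_rot[OF Q] and Q2 = quad_rot[OF quad_rot[OF Q]]
    and Q3 = quad_rot[OF quad_rot[OF quad_rot[OF Q]]]
  consider "{a, b} \<notin> tri_edges_of F" | "{b, c} \<notin> tri_edges_of F" | "{c, d} \<notin> tri_edges_of F"
    | "{a, b} \<in> tri_edges_of F" "{b, c} \<in> tri_edges_of F" "{c, d} \<in> tri_edges_of F" by blast
  then show ?thesis
  proof cases
    case 1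
    then show ?thesis
      using quad_three_consecutive[OF Q1] two ne quad_edges[OF Q] by metis
  next
    case 2
    then show ?thesis
      using quad_three_consecutive[OF Q2] two ne quad_edges[OF Q] by metis
  next
    case 3
    then show ?thesis
      using quad_three_consecutive[OF Q3] two ne quad_edges[OF Q] by metis
  next
    case 4
    then show ?thesis by (rule quad_three_consecutive[OF Q])
  qed
qed

lemma quad_count_le_3:
  assumes Q: "quad F a b c d"
  shows "tri_edge_count F \<le> 3"
proof (rule ccontr)
  assume n: "\<not> ?thesis"
  then obtain p q r s where "quad F p q r s" "{s, p} \<notin> tri_edges_of F"
    using quad_count_three[OF Q] by fastforce
  then have "tri_edge_count F \<le> card (bd F) - card {{s, p}}"
    using quad_edges by (intro tri_edge_count_remove quad_Big[OF Q]) auto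
  with n card_quad[OF Q] show False by simp
qed

text \<open>A quadrilateral has charge 1 and at most three edges on triangles, hence 1/3 for each;
  with two such edges it gives 1/2, with a single one 1. Longer faces give at least 3/5.\<close>

lemma weight_bounds:
  assumes "T \<in> Tri" "F \<in> Big" "e \<in> bd T" "e \<in> bd F"
  shows "card (bd F) = 4 \<Longrightarrow> 1/3 \<le> weight e"
    and "card (bd F) \<noteq> 4 \<or> tri_edge_count F \<le> 2 \<Longrightarrow> 1/2 \<le> weight e"
    and "card (bd F) \<noteq> 4 \<or> tri_edge_count F \<le> 1 \<Longrightarrow> 3/5 \<le> weight e"
proof -
  note pos = tri_edge_count_pos[OF assms(2,1,3,4)]
  note w = weight_eq[OF assms(2,1,3,4)]
  note b = share_ge(1,2)[OF assms(2) pos]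
  have F: "F \<in> Fs" "4 \<le> card (bd F)" using Big_card[OF assms(2)] by auto
  have inv: "1 / real k \<le> 1 / real (tri_edge_count F)" if "tri_edge_count F \<le> k" for k
    using pos that by (intro divide_left_mono) auto
  have "card e = 2" using assms(4) bd_E[OF F(1)] edges by blast
  then obtain u v where uv: "e = {u, v}" by (auto simp: card_2_iff)
  show "1/3 \<le> weight e" if k4: "card (bd F) = 4"
  proof -
    obtain c d where "quad F u v c d" using quadE[OF F(1) k4] assms(4) uv by blast
    then show ?thesis using inv[OF quad_count_le_3] b(1) w by fastforce
  qed
  show "1/2 \<le> weight e" if "card (bd F) \<noteq> 4 \<or> tri_edge_count F \<le> 2"
    using that inv[of 2] b F(2) w by force
  show "3/5 \<le> weight e" if "card (bd F) \<noteq> 4 \<or> tri_edge_count F \<le> 1"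
    using that inv[of 1] b F(2) w by force
qed

lemma fan_quad_end_weight:
  assumes f: "fan c p q r s N T M" and Q: "quad Q p q r s"
  shows "1 \<le> weight {c, p}"
proof -
  have N: "tri N c p q" using f by (simp add: fan_def)
  obtain F where F: "F \<in> Fs" "{c, p} \<in> bd F" "F \<noteq> N"
    using other_face[of N "{c, p}"] tri_edges[OF N] by blast
  note quad_fan_spoke[OF f Q F(1,3,2)]
  with weight_eq[of F N "{c, p}"] tri_Tri[OF N] tri_edges[OF N] F(2) show ?thesis by simp
qed

lemma fan_recv:
  assumes f: "fan c p q r s N T M"
  shows "recv N = weight {c, p} + weight {p, q} + weight {c, q}"
    "recv T = weight {c, q} + weight {q, r} + weight {c, r}"
    "recv M = weight {c, r} + weight {r, s} + weight {c, s}"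
  using recv_tri f by (auto simp: fan_def insert_commute)

lemma fan_quad_end_recv:
  assumes "fan c p q r s N T M" "quad Q p q r s"
  shows "1 \<le> recv N"
  using fan_quad_end_weight[OF assms] fan_recv(1)[OF assms(1)]
    weight_nonneg[of "{p, q}"] weight_nonneg[of "{c, q}"] by linarith

text \<open>Write the quadrilateral as \<open>q r y x\<close>. Unless \<open>x = p\<close> or
  \<open>y = s\<close> there is the 6-cycle \<open>q x y r c p\<close>, and if only one of the two
  held there would be another one.\<close>

lemma fan_quad_rim_middle:
  assumes f: "fan c p q r s N T M" and F: "F \<in> Fs" "card (bd F) = 4" "{q, r} \<in> bd F"
  shows "quad F p q r s"
proof -
  note a = fan_adj[OF f]
  have T: "tri T q r c" using f tri_rot by (auto simp: fan_def)
  obtain y x where Q: "quad F q r y x" using quadE[OF F] by blast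
  note g = quad_adj[OF Q]
  have cx: "c \<noteq> x" "c \<noteq> y" using tri_quad_apex[OF T Q] by auto
  have "y \<noteq> p" using a g by (auto simp: adj_sym)
  moreover have "x \<noteq> s" using a g by (auto simp: adj_sym)
  moreover have "x = p \<or> y = s"
    using C6[of q x y r c p] a g cx calculation by (auto simp: adj_sym)
  moreover have "y = s" if "x = p"
    using C6[of p y r s c q] a g cx that by (auto simp: adj_sym)
  moreover have "x = p" if "y = s"
    using C6[of s x q p c r] a g cx that calculation by (auto simp: adj_sym)
  ultimately have "x = p" "y = s" by blast+
  with Q show ?thesis using quad_rot[of F q r s p] quad_rot by blast
qed

lemma quad_second_tri:
  assumes F: "F \<in> Big" "2 \<le> tri_edge_count F" and e: "e \<in> tri_edges_of F"
  obtains e' where "e' \<in> tri_edges_of F" "e' \<noteq> e"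
proof -
  have "card (tri_edges_of F) \<noteq> 1"
    using F(2) by (simp add: tri_edge_count_eq[OF F(1)] tri_edges_of_def)
  then have "tri_edges_of F \<noteq> {e}" by auto
  with e that show ?thesis by blast
qed

text \<open>A second triangle edge of \<open>F\<close> has a triangle with the same apex
  \<open>c\<close>. On \<open>{q, y}\<close> this triangle has to belong to the fan, on
  \<open>{y, x}\<close> it gives a 6-cycle, and on \<open>{x, p}\<close> it continues the fan beyond
  \<open>p\<close>, which \<open>nw\<close> excludes. So \<open>F\<close> contains
  \<open>{q, r}\<close>, and \<open>fan_quad_rim_middle\<close> applies.\<close>

lemma fan_quad_rim_end:
  assumes f: "fan c p q r s N T M" and nw: "\<And>G w. tri G c p w \<Longrightarrow> G = N"
    and F: "F \<in> Big" "card (bd F) = 4" "2 \<le> tri_edge_count F" "{p, q} \<in> bd F"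
  shows "quad F p q r s"
proof -
  note a = fan_adj[OF f]
  have t: "tri N c p q" "tri T c q r" "tri M c r s" using f by (auto simp: fan_def)
  have N: "tri N p q c" using t(1) tri_rot by blast
  have FF: "F \<in> Fs" using Big_card[OF F(1)] by simp
  obtain y x where Q: "quad F p q y x" using quadE[OF FF F(2,4)] by blast
  note g = quad_adj[OF Q]
  have cx: "c \<notin> {p, q, y, x}" using tri_quad_apex[OF N Q] .
  show ?thesis
  proof (cases "y = r")
    case True
    then have "{q, r} \<in> bd F" using quad_edges[OF Q] by auto
    then show ?thesis by (rule fan_quad_rim_middle[OF f FF F(2)])
  next
    case y: False
    have "{p, q} \<in> tri_edges_of F"
      using F(4) tri_edges[OF N] tri_Tri[OF N] by (auto simp: tri_edges_of_def)
    from quad_second_tri[OF F(1,3) this] obtain e' where e': "e' \<in> tri_edges_of F" "e' \<noteq> {p, q}" .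
    then consider "{q, y} \<in> tri_edges_of F" | "{y, x} \<in> tri_edges_of F" | "{x, p} \<in> tri_edges_of F"
      using Q by (auto simp: tri_edges_of_def quad_def)
    then have False
    proof cases
      case 1
      then obtain G z where G: "tri G q y z" by (rule tri_edges_of_tri)
      have "z = c" using quad_apex_adjacent[OF Q N G] by simp
      then have "{c, q} \<in> bd G" "G \<in> Fs" and qy: "{q, y} \<in> bd G" using tri_edges[OF G] by auto
      then have "G = N \<or> G = T" using fan_faces(4)[OF f] by simp
      then have "y \<in> {c, p, q, r}"
        using tri_vertices[OF t(1), of "{q, y}"] tri_vertices[OF t(2), of "{q, y}"] qy by auto
      then show False using y g cx by auto
    next
      case 2
      then obtain G z where G: "tri G y x z" by (rule tri_edges_of_tri)
      have "z = c" using quad_apex_opposite[OF Q N G] by simp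
      then have h: "adj c x" "adj c y" using tri_adj[OF G] by (auto simp: adj_sym)
      have xy: "x \<noteq> r" "y \<noteq> s" using a g by (auto simp: adj_sym)
      show False
      proof (cases "x = s")
        case True
        then show False using C6[of s y q r c p] a g cx y xy by (auto simp: adj_sym)
      next
        case False
        then show False using C6[of c x y q r s] a g cx y xy h by (auto simp: adj_sym)
      qed
    next
      case 3
      then obtain G z where G: "tri G x p z" by (rule tri_edges_of_tri)
      have "z = c"
        using quad_apex_adjacent[OF quad_rot[OF quad_rot[OF quad_rot[OF Q]]] G N] .
      then have "tri G c p x" using G tri_rot tri_flip by blast
      then have "G = N" by (rule nw)
      then have "{x, p} \<subseteq> {c, p, q}" using tri_vertices[OF t(1)] tri_edges[OF G] by blast
      then show False using g cx by auto
    qed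
    then show ?thesis ..
  qed
qed

text \<open>A second triangle edge of \<open>F\<close> would have a triangle with apex
  \<open>q\<close>. On \<open>{p, x}\<close> it lies beyond the rim edge \<open>{p, q}\<close>, on
  \<open>{x, y}\<close> it gives a 6-cycle, and on \<open>{y, c}\<close> it uses the spoke
  \<open>{c, q}\<close>, whose faces are \<open>N\<close> and \<open>T\<close>.\<close>

lemma fan_quad_spoke_end:
  assumes f: "fan c p q r s N T M"
    and F: "F \<in> Big" "card (bd F) = 4" "2 \<le> tri_edge_count F" "{c, p} \<in> bd F"
  shows False
proof -
  note a = fan_adj[OF f]
  have t: "tri N c p q" "tri T c q r" "tri M c r s" using f by (auto simp: fan_def)
  have FF: "F \<in> Fs" using Big_card[OF F(1)] by simp
  obtain x y where Q: "quad F c p x y" using quadE[OF FF F(2,4)] by blast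
  note g = quad_adj[OF Q]
  have qx: "q \<notin> {c, p, x, y}" using tri_quad_apex[OF t(1) Q] .
  have xr: "x \<noteq> r" using a g by (auto simp: adj_sym)
  have yr: "y \<noteq> r"
  proof
    assume "y = r"
    then have "{c, r} \<in> bd F" using quad_edges[OF Q] by (simp add: insert_commute)
    then have "F = T \<or> F = M" using fan_faces(5)[OF f FF] by blast
    then show False using F(2) card_tri[OF t(2)] card_tri[OF t(3)] by auto
  qed
  have "{c, p} \<in> tri_edges_of F"
    using F(4) tri_edges[OF t(1)] tri_Tri[OF t(1)] by (auto simp: tri_edges_of_def)
  from quad_second_tri[OF F(1,3) this] obtain e' where e': "e' \<in> tri_edges_of F" "e' \<noteq> {c, p}" .
  then consider "{p, x} \<in> tri_edges_of F" | "{x, y} \<in> tri_edges_of F" | "{y, c} \<in> tri_edges_of F"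
    using Q by (auto simp: tri_edges_of_def quad_def)
  then show False
  proof cases
    case 1
    then obtain G z where G: "tri G p x z" by (rule tri_edges_of_tri)
    have "z = q" using quad_apex_adjacent[OF Q t(1) G] by simp
    then have G': "tri G p q x" using tri_swap[OF G] by simp
    show False
    proof (cases "G = N")
      case True
      then show False using tri_vertices[OF t(1), of "{p, x}"] tri_edges[OF G] g qx by auto
    next
      case False
      then show False by (rule fan_outer_rim[OF f G'])
    qed
  next
    case 2
    then obtain G z where G: "tri G x y z" by (rule tri_edges_of_tri)
    have "z = q" using quad_apex_opposite[OF Q t(1) G] by simp
    then have "adj q y" "adj q x" using tri_adj[OF G] by (auto simp: adj_sym)
    then show False using C6[of q y x p c r] a g qx xr yr by (auto simp: adj_sym)
  next
    case 3
    then obtain G z where G: "tri G y c z" by (rule tri_edges_of_tri)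
    have "z = q"
      using quad_apex_adjacent[OF quad_rot[OF quad_rot[OF quad_rot[OF Q]]] G t(1)] .
    then have "{c, q} \<in> bd G" "G \<in> Fs" and yc: "{y, c} \<in> bd G" using tri_edges[OF G] by auto
    then have "G = N \<or> G = T" using fan_faces(4)[OF f] by simp
    then have "y \<in> {c, p, q, r}"
      using tri_vertices[OF t(1), of "{y, c}"] tri_vertices[OF t(2), of "{y, c}"] yc by auto
    then show False using yr g qx by auto
  qed
qed

end

section \<open>Balancing the clusters of triangles\<close>

context face_system
begin

definition nbrs :: "'f \<Rightarrow> 'f set" where
  "nbrs T = {N \<in> Tri. N \<noteq> T \<and> bd N \<inter> bd T \<noteq> {}}"

text \<open>A second triangle on \<open>{q, r}\<close> with apex \<open>z\<close> would give the
  6-cycle \<open>q z r s c p\<close>.\<close>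

lemma fan_rim_not_tri:
  assumes f: "fan c p q r s N T M" and K: "K \<in> Tri" "{q, r} \<in> bd K"
  shows "K = T"
proof (rule ccontr)
  assume "K \<noteq> T"
  note a = fan_adj[OF f]
  obtain z where K': "tri K q r z" using triE[of K q r] K by (auto simp: Tri_def)
  have "tri T q r c" using f tri_rot by (auto simp: fan_def)
  then have "z \<noteq> c" using tri_tri_apex[OF K' _ \<open>K \<noteq> T\<close>] by blast
  moreover have "z \<noteq> p" "z \<noteq> s" using a tri_adj[OF K'] by (auto simp: adj_sym)
  ultimately show False
    using C6[of q z r s c p] a tri_adj[OF K'] by (auto simp: adj_sym)
qed

text \<open>\<open>nw\<close> excludes another triangle on \<open>{c, p}\<close> and
  \<open>fan_outer_rim\<close> one on \<open>{p, q}\<close>; the faces of \<open>{c, q}\<close> are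
  \<open>N\<close> and \<open>T\<close>.\<close>

lemma fan_nbrs_end:
  assumes f: "fan c p q r s N T M" and nw: "\<And>G w. tri G c p w \<Longrightarrow> G = N"
    and K: "K \<in> Tri" "e \<in> bd K" "e \<in> bd N" "K \<noteq> N"
  shows "e = {q, c} \<and> K = T"
proof -
  have N: "tri N c p q" using f by (simp add: fan_def)
  have KF: "K \<in> Fs" "card (bd K) = 3" using K(1) by (auto simp: Tri_def)
  consider "e = {c, p}" | "e = {p, q}" | "e = {q, c}" using N K(3) by (auto simp: tri_def)
  then show ?thesis
  proof cases
    case 1
    then show ?thesis using triE[OF KF, of c p] K(2,4) nw by blast
  next
    case 2
    then show ?thesis using triE[OF KF, of p q] K(2,4) fan_outer_rim[OF f] by blast
  next
    case 3
    then show ?thesis using fan_faces(4)[OF f KF(1)] K(2,4) by (auto simp: insert_commute)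
  qed
qed

lemma tri_other_face:
  assumes T: "T \<in> Tri" "e \<in> bd T" and no: "\<And>K. K \<in> Tri \<Longrightarrow> e \<in> bd K \<Longrightarrow> K = T"
  obtains F where "F \<in> Big" "e \<in> bd F"
proof -
  have "T \<in> Fs" using T(1) by (simp add: Tri_def)
  then obtain F where "F \<in> Fs" "e \<in> bd F" "F \<noteq> T" using other_face T(2) by metis
  with no that show ?thesis by (auto simp: Big_def)
qed

lemma recv_ge_two:
  assumes "T \<in> Tri" "e \<in> bd T" "e' \<in> bd T" "e \<noteq> e'"
  shows "weight e + weight e' \<le> recv T"
proof -
  have "(\<Sum>e\<in>{e, e'}. weight e) \<le> recv T"
    unfolding recv_def using assms finite_bd[of T] weight_nonneg
    by (intro sum_mono2) (auto simp: Tri_def)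
  with assms(4) show ?thesis by simp
qed

text \<open>Two outer edges carrying 1/2 each suffice. An edge carrying less comes from a
  quadrilateral with three triangles, which form a fan. An end triangle of this fan gets 1 through
  its outer spoke, and the middle one has only one outer edge.\<close>

lemma recv_two_outer:
  assumes T: "T \<in> Tri" and e: "e1 \<in> bd T" "e2 \<in> bd T" "e1 \<noteq> e2"
    and F: "F1 \<in> Big" "e1 \<in> bd F1" "F2 \<in> Big" "e2 \<in> bd F2"
  shows "1 \<le> recv T"
proof (rule ccontr)
  assume less: "\<not> ?thesis"
  have bad: False
    if w: "weight e < 1/2" and e: "e \<in> bd T" "e \<in> bd F" "F \<in> Big"
      and e': "e' \<in> bd T" "e' \<noteq> e" "e' \<in> bd F'" "F' \<in> Big" for e e' F F'
  proof -
    have TF: "T \<in> Fs" "F \<in> Fs" "F' \<in> Fs" "T \<noteq> F" "T \<noteq> F'" "card (bd T) = 3"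
      using T e(3) e'(4) by (auto simp: Tri_def Big_def)
    have q: "card (bd F) = 4" "3 \<le> tri_edge_count F"
      using weight_bounds(2)[OF T e(3,1,2)] w by force+
    have "card e = 2" using e(1) bd_E[OF TF(1)] edges by blast
    then obtain u v where "e = {u, v}" by (auto simp: card_2_iff)
    then obtain c d where "quad F u v c d" using quadE[OF TF(2) q(1)] e(2) by blast
    from quad_count_three[OF this q(2)] obtain x p q r s N T' M
      where f: "fan x p q r s N T' M" and Q: "quad F p q r s" and sp: "{s, p} \<notin> tri_edges_of F"
      by blast
    have t: "tri N x p q" "tri T' x q r" "tri M x r s" using f by (auto simp: fan_def)
    have mem: "N \<in> Fs" "T' \<in> Fs" "M \<in> Fs" "N \<noteq> F" "T' \<noteq> F" "M \<noteq> F"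
      using t[THEN tri_edges] t[THEN card_tri] q(1) by auto
    have te: "{p, q} \<in> bd N" "{q, r} \<in> bd T'" "{r, s} \<in> bd M"
      using t[THEN tri_edges] by auto
    have qe: "{p, q} \<in> bd F" "{q, r} \<in> bd F" "{r, s} \<in> bd F"
      using quad_edges[OF Q] by auto
    have "e \<in> tri_edges_of F" using T e(1,2) by (auto simp: tri_edges_of_def)
    then consider "e = {p, q}" | "e = {q, r}" | "e = {r, s}"
      using Q sp by (auto simp: tri_edges_of_def quad_def)
    then show False
    proof cases
      case 1
      then have "T = N" using edge_two_faces[of N F T e] TF(1,2,4) mem te qe e by simp
      with fan_quad_end_recv[OF f Q] less show False by simp
    next
      case 3
      then have "T = M" using edge_two_faces[of M F T e] TF(1,2,4) mem te qe e by simp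
      moreover have "quad F s r q p" using quad_rot[OF quad_rot[OF quad_flip[OF Q]]] .
      ultimately show False using fan_quad_end_recv[OF fan_sym[OF f]] less by simp
    next
      case 2
      then have TT: "T = T'" using edge_two_faces[of T' F T e] TF(1,2,4) mem te qe e by simp
      with e'(1,2) 2 t(2) have "e' = {x, q} \<or> e' = {x, r}" by (auto simp: tri_def insert_commute)
      then have "F' = N \<or> F' = T' \<or> F' = M"
        using fan_faces(4,5)[OF f TF(3)] e'(3) by auto
      then show False using e'(4) t[THEN tri_Tri] by (auto simp: Big_def)
    qed
  qed
  have "1/2 \<le> weight e1" "1/2 \<le> weight e2"
    using bad[of e1 F1 e2 F2] bad[of e2 F2 e1 F1] e F by force+
  with recv_ge_two[OF T e] less show False by simp
qed

text \<open>A triangle may be short of charge if the surplus of its neighbours covers the deficit.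
  Requiring \<open>nbrs N = {T}\<close> keeps two triangles from drawing on the same
  neighbour.\<close>

definition good :: "'f \<Rightarrow> bool" where
  "good T \<longleftrightarrow> 1 \<le> recv T \<or>
    (\<forall>N\<in>nbrs T. 1 \<le> recv N \<and> nbrs N = {T}) \<and> 0 \<le> (recv T - 1) + (\<Sum>N\<in>nbrs T. recv N - 1)"

text \<open>If the fan closes to a wheel, the face beyond \<open>{q, r}\<close> has length at least
  7 and alone pays for \<open>T\<close>. Otherwise the three triangles form a cluster of their own,
  and its five outer edges must bring in 3.\<close>

lemma fan_good:
  assumes f: "fan c p q r s N T M"
  shows "good T"
proof (cases "\<exists>G. tri G c p s")
  case True
  then obtain G where G: "tri G c p s" by blast
  have T: "tri T c q r" "T \<in> Tri" using f tri_Tri by (auto simp: fan_def)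
  have qr: "{q, r} \<in> bd T" using tri_edges[OF T(1)] by simp
  obtain F where F: "F \<in> Big" "{q, r} \<in> bd F"
    using tri_other_face[OF T(2) qr] fan_rim_not_tri[OF f] by blast
  have "F \<in> Fs" "F \<noteq> T" using F(1) T(2) by (auto simp: Big_def)
  then have "7 \<le> card (bd F)" using closed_fan_rim[OF f G] F(2) by blast
  then have "1 \<le> weight {q, r}"
    using weight_eq[OF F(1) T(2) qr F(2)] share_ge(3)[OF F(1) tri_edge_count_pos[OF F(1) T(2) qr F(2)]]
    by simp
  then have "1 \<le> recv T"
    using fan_recv(2)[OF f] weight_nonneg[of "{c, q}"] weight_nonneg[of "{c, r}"] by linarith
  then show ?thesis by (simp add: good_def)
next
  case no: False
  note f' = fan_sym[OF f]
  have t: "tri N c p q" "tri T c q r" "tri M c r s" using f by (auto simp: fan_def)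
  note tT = t[THEN tri_Tri] and te = t[THEN tri_edges]
  have nw: "G = N" if "tri G c p w" for G w
    using fan_outer_spoke[OF f that] no that by blast
  have nw': "G = M" if "tri G c s w" for G w
    using fan_outer_spoke[OF f' that] no that tri_swap by blast
  have NN: "e = {q, c} \<and> K = T" if "K \<in> Tri" "e \<in> bd K" "e \<in> bd N" "K \<noteq> N" for K e
    by (rule fan_nbrs_end[OF f _ that]) (rule nw)
  have MM: "e = {r, c} \<and> K = T" if "K \<in> Tri" "e \<in> bd K" "e \<in> bd M" "K \<noteq> M" for K e
    by (rule fan_nbrs_end[OF f' _ that]) (rule nw')
  have d: "distinct [c, p, q, r, s]" using f by (simp add: fan_def)
  have ne: "{c, p} \<noteq> {q, c}" "{p, q} \<noteq> {q, c}" "{c, s} \<noteq> {r, c}" "{s, r} \<noteq> {r, c}"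
    using d by (auto simp: doubleton_eq_iff)
  have e: "{c, p} \<in> bd N" "{p, q} \<in> bd N" "{q, r} \<in> bd T" "{s, r} \<in> bd M" "{c, s} \<in> bd M"
    "{q, c} \<in> bd N" "{q, c} \<in> bd T" "{r, c} \<in> bd T" "{r, c} \<in> bd M"
    using te by (auto simp: insert_commute)
  obtain F1 where F1: "F1 \<in> Big" "{c, p} \<in> bd F1"
    using tri_other_face[OF tT(1) e(1)] NN e(1) ne(1) by blast
  obtain F2 where F2: "F2 \<in> Big" "{p, q} \<in> bd F2"
    using tri_other_face[OF tT(1) e(2)] NN e(2) ne(2) by blast
  obtain F3 where F3: "F3 \<in> Big" "{q, r} \<in> bd F3"
    using tri_other_face[OF tT(2) e(3)] fan_rim_not_tri[OF f] by blast
  obtain F4 where F4: "F4 \<in> Big" "{s, r} \<in> bd F4"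
    using tri_other_face[OF tT(3) e(4)] MM e(4) ne(4) by blast
  obtain F5 where F5: "F5 \<in> Big" "{c, s} \<in> bd F5"
    using tri_other_face[OF tT(3) e(5)] MM e(5) ne(3) by blast
  have sub: "K = T" if "K \<in> nbrs N \<or> K \<in> nbrs M" for K
    using that
  proof
    assume "K \<in> nbrs N"
    then obtain e where "K \<in> Tri" "K \<noteq> N" "e \<in> bd K" "e \<in> bd N" unfolding nbrs_def by blast
    then show ?thesis using NN[of K e] by simp
  next
    assume "K \<in> nbrs M"
    then obtain e where "K \<in> Tri" "K \<noteq> M" "e \<in> bd K" "e \<in> bd M" unfolding nbrs_def by blast
    then show ?thesis using MM[of K e] by simp
  qed
  have "{q, c} \<in> bd T \<inter> bd N" "{r, c} \<in> bd T \<inter> bd M" using e by simp_all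
  then have "T \<in> nbrs N" "T \<in> nbrs M"
    using tT(2) fan_faces(1,2)[OF f] unfolding nbrs_def by blast+
  with sub have "nbrs N = {T}" "nbrs M = {T}" by blast+
  moreover have nT: "nbrs T = {N, M}"
  proof -
    have "K = N \<or> K = M" if K: "K \<in> Tri" "K \<noteq> T" "e \<in> bd K" "e \<in> bd T" for K e
    proof -
      have "e = {c, q} \<or> e = {q, r} \<or> e = {c, r}" using K(4) t(2) by (auto simp: tri_def)
      then show ?thesis
        using fan_rim_not_tri[OF f K(1)] fan_faces(4,5)[OF f, of K] K by (auto simp: Tri_def)
    qed
    then have "K = N \<or> K = M" if "K \<in> nbrs T" for K
      using that unfolding nbrs_def by blast
    moreover have "{q, c} \<in> bd N \<inter> bd T" "{r, c} \<in> bd M \<inter> bd T" using e by simp_all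
    then have "N \<in> nbrs T" "M \<in> nbrs T"
      using tT(1,3) fan_faces(1,2)[OF f] unfolding nbrs_def by blast+
    ultimately show ?thesis by blast
  qed
  moreover have "1 \<le> recv N \<and> 1 \<le> recv M \<and> 3 \<le> recv N + recv T + recv M"
  proof (cases "\<exists>Q. quad Q p q r s")
    case True
    then obtain Q where Q: "quad Q p q r s" by blast
    have Q': "quad Q s r q p" using quad_rot[OF quad_rot[OF quad_flip[OF Q]]] .
    have qe: "{p, q} \<in> bd Q" "{q, r} \<in> bd Q" "{s, r} \<in> bd Q"
      using quad_edges[OF Q] by (auto simp: insert_commute)
    \<comment> \<open>The rim quadrilateral gives 1/3 to each triangle, and the faces beyond the two
      end spokes give 1 each: 3 in total.\<close>
    have "1/3 \<le> weight {p, q}" "1/3 \<le> weight {q, r}" "1/3 \<le> weight {s, r}"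
      using weight_bounds(1)[OF tT(1) quad_Big[OF Q] e(2) qe(1) card_quad[OF Q]]
        weight_bounds(1)[OF tT(2) quad_Big[OF Q] e(3) qe(2) card_quad[OF Q]]
        weight_bounds(1)[OF tT(3) quad_Big[OF Q] e(4) qe(3) card_quad[OF Q]] by auto
    then show ?thesis
      using fan_quad_end_weight[OF f Q] fan_quad_end_weight[OF f' Q'] fan_recv[OF f]
        weight_nonneg[of "{c, q}"] weight_nonneg[of "{c, r}"] by (simp add: insert_commute)
  next
    case nq: False
    have nq': "\<not> quad Q s r q p" for Q
      using nq quad_rot[OF quad_rot[OF quad_flip[of Q s r q p]]] by blast
    have FF: "F1 \<in> Fs" "F2 \<in> Fs" "F3 \<in> Fs" "F4 \<in> Fs" "F5 \<in> Fs"
      using F1 F2 F3 F4 F5 by (auto simp: Big_def)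
    \<comment> \<open>No outer edge borders a quadrilateral with two triangle edges, so each of the
      five carries 3/5.\<close>
    have "3/5 \<le> weight {c, p}"
      using weight_bounds(3)[OF tT(1) F1(1) e(1) F1(2)] fan_quad_spoke_end[OF f F1(1) _ _ F1(2)]
      by force
    moreover have "3/5 \<le> weight {p, q}"
      using weight_bounds(3)[OF tT(1) F2(1) e(2) F2(2)] fan_quad_rim_end[OF f _ F2(1) _ _ F2(2)] nw nq
      by force
    moreover have "3/5 \<le> weight {q, r}"
      using weight_bounds(3)[OF tT(2) F3(1) e(3) F3(2)] fan_quad_rim_middle[OF f FF(3) _ F3(2)] nq
      by force
    moreover have "3/5 \<le> weight {s, r}"
      using weight_bounds(3)[OF tT(3) F4(1) e(4) F4(2)] fan_quad_rim_end[OF f' _ F4(1) _ _ F4(2)] nw' nq'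
      by force
    moreover have "3/5 \<le> weight {c, s}"
      using weight_bounds(3)[OF tT(3) F5(1) e(5) F5(2)] fan_quad_spoke_end[OF f' F5(1) _ _ F5(2)]
      by force
    ultimately show ?thesis
      using fan_recv[OF f] weight_nonneg[of "{c, q}"] weight_nonneg[of "{c, r}"]
      by (simp add: insert_commute)
  qed
  ultimately show ?thesis
    using fan_faces(3)[OF f] by (simp add: good_def)
qed

text \<open>Of the three edges, two border no further triangle or two do. In the second case the two
  edges share a vertex, and the further triangles form a fan around it with \<open>T\<close> in the
  middle.\<close>

lemma all_good:
  assumes "T \<in> Tri"
  shows "good T"
proof -
  have T: "T \<in> Fs" "card (bd T) = 3" using assms by (auto simp: Tri_def)
  obtain e where e: "e \<in> bd T" using bd_nonempty[OF T(1)] by blast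
  then have "card e = 2" using bd_E[OF T(1)] edges by blast
  then obtain a b where "e = {a, b}" by (auto simp: card_2_iff)
  then obtain c where t: "tri T a b c" using triE[OF T] e by blast
  have ne: "{a, b} \<noteq> {b, c}" "{b, c} \<noteq> {c, a}" "{a, b} \<noteq> {c, a}"
    using tri_adj[OF t] by (auto simp: doubleton_eq_iff)
  define I where "I e \<longleftrightarrow> (\<exists>K\<in>Tri. K \<noteq> T \<and> e \<in> bd K)" for e
  have outer: "good T" if h: "\<not> I e" "\<not> I e'" "e \<in> bd T" "e' \<in> bd T" "e \<noteq> e'" for e e'
  proof -
    obtain F where F: "F \<in> Big" "e \<in> bd F" using tri_other_face[OF assms h(3)] h(1) I_def by blast
    obtain F' where F': "F' \<in> Big" "e' \<in> bd F'"
      using tri_other_face[OF assms h(4)] h(2) I_def by blast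
    show ?thesis using recv_two_outer[OF assms h(3,4,5) F F'] by (simp add: good_def)
  qed
  have inner: "good T" if t: "tri T a b c" and I: "I {a, b}" "I {b, c}" for a b c
  proof -
    obtain N where N: "N \<in> Tri" "N \<noteq> T" "{a, b} \<in> bd N" using I(1) I_def by blast
    obtain M where M: "M \<in> Tri" "M \<noteq> T" "{b, c} \<in> bd M" using I(2) I_def by blast
    obtain x where x: "tri N a b x" using triE[of N a b] N by (auto simp: Tri_def)
    obtain y where y: "tri M b c y" using triE[of M b c] M by (auto simp: Tri_def)
    have "fan b x a c y N T M"
      by (rule fanI) (use x y t N(2) M(2) tri_rot tri_flip tri_swap in blast)+
    then show ?thesis by (rule fan_good)
  qed
  have t1: "tri T b c a" "tri T c a b" using t tri_rot by blast+
  show ?thesis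
    using outer[of "{a, b}" "{b, c}"] outer[of "{b, c}" "{c, a}"] outer[of "{a, b}" "{c, a}"]
      inner[OF t] inner[OF t1(1)] inner[OF t1(2)] tri_edges[OF t] ne by blast
qed

text \<open>The neighbour sets of deficient triangles are disjoint by \<open>good\<close>, and their
  members are not deficient, so no surplus is spent twice.\<close>

lemma sum_recv_ge: "real (card Tri) \<le> (\<Sum>T\<in>Tri. recv T)"
proof -
  define Neg where "Neg = {T \<in> Tri. recv T < 1}"
  define Pos where "Pos = (\<Union>T\<in>Neg. nbrs T)"
  have fin: "finite Neg" "finite Tri" "finite (nbrs T)" for T
    using finite_Tri by (auto simp: Neg_def nbrs_def)
  have neg: "N \<in> nbrs T \<Longrightarrow> 1 \<le> recv N \<and> nbrs N = {T}"
    "0 \<le> (recv T - 1) + (\<Sum>N\<in>nbrs T. recv N - 1)" if "T \<in> Neg" for T N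
    using all_good[of T] that by (auto simp: good_def Neg_def)
  have PosTri: "Pos \<subseteq> Tri - Neg" using neg(1) by (fastforce simp: Pos_def Neg_def nbrs_def)
  have "(\<Sum>N\<in>Pos. recv N - 1) = (\<Sum>T\<in>Neg. \<Sum>N\<in>nbrs T. recv N - 1)"
    unfolding Pos_def
  proof (rule sum.UNION_disjoint[OF fin(1)])
    show "\<forall>T\<in>Neg. \<forall>T'\<in>Neg. T \<noteq> T' \<longrightarrow> nbrs T \<inter> nbrs T' = {}"
    proof (intro ballI impI equals0I)
      fix T T' N assume "T \<in> Neg" "T' \<in> Neg" "T \<noteq> T'" "N \<in> nbrs T \<inter> nbrs T'"
      then show False using neg(1)[of T N] neg(1)[of T' N] by simp
    qed
  qed (use fin in blast)
  moreover have "(\<Sum>N\<in>Pos. recv N - 1) \<le> (\<Sum>N\<in>Tri - Neg. recv N - 1)"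
    by (rule sum_mono2) (use fin PosTri in \<open>auto simp: Neg_def\<close>)
  moreover have "(\<Sum>T\<in>Tri. recv T - 1) = (\<Sum>T\<in>Tri - Neg. recv T - 1) + (\<Sum>T\<in>Neg. recv T - 1)"
    by (rule sum.subset_diff) (use fin in \<open>auto simp: Neg_def\<close>)
  moreover have "0 \<le> (\<Sum>T\<in>Neg. (recv T - 1) + (\<Sum>N\<in>nbrs T. recv N - 1))"
    using neg(2) by (rule sum_nonneg)
  ultimately have "0 \<le> (\<Sum>T\<in>Tri. recv T - 1)"
    by (simp add: sum.distrib)
  then show ?thesis by (simp add: sum_subtractf)
qed

text \<open>The charges \<open>2 k - 7\<close> add up to \<open>4 * card E - 7 * card Fs\<close>,
  and those of the big faces pay for the 1 that each triangle lacks.\<close>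

theorem face_count: "7 * card Fs \<le> 4 * card E"
proof -
  have "(\<Sum>F\<in>Fs. card (bd F)) = (\<Sum>F\<in>Fs. \<Sum>e\<in>E. if e \<in> bd F then 1 else 0)"
    using bd_E finite_E by (intro sum.cong refl) (simp add: sum.If_cases Int_absorb1 Int_commute)
  also have "\<dots> = (\<Sum>e\<in>E. \<Sum>F\<in>Fs. if e \<in> bd F then 1 else 0)" by (rule sum.swap)
  also have "\<dots> = (\<Sum>e\<in>E. card {F \<in> Fs. e \<in> bd F})"
    using finite_Fs by (simp add: sum.If_cases Collect_conj_eq)
  also have "\<dots> = 2 * card E" using two_faces by simp
  finally have total: "(\<Sum>F\<in>Fs. card (bd F)) = 2 * card E" .
  have split: "sum g Fs = sum g Big + sum g Tri" for g :: "'f \<Rightarrow> real"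
    unfolding Big_def by (rule sum.subset_diff) (use finite_Fs in \<open>auto simp: Tri_def\<close>)
  have "(\<Sum>F\<in>Tri. 2 * real (card (bd F)) - 7) = - real (card Tri)"
    by (simp add: Tri_def)
  then have "0 \<le> (\<Sum>F\<in>Fs. 2 * real (card (bd F)) - 7)"
    using split sum_recv_le sum_recv_ge by simp
  also have "\<dots> = 2 * real (\<Sum>F\<in>Fs. card (bd F)) - 7 * real (card Fs)"
    by (simp add: sum_subtractf sum_distrib_left)
  finally show ?thesis using total by simp
qed

end

section \<open>Reduction to the 2-connected case\<close>

context cyclic_plane_drawing
begin

lemma pos_V_curve:
  assumes "v \<in> V"
  obtains e where "e \<in> E" "v \<in> e" "pos v \<in> path_image (curve e)"
proof -
  have "star E v \<noteq> {}" using min_degree[OF assms] by auto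
  then show ?thesis using that pos_in_curve by (auto simp: star_def)
qed

lemma pos_V_img: "v \<in> V \<Longrightarrow> pos v \<in> img E"
  by (rule pos_V_curve) (auto simp: img_def)

lemma mid_not_pos:
  assumes e: "e \<in> E"
  shows "curve e (1/2) \<notin> pos ` V"
proof
  assume "curve e (1/2) \<in> pos ` V"
  then obtain v where v: "v \<in> V" "curve e (1/2) = pos v" by auto
  have m: "curve e (1/2) \<in> path_image (curve e)" "curve e (1/2) \<notin> pos ` e"
    using mid_curve[OF e] by auto
  obtain f where f: "f \<in> E" "v \<in> f" "pos v \<in> path_image (curve f)"
    using pos_V_curve[OF v(1)] .
  moreover have "f \<noteq> e" using f(2) m(2) v(2) by auto
  ultimately show False using curve_Int[OF f(1) e] m v(2) by auto
qed

text \<open>The open set \<open>side E e\<close> contains a point of the closure of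
  \<open>F\<close>, hence meets \<open>F\<close>, and \<open>F\<close> is connected and avoids the
  other edges.\<close>

lemma face_meets_side:
  assumes F: "F \<in> faces E" and e: "e \<in> E" and p: "p \<in> closure F" "p \<in> side E e"
  shows "e \<in> boundary F"
proof -
  have "side E e \<inter> F \<noteq> {}"
    using open_Int_closure_eq_empty[OF open_side[OF order_refl], of e F] p by blast
  moreover have "F \<subseteq> - img (E - {e})" "connected F"
    using face_facts[OF F] img_mono[of "E - {e}" E] by auto
  ultimately have "F \<subseteq> side E e"
    using components_maximal[of "side E e" "- img (E - {e})" F] side_in_faces[OF e order_refl]
    unfolding faces_def by blast
  with e show ?thesis by (simp add: boundary_def)
qed

text \<open>If no edge bounded \<open>F\<close>, its closure would add at most vertex positions.
  Then \<open>F\<close> would be open and closed in the plane minus finitely many points, which is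
  connected, although the midpoint of an edge is not in \<open>F\<close>.\<close>

lemma boundary_nonempty:
  assumes F: "F \<in> faces E" and "V \<noteq> {}"
  shows "boundary F \<noteq> {}"
proof
  assume no: "boundary F = {}"
  have opE: "open (- img E)" by (rule open_Compl_img) simp
  have opF: "open F" using open_components[OF opE] F by (simp add: faces_def)
  have cl: "p \<in> F \<or> p \<in> pos ` V" if p: "p \<in> closure F" for p
  proof (rule ccontr)
    assume *: "\<not> ?thesis"
    show False
    proof (cases "p \<in> img E")
      case True
      then obtain e where e: "e \<in> E" "p \<in> path_image (curve e)" by (auto simp: img_def)
      have "p \<notin> pos ` e" using * edge_V[OF e(1)] by auto
      then have "p \<notin> img (E - {e})" using curve_img_Int[OF e(1), of "E - {e}"] e(2) by auto
      then have "p \<in> side E e" using curve_minus_subset_side[OF e(1) order_refl] e(2) by auto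
      from face_meets_side[OF F e(1) p this] no show False by simp
    next
      case False
      let ?G = "connected_component_set (- img E) p"
      have "open ?G" by (rule open_connected_component[OF opE])
      moreover have pG: "p \<in> ?G" using False by simp
      ultimately have "?G \<inter> F \<noteq> {}"
        using open_Int_closure_eq_empty[of ?G F] p by blast
      moreover have "?G \<in> faces E" using False by (simp add: faces_def componentsI)
      ultimately have "?G = F" using faces_disjoint[OF _ F] by blast
      with pG * show False by simp
    qed
  qed
  obtain v where "v \<in> V" using assms(2) by blast
  then have "star E v \<noteq> {}" using min_degree[of v] by auto
  then obtain e where e: "e \<in> E" by (auto simp: star_def)
  have "connected (UNIV - pos ` V)"
    by (rule connected_open_diff_countable)
      (use finite_V in \<open>auto intro: countable_finite\<close>)
  moreover have "UNIV - pos ` V \<subseteq> F \<union> - closure F" using cl by blast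
  moreover have "F \<inter> (UNIV - pos ` V) \<noteq> {}"
  proof -
    have "F \<inter> pos ` V = {}" using pos_V_img face_facts[OF F] by auto
    then show ?thesis using face_facts[OF F] by blast
  qed
  moreover have "- closure F \<inter> (UNIV - pos ` V) \<noteq> {}"
  proof -
    have "curve e (1/2) \<notin> closure F"
      using face_meets_side[OF F e _ mid_in_side[OF e order_refl]] no by blast
    then show ?thesis using mid_not_pos[OF e] by blast
  qed
  moreover have "F \<inter> - closure F \<inter> (UNIV - pos ` V) = {}" using closure_subset[of F] by blast
  ultimately show False
    using connectedD[of "UNIV - pos ` V" F "- closure F"] opF by auto
qed

lemma edge_bound_2_connected:
  assumes "\<And>v. v \<in> V \<Longrightarrow> 3 \<le> card (star E v)"
    and "\<And>X. X \<subseteq> V \<Longrightarrow> X \<noteq> {} \<Longrightarrow> X \<noteq> V \<Longrightarrow> \<exists>x\<in>X. \<exists>y\<in>V - X. {x, y} \<in> E"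
    and "6 \<le> card V" "\<not> contains_K4 V E" "\<not> contains_C6 V E"
  shows "3 * card E + 14 \<le> 7 * card V"
proof -
  have "V \<noteq> {}" using assms(3) by auto
  have "face_system V E (faces E) boundary"
    using assms \<open>V \<noteq> {}\<close> finite_V finite_faces edge_V card_edge boundary_nonempty
      two_faces even_boundary link_connected
    by unfold_locales (auto simp: boundary_def)
  then have "7 * card (faces E) \<le> 4 * card E" by (rule face_system.face_count)
  with card_faces_ge[OF \<open>V \<noteq> {}\<close>] show ?thesis by linarith
qed

end

lemma set_ledges: "2 \<le> length p \<Longrightarrow> set p = \<Union>(ledges p)"
proof (induction p rule: ledges.induct)
  case (1 x y p)
  then show ?case by (cases p) auto
qed auto

section \<open>Properties inherited by subgraphs, and graphs with at most six vertices\<close>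

definition K4_C6_free_planar :: "'a set \<Rightarrow> 'a set set \<Rightarrow> bool" where
  "K4_C6_free_planar V E \<longleftrightarrow>
    simple_graph V E \<and> planar V E \<and> \<not> contains_K4 V E \<and> \<not> contains_C6 V E"

lemma planar_subgraph:
  assumes "simple_graph V E" "planar V E" "W \<subseteq> V" "D \<subseteq> E" "\<forall>e\<in>D. e \<subseteq> W"
  shows "planar W D"
proof -
  obtain pos and curve :: "'a set \<Rightarrow> real \<Rightarrow> complex" where pc: "inj_on pos V"
    "\<forall>e\<in>E. arc (curve e) \<and> {pathstart (curve e), pathfinish (curve e)} = pos ` e \<and>
      path_image (curve e) \<inter> pos ` V = pos ` e"
    "\<forall>e\<in>E. \<forall>e'\<in>E. e \<noteq> e' \<longrightarrow>
      path_image (curve e) \<inter> path_image (curve e') \<subseteq> pos ` (e \<inter> e')"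
    using assms(2) unfolding planar_def by blast
  have "path_image (curve e) \<inter> pos ` W = pos ` e" if "e \<in> D" for e
  proof -
    have "e \<in> E" "e \<subseteq> W" using that assms(4,5) by blast+
    then have "path_image (curve e) \<inter> pos ` V = pos ` e" "pos ` e \<subseteq> pos ` W"
      using pc(2) by blast+
    then show ?thesis using assms(3) by blast
  qed
  moreover have "inj_on pos W" using pc(1) assms(3) inj_on_subset by blast
  moreover have "\<forall>e\<in>D. arc (curve e) \<and> {pathstart (curve e), pathfinish (curve e)} = pos ` e"
    using pc(2) subsetD[OF assms(4)] by simp
  moreover have "\<forall>e\<in>D. \<forall>e'\<in>D. e \<noteq> e' \<longrightarrow>
      path_image (curve e) \<inter> path_image (curve e') \<subseteq> pos ` (e \<inter> e')"
    using pc(3) subsetD[OF assms(4)] by simp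
  ultimately show ?thesis
    unfolding planar_def by (intro exI[of _ pos] exI[of _ curve]) simp
qed

lemma K4_C6_free_planar_subgraph:
  assumes "K4_C6_free_planar V E" "W \<subseteq> V" "D \<subseteq> E" "\<forall>e\<in>D. e \<subseteq> W"
  shows "K4_C6_free_planar W D"
proof -
  have "simple_graph W D"
    using assms finite_subset[of W V] by (auto simp: K4_C6_free_planar_def simple_graph_def)
  moreover have "planar W D"
    using planar_subgraph[OF _ _ assms(2-4)] assms(1) by (simp add: K4_C6_free_planar_def)
  moreover have "\<not> contains_K4 W D"
  proof
    assume "contains_K4 W D"
    then obtain f :: "nat \<Rightarrow> 'a" where f: "inj_on f {0..<4}" "f ` {0..<4} \<subseteq> W" "\<forall>i<4. \<forall>j<4. i \<noteq> j \<longrightarrow> {f i, f j} \<in> D"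
      unfolding contains_K4_def by (elim exE conjE)
    have "f ` {0..<4} \<subseteq> V" using f(2) assms(2) by (rule subset_trans)
    moreover have "\<forall>i<4. \<forall>j<4. i \<noteq> j \<longrightarrow> {f i, f j} \<in> E" using f(3) subsetD[OF assms(3)] by simp
    ultimately have "contains_K4 V E"
      unfolding contains_K4_def using f(1) by (intro exI[of _ f] conjI)
    with assms(1) show False by (simp add: K4_C6_free_planar_def)
  qed
  moreover have "\<not> contains_C6 W D"
  proof
    assume "contains_C6 W D"
    then obtain f :: "nat \<Rightarrow> 'a" where f: "inj_on f {0..<6}" "f ` {0..<6} \<subseteq> W" "\<forall>i<6. {f i, f ((i + 1) mod 6)} \<in> D"
      unfolding contains_C6_def by (elim exE conjE)
    have "f ` {0..<6} \<subseteq> V" using f(2) assms(2) by (rule subset_trans)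
    moreover have "\<forall>i<6. {f i, f ((i + 1) mod 6)} \<in> E" using f(3) subsetD[OF assms(3)] by simp
    ultimately have "contains_C6 V E"
      unfolding contains_C6_def using f(1) by (intro exI[of _ f] conjI)
    with assms(1) show False by (simp add: K4_C6_free_planar_def)
  qed
  ultimately show ?thesis by (simp add: K4_C6_free_planar_def)
qed

lemma star_subset_image:
  assumes "simple_graph V E"
  shows "star E v \<subseteq> (\<lambda>w. {v, w}) ` {w \<in> V - {v}. {v, w} \<in> E}"
proof
  fix e assume "e \<in> star E v"
  then have e: "e \<in> E" "v \<in> e" "e \<subseteq> V" "card e = 2"
    using assms by (auto simp: star_def simple_graph_def)
  then obtain a b where "e = {a, b}" "a \<noteq> b" by (auto simp: card_2_iff)
  with e obtain w where "e = {v, w}" "w \<noteq> v" by blast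
  with e show "e \<in> (\<lambda>w. {v, w}) ` {w \<in> V - {v}. {v, w} \<in> E}" by blast
qed

lemma degree_le_neighbours:
  assumes "simple_graph V E"
  shows "card (star E v) \<le> card {w \<in> V - {v}. {v, w} \<in> E}"
proof -
  have "finite {w \<in> V - {v}. {v, w} \<in> E}" using assms by (simp add: simple_graph_def)
  then show ?thesis using star_subset_image[OF assms] by (rule surj_card_le)
qed

lemma delete_vertex:
  assumes "simple_graph V E"
  shows "card E = card {e \<in> E. v \<notin> e} + card (star E v)"
proof -
  have "finite E" using assms finite_subset[of E "Pow V"] by (auto simp: simple_graph_def)
  moreover have "E = {e \<in> E. v \<notin> e} \<union> star E v" by (auto simp: star_def)
  ultimately show ?thesis
    using card_Un_disjoint[of "{e \<in> E. v \<notin> e}" "star E v"] by (auto simp: star_def)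
qed

text \<open>If every degree were at least \<open>card V - 1\<close>, the graph would be complete,
  and any four vertices would form a K4.\<close>

lemma K4_free_low_degree:
  assumes g: "simple_graph V E" and "4 \<le> card V" and "\<not> contains_K4 V E"
  shows "\<exists>v\<in>V. card (star E v) + 2 \<le> card V"
proof (rule ccontr)
  assume *: "\<not> ?thesis"
  have fin: "finite V" using g by (simp add: simple_graph_def)
  have complete: "{v, w} \<in> E" if vw: "v \<in> V" "w \<in> V" "v \<noteq> w" for v w
  proof (rule ccontr)
    assume "{v, w} \<notin> E"
    then have "{x \<in> V - {v}. {v, x} \<in> E} \<subseteq> V - {v, w}" by auto
    then have "card {x \<in> V - {v}. {v, x} \<in> E} \<le> card (V - {v, w})"
      using fin by (intro card_mono) auto
    also have "\<dots> = card V - 2" using vw by (subst card_Diff_subset) auto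
    finally have "card (star E v) \<le> card V - 2" using degree_le_neighbours[OF g, of v] by linarith
    with * vw(1) assms(2) show False by force
  qed
  obtain S where S: "S \<subseteq> V" "card S = 4" "finite S"
    using obtain_subset_with_card_n[OF assms(2)] by metis
  then obtain f where "bij_betw f {0..<4::nat} S"
    using ex_bij_betw_nat_finite[OF S(3)] by auto
  then have f: "inj_on f {0..<4}" "f ` {0..<4} = S" by (auto simp: bij_betw_def)
  have "{f i, f j} \<in> E" if "i < 4" "j < 4" "i \<noteq> j" for i j
  proof (rule complete)
    show "f i \<in> V" "f j \<in> V" using f(2) S(1) that by auto
    show "f i \<noteq> f j" using inj_onD[OF f(1)] that by auto
  qed
  with f have "contains_K4 V E"
    unfolding contains_K4_def using S(1) by blast
  with assms(3) show False ..
qed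

lemma small_edge_bounds:
  assumes "K4_C6_free_planar V E"
  shows "card V \<le> 1 \<Longrightarrow> card E = 0" "card V = 2 \<Longrightarrow> card E \<le> 1" "card V = 3 \<Longrightarrow> card E \<le> 3"
    "card V = 4 \<Longrightarrow> card E \<le> 5" "card V = 5 \<Longrightarrow> card E \<le> 8"
proof -
  \<comment> \<open>Complete graphs up to three vertices; then deleting a vertex that misses another
    one gives 3 + 2 and 5 + 3.\<close>
  define b :: "nat \<Rightarrow> nat" where "b n = [0, 0, 1, 3, 5, 8] ! n" for n
  have "card E \<le> b (card V)" if "card V \<le> 5"
    using assms that
  proof (induction "card V" arbitrary: V E)
    case 0
    then have "V = {}" "simple_graph V E" by (auto simp: K4_C6_free_planar_def simple_graph_def)
    then have "E = {}" by (fastforce simp: simple_graph_def)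
    then show ?case by simp
  next
    case (Suc n)
    have g: "simple_graph V E" "finite V" "\<not> contains_K4 V E"
      using Suc.prems by (auto simp: K4_C6_free_planar_def simple_graph_def)
    have "\<exists>v\<in>V. card (star E v) + (if 4 \<le> card V then 2 else 1) \<le> card V"
    proof (cases "4 \<le> card V")
      case True
      then show ?thesis using K4_free_low_degree[OF g(1) _ g(3)] by simp
    next
      case False
      obtain v where v: "v \<in> V" using Suc.hyps(2) by fastforce
      have "card {w \<in> V - {v}. {v, w} \<in> E} \<le> card (V - {v})" using g(2) by (intro card_mono) auto
      then have "card (star E v) + 1 \<le> card V"
        using degree_le_neighbours[OF g(1), of v] v g(2) Suc.hyps(2) by simp
      with False v show ?thesis by auto
    qed
    then obtain v where v: "v \<in> V" "card (star E v) + (if 4 \<le> card V then 2 else 1) \<le> card V" by blast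
    have "K4_C6_free_planar (V - {v}) {e \<in> E. v \<notin> e}"
      by (rule K4_C6_free_planar_subgraph[OF Suc.prems(1)]) (use g(1) in \<open>auto simp: simple_graph_def\<close>)
    moreover have n: "n = card (V - {v})" using Suc.hyps(2) v(1) g(2) by simp
    ultimately have "card {e \<in> E. v \<notin> e} \<le> b n"
      using Suc.hyps(1)[of "V - {v}"] Suc.prems(2) Suc.hyps(2) by simp
    moreover have "n = 0 \<or> n = 1 \<or> n = 2 \<or> n = 3 \<or> n = 4" using Suc.hyps(2) Suc.prems(2) by auto
    ultimately show ?case
      using delete_vertex[OF g(1), of v] v(2) Suc.hyps(2)[symmetric]
      by (auto simp: b_def eval_nat_numeral)
  qed
  note this[unfolded b_def]
  then show "card V \<le> 1 \<Longrightarrow> card E = 0" "card V = 2 \<Longrightarrow> card E \<le> 1" "card V = 3 \<Longrightarrow> card E \<le> 3"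
    "card V = 4 \<Longrightarrow> card E \<le> 5" "card V = 5 \<Longrightarrow> card E \<le> 8"
    by (auto simp: le_Suc_eq)
qed

text \<open>Deleting \<open>v\<close> would by itself allow 8 + 2 = 10 edges on six vertices, one
  too many. With 8 edges on the other five, each of these misses at most one other; then some path
  from one neighbour of \<open>v\<close> to the other visits all five, and \<open>v\<close> closes
  it to a 6-cycle.\<close>

lemma six_vertices_degree_2:
  assumes g: "K4_C6_free_planar V E" "card V = 6" and v: "v \<in> V" "card (star E v) = 2"
    and e: "card {e \<in> E. v \<notin> e} = 8"
  shows False
proof -
  let ?W = "V - {v}" and ?D = "{e \<in> E. v \<notin> e}"
  have sg: "simple_graph V E" "\<not> contains_C6 V E" "finite V"
    using g(1) by (auto simp: K4_C6_free_planar_def simple_graph_def)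
  have cW: "card ?W = 5" using g(2) v(1) sg(3) by simp
  have gW: "K4_C6_free_planar ?W ?D"
    by (rule K4_C6_free_planar_subgraph[OF g(1)]) (use sg(1) in \<open>auto simp: simple_graph_def\<close>)
  have sW: "simple_graph ?W ?D" using gW by (simp add: K4_C6_free_planar_def)
  \<comment> \<open>A vertex missing two others has degree at most 2, and the remaining four carry
    at most 5 edges: 7 instead of 8.\<close>
  have one_missing: "{w, s} \<in> E \<or> {w, t} \<in> E"
    if h: "w \<in> ?W" "s \<in> ?W" "t \<in> ?W" "distinct [w, s, t]" for w s t
  proof (rule ccontr)
    assume "\<not> ?thesis"
    then have "{x \<in> ?W - {w}. {w, x} \<in> ?D} \<subseteq> ?W - {w, s, t}" by auto
    then have "card {x \<in> ?W - {w}. {w, x} \<in> ?D} \<le> card (?W - {w, s, t})"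
      using sg(3) by (intro card_mono) auto
    also have "\<dots> = 2" using h cW by (subst card_Diff_subset) auto
    finally have d: "card (star ?D w) \<le> 2" using degree_le_neighbours[OF sW, of w] by linarith
    have "K4_C6_free_planar (?W - {w}) {e \<in> ?D. w \<notin> e}"
      by (rule K4_C6_free_planar_subgraph[OF gW]) (use sW in \<open>auto simp: simple_graph_def\<close>)
    moreover have "card (?W - {w}) = 4" using cW h(1) sg(3) by simp
    ultimately have "card {e \<in> ?D. w \<notin> e} \<le> 5" by (rule small_edge_bounds(4))
    then show False using delete_vertex[OF sW, of w] e d by linarith
  qed
  obtain e1 e2 where e12: "star E v = {e1, e2}" "e1 \<noteq> e2" using v(2) by (auto simp: card_2_iff)
  then have "e1 \<in> star E v" "e2 \<in> star E v" by auto
  then obtain x y where xy: "e1 = {v, x}" "e2 = {v, y}" "x \<in> ?W" "y \<in> ?W" "{v, x} \<in> E" "{v, y} \<in> E"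
    using star_subset_image[OF sg(1), of v] by blast
  have "x \<noteq> y" using xy e12(2) by auto
  have "card (?W - {x, y}) = 3" using cW xy \<open>x \<noteq> y\<close> by (subst card_Diff_subset) auto
  then obtain a b d where abd: "?W - {x, y} = {a, b, d}" "distinct [a, b, d]"
    by (auto simp: card_3_iff)
  then have W: "a \<in> ?W" "b \<in> ?W" "d \<in> ?W" and ne: "a \<noteq> x" "a \<noteq> y" "b \<noteq> x" "b \<noteq> y" "d \<noteq> x" "d \<noteq> y"
    by blast+
  have no_path: "\<not> ({x, p} \<in> E \<and> {p, q} \<in> E \<and> {q, r} \<in> E \<and> {r, y} \<in> E)"
    if "distinct [p, q, r]" "{p, q, r} \<subseteq> {a, b, d}" for p q r
  proof
    assume *: "{x, p} \<in> E \<and> {p, q} \<in> E \<and> {q, r} \<in> E \<and> {r, y} \<in> E"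
    have "p \<in> {a, b, d}" "q \<in> {a, b, d}" "r \<in> {a, b, d}" using that(2) by auto
    then have m: "p \<in> ?W - {x, y}" "q \<in> ?W - {x, y}" "r \<in> ?W - {x, y}" unfolding abd(1) .
    have "contains_C6 V E"
      by (rule contains_C6I[of v x p q r y])
        (use that(1) m xy \<open>x \<noteq> y\<close> * v(1) in \<open>auto simp: insert_commute\<close>)
    with sg(2) show False ..
  qed
  \<comment> \<open>What remains is propositional: the six orders of \<open>a\<close>,
    \<open>b\<close>, \<open>d\<close> on the path against the fact that no vertex misses two
    others.\<close>
  define A where "A s t \<longleftrightarrow> {s, t} \<in> E" for s t
  have A_sym: "A s t \<longleftrightarrow> A t s" for s t by (simp add: A_def insert_commute)
  have M: "A w s \<or> A w t" if "w \<in> ?W" "s \<in> ?W" "t \<in> ?W" "distinct [w, s, t]" for w s t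
    using one_missing[OF that] by (simp add: A_def)
  have paths: "\<not> (A x a \<and> A a b \<and> A b d \<and> A d y)" "\<not> (A x a \<and> A a d \<and> A d b \<and> A b y)"
    "\<not> (A x b \<and> A b a \<and> A a d \<and> A d y)" "\<not> (A x b \<and> A b d \<and> A d a \<and> A a y)"
    "\<not> (A x d \<and> A d a \<and> A a b \<and> A b y)" "\<not> (A x d \<and> A d b \<and> A b a \<and> A a y)"
    using no_path[of a b d] no_path[of a d b] no_path[of b a d] no_path[of b d a]
      no_path[of d a b] no_path[of d b a] abd(2) by (auto simp: A_def)
  have pairs: "A x a \<or> A x b" "A x a \<or> A x d" "A x b \<or> A x d" "A y a \<or> A y b" "A y a \<or> A y d" "A y b \<or> A y d"
    "A a b \<or> A a d" "A b a \<or> A b d" "A d a \<or> A d b" "A a b \<or> A a x" "A a b \<or> A a y" "A b a \<or> A b x"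
    "A b a \<or> A b y" "A a d \<or> A a x" "A a d \<or> A a y" "A d a \<or> A d x" "A d a \<or> A d y"
    "A b d \<or> A b x" "A b d \<or> A b y" "A d b \<or> A d x" "A d b \<or> A d y"
    "A a x \<or> A a y" "A b x \<or> A b y" "A d x \<or> A d y"
    by (rule M; use W xy(3,4) ne abd(2) \<open>x \<noteq> y\<close> in auto)+
  show False
    using paths pairs A_sym[of b a] A_sym[of d a] A_sym[of d b] A_sym[of a x] A_sym[of b x]
      A_sym[of d x] A_sym[of a y] A_sym[of b y] A_sym[of d y] by argo
qed

text \<open>An empty overlap describes a disconnected graph, an overlap of one vertex a cut
  vertex.\<close>

definition separation :: "'a set \<Rightarrow> 'a set set \<Rightarrow> 'a set \<Rightarrow> 'a set \<Rightarrow> bool" where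
  "separation V E A B \<longleftrightarrow> A \<union> B = V \<and> A \<noteq> V \<and> B \<noteq> V \<and> card (A \<inter> B) \<le> 1 \<and>
    (\<forall>e\<in>E. e \<subseteq> A \<or> e \<subseteq> B)"

text \<open>The far ends of \<open>a\<close> and \<open>z\<close> are connected after deleting
  \<open>v\<close>; otherwise the component of one of them together with \<open>v\<close> would be
  one part of a separation. A path between them closes up through \<open>v\<close>.\<close>

lemma cycle_at_vertex:
  assumes g: "simple_graph V E" and ns: "\<And>A B. \<not> separation V E A B"
    and a: "a \<in> star E v" "z \<in> star E v" "a \<noteq> z"
  shows "\<exists>C. is_cycle C \<and> C \<subseteq> E \<and> star C v = {a, z}"
proof -
  obtain x y where xy: "a = {v, x}" "z = {v, y}" "x \<in> V - {v}" "y \<in> V - {v}" "{v, x} \<in> E" "{v, y} \<in> E"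
    using star_subset_image[OF g, of v] a(1,2) by blast
  have "x \<noteq> y" using a(3) xy by auto
  have "v \<in> V" using xy(5) g by (auto simp: simple_graph_def)
  let ?D = "{e \<in> E. v \<notin> e}"
  define A where "A = {w \<in> V - {v}. (x, w) \<in> (adj_rel ?D)\<^sup>*}"
  have "y \<in> A"
  proof (rule ccontr)
    assume "y \<notin> A"
    have "e \<subseteq> insert v A \<or> e \<subseteq> V - A" if e: "e \<in> E" for e
    proof -
      have "e \<subseteq> V" "card e = 2" using g e by (auto simp: simple_graph_def)
      then obtain s t where st: "e = {s, t}" "s \<in> V" "t \<in> V" by (auto simp: card_2_iff)
      show ?thesis
      proof (cases "v \<in> e")
        case True
        then show ?thesis using st \<open>v \<in> V\<close> by (auto simp: A_def)
      next
        case False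
        then have "(s, t) \<in> adj_rel ?D" "(t, s) \<in> adj_rel ?D"
          using e st by (auto simp: adj_rel_def insert_commute)
        then have "s \<in> A \<longleftrightarrow> t \<in> A"
          using False st unfolding A_def by (auto intro: rtrancl_into_rtrancl)
        then show ?thesis using st by auto
      qed
    qed
    moreover have "insert v A \<inter> (V - A) = {v}" using \<open>v \<in> V\<close> by (auto simp: A_def)
    then have "card (insert v A \<inter> (V - A)) \<le> 1" by simp
    moreover have "x \<in> A" using xy(3) by (simp add: A_def)
    ultimately have "separation V E (insert v A) (V - A)"
      unfolding separation_def using \<open>y \<notin> A\<close> xy(3,4) \<open>v \<in> V\<close> by (auto simp: A_def)
    with ns show False by blast
  qed
  then obtain p where p: "upath ?D x p y" using rtrancl_adj_upath by (fastforce simp: A_def)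
  have len: "2 \<le> length p"
    using p \<open>x \<noteq> y\<close> by (cases p rule: ledges.cases) (auto simp: upath_def)
  have "v \<notin> set p" using set_ledges[OF len] p by (auto simp: upath_def)
  have hd: "ledges (v # p) = insert a (ledges p)"
    using p xy(1) by (cases p) (auto simp: upath_def)
  define C where "C = insert z (insert a (ledges p))"
  have "is_cycle C"
    unfolding is_cycle_def C_def using p \<open>v \<notin> set p\<close> len hd xy(2)
    by (intro exI[of _ "v # p"]) (auto simp: upath_def insert_commute)
  moreover have "C \<subseteq> E" using p xy by (auto simp: C_def upath_def)
  moreover have "star C v = {a, z}" using p xy by (auto simp: C_def upath_def star_def)
  ultimately show ?thesis by blast
qed

lemma edge_bound_no_separation:
  assumes g: "K4_C6_free_planar V E" and "6 \<le> card V" and ns: "\<And>A B. \<not> separation V E A B"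
    and deg: "\<And>v. v \<in> V \<Longrightarrow> 3 \<le> card (star E v)"
  shows "3 * card E + 14 \<le> 7 * card V"
proof -
  have g': "simple_graph V E" "planar V E" "\<not> contains_K4 V E" "\<not> contains_C6 V E"
    using g by (auto simp: K4_C6_free_planar_def)
  obtain pos and curve :: "'a set \<Rightarrow> real \<Rightarrow> complex" where pc: "inj_on pos V"
    "\<forall>e\<in>E. arc (curve e) \<and> {pathstart (curve e), pathfinish (curve e)} = pos ` e \<and>
      path_image (curve e) \<inter> pos ` V = pos ` e"
    "\<forall>e\<in>E. \<forall>e'\<in>E. e \<noteq> e' \<longrightarrow>
      path_image (curve e) \<inter> path_image (curve e') \<subseteq> pos ` (e \<inter> e')"
    using g'(2) unfolding planar_def by blast
  have "cyclic_plane_drawing V E pos curve"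
  proof
    show "\<exists>C. is_cycle C \<and> C \<subseteq> E \<and> star C v = {a, z}"
      if "a \<in> star E v" "z \<in> star E v" "a \<noteq> z" for v a z
      by (rule cycle_at_vertex[OF g'(1) ns that])
    show "2 \<le> card (star E v)" if "v \<in> V" for v using deg[OF that] by simp
  qed (use g'(1) pc in blast)+
  then show ?thesis
  proof (rule cyclic_plane_drawing.edge_bound_2_connected[OF _ deg _ assms(2) g'(3,4)])
    fix X assume X: "X \<subseteq> V" "X \<noteq> {}" "X \<noteq> V"
    have "\<not> separation V E X (V - X)" by (rule ns)
    then obtain e where e: "e \<in> E" "\<not> e \<subseteq> X" "\<not> e \<subseteq> V - X"
      using X unfolding separation_def by auto
    then have "e \<subseteq> V" "card e = 2" using g'(1) by (auto simp: simple_graph_def)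
    then obtain s t where "e = {s, t}" by (auto simp: card_2_iff)
    with e \<open>e \<subseteq> V\<close> have "s \<in> X \<and> t \<in> V - X \<and> {s, t} \<in> E \<or> t \<in> X \<and> s \<in> V - X \<and> {t, s} \<in> E"
      by (auto simp: insert_commute)
    then show "\<exists>x\<in>X. \<exists>y\<in>V - X. {x, y} \<in> E" by blast
  qed
qed

text \<open>Deleting a vertex of degree at most 2 lowers the left side by at most 6 and the right
  side by 7. Adding the bounds of two separated parts counts 14 twice, which pays for the overlap
  and for parts with fewer than six vertices, where the bound may fail.\<close>

lemma edge_bound:
  assumes "K4_C6_free_planar V E" "6 \<le> card V"
  shows "3 * card E + 14 \<le> 7 * card V"
  using assms
proof (induction "card V" arbitrary: V E rule: less_induct)
  case less
  have g: "simple_graph V E" "finite V" "finite E"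
    using less.prems(1) finite_subset[of E "Pow V"]
    by (auto simp: K4_C6_free_planar_def simple_graph_def)
  consider v where "v \<in> V" "card (star E v) \<le> 2" | A B where "separation V E A B"
    | "\<And>A B. \<not> separation V E A B" "\<And>v. v \<in> V \<Longrightarrow> 3 \<le> card (star E v)"
    by (metis Suc_leI not_less numeral_2_eq_2 numeral_3_eq_3)
  then show ?case
  proof cases
    case (1 v)
    have sub: "K4_C6_free_planar (V - {v}) {e \<in> E. v \<notin> e}"
      by (rule K4_C6_free_planar_subgraph[OF less.prems(1)])
        (use g(1) in \<open>auto simp: simple_graph_def\<close>)
    have n: "card (V - {v}) + 1 = card V" using 1(1) g(2) less.prems(2) by simp
    note e = delete_vertex[OF g(1), of v]
    show ?thesis
    proof (cases "card V = 6")
      case True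
      then have "card {e \<in> E. v \<notin> e} \<le> 8" using small_edge_bounds(5)[OF sub] n by simp
      moreover have "\<not> (card (star E v) = 2 \<and> card {e \<in> E. v \<notin> e} = 8)"
        using six_vertices_degree_2[OF less.prems(1) True 1(1)] by blast
      ultimately have "card E \<le> 9" using e 1(2) by linarith
      with True show ?thesis by simp
    next
      case False
      then have "3 * card {e \<in> E. v \<notin> e} + 14 \<le> 7 * card (V - {v})"
        using less.hyps[OF _ sub] n less.prems(2) by simp
      with e 1(2) n show ?thesis by linarith
    qed
  next
    case (2 A B)
    have AB: "A \<union> B = V" "A \<noteq> V" "B \<noteq> V" "card (A \<inter> B) \<le> 1" "\<And>e. e \<in> E \<Longrightarrow> e \<subseteq> A \<or> e \<subseteq> B"
      using 2 by (auto simp: separation_def)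
    have fin: "finite A" "finite B" using AB(1) g(2) by auto
    \<comment> \<open>The possible excess over \<open>7 * card W\<close>: it is 14 - 7 = 7 for one
      vertex and otherwise at most 3, reached by 1 edge on two vertices and by 8 edges on
      five.\<close>
    have part: "3 * card {e \<in> E. e \<subseteq> W} + 14 \<le> 7 * card W + (if card W = 1 then 7 else 3)"
      if W: "W \<subseteq> V" "W \<noteq> V" "W \<noteq> {}" for W
    proof -
      have sub: "K4_C6_free_planar W {e \<in> E. e \<subseteq> W}"
        by (rule K4_C6_free_planar_subgraph[OF less.prems(1) W(1)]) auto
      have c: "card W < card V" using W g(2) by (simp add: psubset_card_mono psubsetI)
      have "card W \<noteq> 0" using W(1,3) g(2) finite_subset by fastforce
      then consider "card W = 1" | "card W = 2" | "card W = 3" | "card W = 4" | "card W = 5" | "6 \<le> card W"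
        by linarith
      then show ?thesis
        using small_edge_bounds[OF sub] less.hyps[OF c sub] by cases auto
    qed
    have "E = {e \<in> E. e \<subseteq> A} \<union> {e \<in> E. e \<subseteq> B}" using AB(5) by auto
    then have "card E \<le> card {e \<in> E. e \<subseteq> A} + card {e \<in> E. e \<subseteq> B}"
      using card_Un_le by metis
    moreover have "A \<noteq> {}" "B \<noteq> {}" using AB(1-3) by auto
    then have "3 * card {e \<in> E. e \<subseteq> A} + 14 \<le> 7 * card A + (if card A = 1 then 7 else 3)"
      "3 * card {e \<in> E. e \<subseteq> B} + 14 \<le> 7 * card B + (if card B = 1 then 7 else 3)"
      using part[of A] part[of B] AB(1-3) by blast+
    moreover have "card A + card B = card V + card (A \<inter> B)"
      using card_Un_Int[OF fin] AB(1) by simp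
    \<comment> \<open>With one common vertex the affordable excess is 14 - 7 = 7, enough for 3 + 3
      but not for 7 + 3. A part consisting of the common vertex alone would lie inside the other
      part, which would then be all of \<open>V\<close>.\<close>
    moreover have "card A \<noteq> 1 \<and> card B \<noteq> 1" if "card (A \<inter> B) = 1"
    proof -
      have "A \<inter> B = A" if "card A = 1"
        using that \<open>card (A \<inter> B) = 1\<close> fin by (intro card_subset_eq) auto
      moreover have "A \<inter> B = B" if "card B = 1"
        using that \<open>card (A \<inter> B) = 1\<close> fin by (intro card_subset_eq) auto
      ultimately show ?thesis using AB(1-3) by blast
    qed
    moreover have "card (A \<inter> B) = 0 \<or> card (A \<inter> B) = 1" using AB(4) by linarith
    ultimately show ?thesis by (elim disjE) (auto split: if_splits)
  next
    case 3
    show ?thesis by (rule edge_bound_no_separation[OF less.prems 3])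
  qed
qed

theorem theorem3:
  fixes V :: "'a set" and E :: "'a set set"
  assumes "simple_graph V E"
    and "planar V E"
    and "card V \<ge> 6"
    and "\<forall>v\<in>V. degree E v \<ge> 3"
    and "\<not> contains_K4 V E"
    and "\<not> contains_C6 V E"
  shows "real (card E) \<le> 7 / 3 * (real (card V) - 2)"
proof -
  have "3 * card E + 14 \<le> 7 * card V"
    by (rule edge_bound) (use assms in \<open>auto simp: K4_C6_free_planar_def\<close>)
  then have "3 * real (card E) + 14 \<le> 7 * real (card V)" by linarith
  then show ?thesis by simp
qed

end
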